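(* Let $\mathbf{G}=(J,\mu,E)$ be a graphing and let $\alpha\in\mathsf{mm}_+(\rho_{\mathbf{G}})$ with Radon–Nikodym derivative $f_\alpha=\frac{d\alpha}{d\eta_{\mathbf{G}}}$. Suppose $f_\alpha$ is exposed by a function $g\in L^\infty(E,\eta_{\mathbf{G}})$, i.e. $\int_E f_\alpha g\,d\eta_{\mathbf{G}}>\int_E f_\beta g\,d\eta_{\mathbf{G}}$ for every $\beta\in\mathsf{mm}_+(\rho_{\mathbf{G}})$ with $f_\beta\ne f_\alpha$ in $L^1(E,\eta_{\mathbf{G}})$. Then $f_\alpha$ is $\{0,1\}$-valued $\eta_{\mathbf{G}}$-almost everywhere.
   Context: A graphing $\mathbf{G}=(J,\mu,E)$: $(J,\mu)$ a standard Borel probability space, $E\subseteq\binom{J}{2}$ Borel with bounded degrees, satisfying $\int_A\deg(B,x)\,d\mu(x)=\int_B\deg(A,x)\,d\mu(x)$ for all measurable $A,B\subseteq J$. Edge measure: $\eta_{\mathbf{G}}(F)=\frac12\int_J\deg_F(x)\,d\mu(x)$. Rank: $\rho_{\mathbf{G}}(F)=1-\int_J\frac{1}{|V(\mathbf{G}^F_x)|}\,d\mu(x)$, where $\mathbf{G}^F_x$ is the component of $x$ in $(J,\mu,F)$ and $1/\infty=0$. $\mathsf{mm}_+(\rho_{\mathbf{G}})$ is the set of measures $\alpha$ on $E$ with $0\le\alpha(A)\le\rho_{\mathbf{G}}(A)$ for all Borel $A$ (these satisfy $\alpha\le\eta_{\mathbf{G}}$, hence have Radon–Nikodym derivatives w.r.t.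 $\eta_{\mathbf{G}}$). *)

theory Defs
  imports "HOL-Probability.Probability" "HOL-Library.Uprod"
begin

text \<open>Vertices: a Polish space with its Borel sigma-algebra (standard Borel space).
 Edges: unordered pairs (type uprod). A set F of edges is Borel iff the
 (symmetric) set of ordered pairs it represents is Borel in the product.\<close>

definition pairs_of :: "'a uprod set \<Rightarrow> ('a \<times> 'a) set" where
  "pairs_of F = {(x, y). Upair x y \<in> F}"

definition edge_sets :: "'a::topological_space uprod set \<Rightarrow> 'a uprod set set" where
  "edge_sets E = {F. F \<subseteq> E \<and> pairs_of F \<in> sets (borel \<Otimes>\<^sub>M borel)}"

definition edge_space :: "'a::topological_space uprod set \<Rightarrow> 'a uprod measure" where
  "edge_space E = sigma E (edge_sets E)"

definition deg_in :: "'a uprod set \<Rightarrow> 'a set \<Rightarrow> 'a \<Rightarrow> nat" where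
  "deg_in F B x = card {y \<in> B. Upair x y \<in> F}"

definition deg :: "'a uprod set \<Rightarrow> 'a \<Rightarrow> nat" where
  "deg F x = card {y. Upair x y \<in> F}"

definition graphing :: "'a::polish_space measure \<Rightarrow> 'a uprod set \<Rightarrow> bool" where
  "graphing \<mu> E \<longleftrightarrow>
     prob_space \<mu> \<and> sets \<mu> = sets borel \<and>
     (\<forall>x. Upair x x \<notin> E) \<and>
     pairs_of E \<in> sets (borel \<Otimes>\<^sub>M borel) \<and>
     (\<exists>D::nat. \<forall>x. finite {y. Upair x y \<in> E} \<and> deg E x \<le> D) \<and>
     (\<forall>A \<in> sets \<mu>. \<forall>B \<in> sets \<mu>.
        (\<integral>\<^sup>+ x\<in>A. of_nat (deg_in E B x) \<partial>\<mu>) = (\<integral>\<^sup>+ x\<in>B. of_nat (deg_in E A x) \<partial>\<mu>))"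

definition edge_measure :: "'a::polish_space measure \<Rightarrow> 'a uprod set \<Rightarrow> 'a uprod measure" where
  "edge_measure \<mu> E = measure_of E (edge_sets E)
     (\<lambda>F. ennreal (1/2) * (\<integral>\<^sup>+ x. of_nat (deg F x) \<partial>\<mu>))"

definition component :: "'a uprod set \<Rightarrow> 'a \<Rightarrow> 'a set" where
  "component F x = {y. (x, y) \<in> (pairs_of F)\<^sup>*}"

text \<open>Rank; card of an infinite set is 0 and 1/0 = 0, matching the convention 1/infinity = 0.\<close>
definition rank :: "'a::polish_space measure \<Rightarrow> 'a uprod set \<Rightarrow> real" where
  "rank \<mu> F = 1 - (\<integral>x. 1 / real (card (component F x)) \<partial>\<mu>)"

definition mm_plus :: "'a::polish_space measure \<Rightarrow> 'a uprod set \<Rightarrow> 'a uprod measure set" where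
  "mm_plus \<mu> E = {\<alpha>. sets \<alpha> = sets (edge_space E) \<and>
     (\<forall>A \<in> sets (edge_space E). emeasure \<alpha> A \<le> ennreal (rank \<mu> A))}"

definition rn_density :: "'a::polish_space measure \<Rightarrow> 'a uprod set \<Rightarrow> 'a uprod measure \<Rightarrow> 'a uprod \<Rightarrow> real" where
  "rn_density \<mu> E \<alpha> = (\<lambda>e. enn2real (RN_deriv (edge_measure \<mu> E) \<alpha> e))"

end

theory Submission
  imports Defs
begin

text \<open>
  Order the edges by the exposing function \<open>g\<close>, with ties broken by a fixed Borel linear order, and let
  \<open>F\<close> be the wired maximal spanning forest of this order: an edge belongs to \<open>F\<close> if its ends lie in
  different components of the graph of all higher edges and at least one of them is finite. Fix a
  Borel linear order of the vertices and call the least vertex of a finite component its root. If the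
  edges are added from the highest one downwards, an edge of \<open>F\<close> is one at whose arrival some vertex
  stops being a root, and this vertex is unique. Mass transport then shows, for every upward closed
  edge set \<open>U\<close>, that \<open>\<eta> (F \<inter> U)\<close> is the measure of the set of non-roots of \<open>U\<close>, which is the rank of \<open>U\<close>.
  Applied to an order in which \<open>A\<close> comes before \<open>B\<close> this gives \<open>\<rho> (A \<union> B) \<le> \<rho> A + \<eta> B\<close>, hence
  \<open>\<eta> A \<le> \<rho> A\<close> for \<open>A \<subseteq> F \<inter> U\<close>. So the restriction of \<open>\<eta>\<close> to \<open>F \<inter> {g > 0}\<close> lies in \<open>mm_plus\<close>, and as
  it attains the bound \<open>\<alpha> {g > t} \<le> \<rho> {g > t}\<close> for all \<open>t \<ge> 0\<close>, it maximises the integral of \<open>g\<close>.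
  Since the maximiser is unique, \<open>\<alpha>\<close> has density \<open>1\<close> on this set and \<open>0\<close> elsewhere.

  Borel measurability of degrees and of component sizes rests on the Lusin--Novikov theorem for
  sections of bounded cardinality, which is derived from the separation of disjoint analytic sets.
\<close>

section \<open>Separation of projections of Borel sets\<close>

text \<open>Infinite components contribute 0 to the integral in the rank, so joining two of them
  leaves it unchanged, while joining a finite component to an infinite one can raise it; this is why
  the forest is wired. The order of the edges is not a well-order, so they cannot be added one at a
  time by induction; each edge is judged by itself, through the graph of the edges above it. Ties
  must be broken because edges arriving together would spoil the charging of a lost root to one
  edge. The step to \<open>\<eta> A \<le> \<rho> A\<close> rests on the fact that
  \<open>F \<inter> U\<close> and \<open>U\<close> have the same roots: \<open>\<eta> (F \<inter> U)
  = \<rho> U = \<rho> (F \<inter> U) \<le> \<rho> A + \<eta> (F \<inter> U - A)\<close>, and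
  \<open>\<eta> (F \<inter> U - A)\<close> is subtracted. Levels \<open>t \<ge> 0\<close> suffice
  because integrating the measures of the sets \<open>{g > t}\<close> over them gives the integral
  of the positive part of \<open>g\<close>; the negative part can only lower the value for \<alpha>,
  and it vanishes on \<open>F \<inter> {g > 0}\<close>.\<close>

text \<open>Suslin sets are introduced through complete sequences of countable covers, in the sense of Frolik,
  rather than as images of the Baire space: for this notion the closure properties are combinatorial.\<close>

definition complete_covers :: "(nat \<Rightarrow> nat \<Rightarrow> 'a set) \<Rightarrow> 'a::topological_space set \<Rightarrow> bool" where
  "complete_covers c P \<longleftrightarrow> (\<forall>n. P = (\<Union>i. c n i)) \<and>
     (\<forall>\<sigma>. (\<forall>n. (\<Inter>k\<le>n. c k (\<sigma> k)) \<noteq> {}) \<longrightarrow>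
        (\<exists>w\<in>P. \<forall>S. open S \<longrightarrow> w \<in> S \<longrightarrow> (\<exists>n. (\<Inter>k\<le>n. c k (\<sigma> k)) \<subseteq> S)))"

definition suslin :: "'a::topological_space set \<Rightarrow> bool" where
  "suslin P \<longleftrightarrow> (\<exists>c. complete_covers c P)"

lemma complete_covers_UN: "complete_covers c P \<Longrightarrow> P = (\<Union>i. c n i)"
  unfolding complete_covers_def by (elim conjE allE)

lemma complete_covers_limit:
  assumes "complete_covers c P" "\<And>n. (\<Inter>k\<le>n. c k (\<sigma> k)) \<noteq> {}"
  obtains w where "w \<in> P" "\<And>S. open S \<Longrightarrow> w \<in> S \<Longrightarrow> \<exists>n. (\<Inter>k\<le>n. c k (\<sigma> k)) \<subseteq> S"
proof -
  have "(\<forall>n. (\<Inter>k\<le>n. c k (\<sigma> k)) \<noteq> {}) \<longrightarrow>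
        (\<exists>w\<in>P. \<forall>S. open S \<longrightarrow> w \<in> S \<longrightarrow> (\<exists>n. (\<Inter>k\<le>n. c k (\<sigma> k)) \<subseteq> S))"
    using assms(1) unfolding complete_covers_def by (elim conjE allE)
  then show ?thesis using assms(2) that by metis
qed

lemma suslinI:
  fixes c :: "nat \<Rightarrow> nat \<Rightarrow> 'a::topological_space set"
  assumes "\<And>n. P = (\<Union>i. c n i)"
    and "\<And>\<sigma>. (\<And>n. (\<Inter>k\<le>n. c k (\<sigma> k)) \<noteq> {}) \<Longrightarrow>
        \<exists>w\<in>P. \<forall>S. open S \<longrightarrow> w \<in> S \<longrightarrow> (\<exists>n. (\<Inter>k\<le>n. c k (\<sigma> k)) \<subseteq> S)"
  shows "suslin P"
proof -
  have "complete_covers c P" unfolding complete_covers_def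
    by (intro conjI allI impI) (rule assms(1), rule assms(2), blast)
  then show ?thesis unfolding suslin_def by blast
qed

lemma dense_sequence:
  obtains d :: "nat \<Rightarrow> 'a::{metric_space, second_countable_topology}"
  where "\<And>x e. 0 < e \<Longrightarrow> \<exists>i. dist (d i) x < e"
proof -
  obtain D :: "'a set" where D: "countable D" "\<And>X. open X \<Longrightarrow> X \<noteq> {} \<Longrightarrow> \<exists>d\<in>D. d \<in> X"
    using countable_dense_setE by blast
  have "D \<noteq> {}" using D(2)[of UNIV] by auto
  show ?thesis
  proof (rule that[of "from_nat_into D"])
    fix x :: 'a and e :: real assume "0 < e"
    then obtain y where "y \<in> D" "y \<in> ball x e" using D(2)[of "ball x e"] by auto
    then show "\<exists>i. dist (from_nat_into D i) x < e"
      using from_nat_into_surj[OF D(1)] by (metis dist_commute mem_ball)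
  qed
qed

text \<open>The cover at index 0 consists of the closed pieces, so a choice fixes one piece
  \<open>Q (\<sigma> 0)\<close> that contains the limit; the later covers by balls of radius
  \<open>1/2^m\<close> around a dense sequence make every admissible choice Cauchy.\<close>

lemma suslin_fsigma:
  fixes Q :: "nat \<Rightarrow> 'a::{complete_space, second_countable_topology} set"
  assumes Q: "\<And>i. closed (Q i)"
  shows "suslin (\<Union>i. Q i)"
proof -
  obtain d :: "nat \<Rightarrow> 'a" where d: "\<And>x e. 0 < e \<Longrightarrow> \<exists>i. dist (d i) x < e"
    using dense_sequence by blast
  define P where "P = (\<Union>i. Q i)"
  define c where "c n i = (case n of 0 \<Rightarrow> Q i | Suc m \<Rightarrow> P \<inter> ball (d i) (1/2^m))" for n i
  have "suslin P"
  proof (rule suslinI[of P c])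
    fix n show "P = (\<Union>i. c n i)"
      by (cases n) (auto simp: c_def P_def d)
  next
    fix \<sigma> :: "nat \<Rightarrow> nat" assume ne: "\<And>n. (\<Inter>k\<le>n. c k (\<sigma> k)) \<noteq> {}"
    then have "\<forall>n. \<exists>z. z \<in> (\<Inter>k\<le>n. c k (\<sigma> k))" by blast
    then obtain z where z: "\<And>n. z n \<in> (\<Inter>k\<le>n. c k (\<sigma> k))" by metis
    have zc: "z m \<in> c k (\<sigma> k)" if "k \<le> m" for k m using z[of m] that by auto
    have zd: "dist (d (\<sigma> (Suc n))) (z m) < 1/2^n" if "Suc n \<le> m" for n m
      using zc[OF that] by (auto simp: c_def)
    have small: "\<exists>n. 2 * (1/2^n) < e" if "0 < e" for e :: real
    proof -
      have "\<exists>n. (1/2::real)^n < e/2" using that by (intro real_arch_pow_inv) auto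
      then obtain n where "(1/2::real)^n < e/2" ..
      then show ?thesis by (intro exI[of _ n]) (simp add: power_one_over field_simps)
    qed
    have "Cauchy z"
    proof (rule metric_CauchyI)
      fix e :: real assume "0 < e"
      then obtain n where n: "2 * (1/2^n) < e" using small by blast
      have "dist (z m) (z m') < e" if "m \<ge> Suc n" "m' \<ge> Suc n" for m m'
        using zd[OF that(1)] zd[OF that(2)] n
        by (smt (verit, ccfv_SIG) dist_triangle3)
      then show "\<exists>M. \<forall>m\<ge>M. \<forall>n\<ge>M. dist (z m) (z n) < e" by blast
    qed
    then obtain w where w: "z \<longlonglongrightarrow> w" using Cauchy_convergent convergentD by blast
    have "w \<in> Q (\<sigma> 0)"
      using closed_sequentially[OF Q _ w] zc[of 0] by (auto simp: c_def)
    then have wP: "w \<in> P" by (auto simp: P_def)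
    show "\<exists>w\<in>P. \<forall>S. open S \<longrightarrow> w \<in> S \<longrightarrow> (\<exists>n. (\<Inter>k\<le>n. c k (\<sigma> k)) \<subseteq> S)"
    proof (intro bexI[OF _ wP] allI impI)
      fix S assume "open S" "w \<in> S"
      then obtain e where e: "0 < e" "ball w e \<subseteq> S" using openE by blast
      obtain n where n: "2 * (1/2^n) < e" using small[OF e(1)] by blast
      have wd: "dist (d (\<sigma> (Suc n))) w \<le> 1/2^n"
      proof (rule LIMSEQ_le_const2[OF tendsto_dist[OF tendsto_const w]])
        show "\<exists>N. \<forall>m\<ge>N. dist (d (\<sigma> (Suc n))) (z m) \<le> 1/2^n"
          using zd by (meson less_imp_le)
      qed
      have "c (Suc n) (\<sigma> (Suc n)) \<subseteq> ball w e"
      proof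
        fix x assume "x \<in> c (Suc n) (\<sigma> (Suc n))"
        then have "dist (d (\<sigma> (Suc n))) x < 1/2^n" by (simp add: c_def)
        then show "x \<in> ball w e" using wd n dist_triangle3[of w x "d (\<sigma> (Suc n))"] by simp
      qed
      then show "\<exists>n. (\<Inter>k\<le>n. c k (\<sigma> k)) \<subseteq> S" using e(2) by (intro exI[of _ "Suc n"]) auto
    qed
  qed
  then show ?thesis by (simp add: P_def)
qed

text \<open>All covers of all \<open>P i\<close> are merged into one sequence through
  \<open>prod_decode\<close>. A choice then has one limit in each \<open>P i\<close>, and the limits
  agree because disjoint neighbourhoods of two of them would both contain the same nonempty finite
  intersection.\<close>

lemma suslin_INT:
  fixes P :: "nat \<Rightarrow> 'a::t2_space set"
  assumes "\<And>i. suslin (P i)"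
  shows "suslin (\<Inter>i. P i)"
proof -
  obtain c where c': "\<And>i. complete_covers (c i) (P i)"
    using assms unfolding suslin_def by metis
  note c = complete_covers_UN[OF c'] and lim = complete_covers_limit[OF c']
  define C where "C m j = (\<Inter>i. P i) \<inter> c (fst (prod_decode m)) (snd (prod_decode m)) j" for m j
  show ?thesis
  proof (rule suslinI[of _ C])
    fix n show "(\<Inter>i. P i) = (\<Union>i. C n i)"
      using c[of "fst (prod_decode n)" "snd (prod_decode n)"] by (auto simp: C_def)
  next
    fix \<sigma> :: "nat \<Rightarrow> nat" assume ne: "\<And>n. (\<Inter>k\<le>n. C k (\<sigma> k)) \<noteq> {}"
    define \<tau> where "\<tau> i n = \<sigma> (prod_encode (i, n))" for i n
    have sub: "\<exists>N. \<forall>N'\<ge>N. (\<Inter>k\<le>N'. C k (\<sigma> k)) \<subseteq> (\<Inter>k\<le>n. c i k (\<tau> i k))" for i n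
    proof (intro exI allI impI)
      fix N' assume N': "Max ((\<lambda>k. prod_encode (i, k)) ` {..n}) \<le> N'"
      show "(\<Inter>k\<le>N'. C k (\<sigma> k)) \<subseteq> (\<Inter>k\<le>n. c i k (\<tau> i k))"
      proof (intro INT_greatest)
        fix k assume "k \<in> {..n}"
        then have "prod_encode (i, k) \<le> N'"
          using N' by (meson Max_ge finite_atMost finite_imageI imageI le_trans)
        then have "(\<Inter>k\<le>N'. C k (\<sigma> k)) \<subseteq> C (prod_encode (i, k)) (\<sigma> (prod_encode (i, k)))" by auto
        also have "\<dots> \<subseteq> c i k (\<tau> i k)" by (simp add: C_def \<tau>_def)
        finally show "(\<Inter>k\<le>N'. C k (\<sigma> k)) \<subseteq> c i k (\<tau> i k)" .
      qed
    qed
    have "\<exists>w. w \<in> P i \<and> (\<forall>S. open S \<longrightarrow> w \<in> S \<longrightarrow> (\<exists>N. \<forall>N'\<ge>N. (\<Inter>k\<le>N'. C k (\<sigma> k)) \<subseteq> S))" for i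
    proof -
      have "(\<Inter>k\<le>n. c i k (\<tau> i k)) \<noteq> {}" for n
      proof -
        obtain N where N: "\<forall>N'\<ge>N. (\<Inter>k\<le>N'. C k (\<sigma> k)) \<subseteq> (\<Inter>k\<le>n. c i k (\<tau> i k))" using sub ..
        show "(\<Inter>k\<le>n. c i k (\<tau> i k)) \<noteq> {}"
          using N[rule_format, OF order_refl] ne[of N] by (metis subset_empty)
      qed
      then obtain w where w: "w \<in> P i" "\<And>S. open S \<Longrightarrow> w \<in> S \<Longrightarrow> \<exists>n. (\<Inter>k\<le>n. c i k (\<tau> i k)) \<subseteq> S"
        using lim by metis
      have "\<exists>N. \<forall>N'\<ge>N. (\<Inter>k\<le>N'. C k (\<sigma> k)) \<subseteq> S" if S: "open S" "w \<in> S" for S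
      proof -
        obtain n where n: "(\<Inter>k\<le>n. c i k (\<tau> i k)) \<subseteq> S" using w(2)[OF S] ..
        obtain N where N: "\<forall>N'\<ge>N. (\<Inter>k\<le>N'. C k (\<sigma> k)) \<subseteq> (\<Inter>k\<le>n. c i k (\<tau> i k))"
          using sub ..
        show ?thesis
          by (rule exI[of _ N], intro allI impI, rule order_trans[OF N[rule_format] n])
      qed
      then show ?thesis using w(1) by blast
    qed
    then have "\<forall>i. \<exists>w. w \<in> P i \<and> (\<forall>S. open S \<longrightarrow> w \<in> S \<longrightarrow> (\<exists>N. \<forall>N'\<ge>N. (\<Inter>k\<le>N'. C k (\<sigma> k)) \<subseteq> S))" ..
    from choice[OF this] obtain w where w: "w i \<in> P i"
      and nb: "open S \<Longrightarrow> w i \<in> S \<Longrightarrow> \<exists>N. \<forall>N'\<ge>N. (\<Inter>k\<le>N'. C k (\<sigma> k)) \<subseteq> S" for i S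
      apply (elim exE) subgoal for f by (rule that[of f]) simp_all done
    have "w i = w 0" for i
    proof (rule ccontr)
      assume "w i \<noteq> w 0"
      then obtain S T where ST: "open S" "open T" "w i \<in> S" "w 0 \<in> T" "S \<inter> T = {}"
        using hausdorff[of "w i" "w 0"] by meson
      obtain N1 where N1: "\<forall>N'\<ge>N1. (\<Inter>k\<le>N'. C k (\<sigma> k)) \<subseteq> S" using nb[OF ST(1,3)] ..
      obtain N2 where N2: "\<forall>N'\<ge>N2. (\<Inter>k\<le>N'. C k (\<sigma> k)) \<subseteq> T" using nb[OF ST(2,4)] ..
      have "(\<Inter>k\<le>max N1 N2. C k (\<sigma> k)) \<subseteq> S \<inter> T"
        using N1[rule_format, OF max.cobounded1] N2[rule_format, OF max.cobounded2] by (rule Int_greatest)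
      then show False using ne ST(5) by (metis subset_empty)
    qed
    then have "w 0 \<in> (\<Inter>i. P i)" using w by (metis INT_I)
    then show "\<exists>w\<in>(\<Inter>i. P i). \<forall>S. open S \<longrightarrow> w \<in> S \<longrightarrow> (\<exists>n. (\<Inter>k\<le>n. C k (\<sigma> k)) \<subseteq> S)"
    proof (rule rev_bexI, intro allI impI)
      fix S assume "open S" "w 0 \<in> S"
      from nb[OF this] obtain N where N: "\<forall>N'\<ge>N. (\<Inter>k\<le>N'. C k (\<sigma> k)) \<subseteq> S" ..
      show "\<exists>n. (\<Inter>k\<le>n. C k (\<sigma> k)) \<subseteq> S" using N[rule_format, OF order_refl] ..
    qed
  qed
qed

text \<open>The covers of the pieces are simply united, level by level. Disjointness keeps a choice
  inside one piece: a nonempty finite intersection forces all levels to agree on the index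
  \<open>i\<close>.\<close>

lemma suslin_UN_disjoint:
  fixes P :: "nat \<Rightarrow> 'a::topological_space set"
  assumes "\<And>i. suslin (P i)" "disjoint_family P"
  shows "suslin (\<Union>i. P i)"
proof -
  obtain c where c': "\<And>i. complete_covers (c i) (P i)"
    using assms(1) unfolding suslin_def by metis
  note c = complete_covers_UN[OF c'] and lim = complete_covers_limit[OF c']
  define C where "C n m = c (fst (prod_decode m)) n (snd (prod_decode m))" for n m
  have CP: "C n m \<subseteq> P (fst (prod_decode m))" for n m
    using c[of "fst (prod_decode m)" n] by (auto simp: C_def)
  show ?thesis
  proof (rule suslinI[of _ C])
    fix n show "(\<Union>i. P i) = (\<Union>m. C n m)"
    proof
      show "(\<Union>i. P i) \<subseteq> (\<Union>m. C n m)"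
      proof
        fix x assume "x \<in> (\<Union>i. P i)"
        then obtain i j where "x \<in> c i n j" using c[of _ n] by blast
        then have "x \<in> C n (prod_encode (i, j))" by (simp add: C_def)
        then show "x \<in> (\<Union>m. C n m)" by blast
      qed
    qed (use CP in blast)
  next
    fix \<sigma> :: "nat \<Rightarrow> nat" assume ne: "\<And>n. (\<Inter>k\<le>n. C k (\<sigma> k)) \<noteq> {}"
    define i where "i = fst (prod_decode (\<sigma> 0))"
    have fst_eq: "fst (prod_decode (\<sigma> n)) = i" for n
    proof (rule ccontr)
      assume "fst (prod_decode (\<sigma> n)) \<noteq> i"
      then have "P (fst (prod_decode (\<sigma> n))) \<inter> P i = {}"
        using assms(2) by (auto simp: disjoint_family_on_def)
      moreover have "(\<Inter>k\<le>n. C k (\<sigma> k)) \<subseteq> C n (\<sigma> n) \<inter> C 0 (\<sigma> 0)" by auto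
      moreover have "\<dots> \<subseteq> P (fst (prod_decode (\<sigma> n))) \<inter> P i" using CP unfolding i_def by blast
      ultimately show False using ne[of n] by blast
    qed
    define \<tau> where "\<tau> n = snd (prod_decode (\<sigma> n))" for n
    have eq: "C k (\<sigma> k) = c i k (\<tau> k)" for k by (simp add: C_def fst_eq \<tau>_def)
    show "\<exists>w\<in>(\<Union>i. P i). \<forall>S. open S \<longrightarrow> w \<in> S \<longrightarrow> (\<exists>n. (\<Inter>k\<le>n. C k (\<sigma> k)) \<subseteq> S)"
    proof -
      have "(\<Inter>k\<le>n. c i k (\<tau> k)) \<noteq> {}" for n using ne[of n] unfolding eq .
      then obtain w where w: "w \<in> P i" "\<And>S. open S \<Longrightarrow> w \<in> S \<Longrightarrow> \<exists>n. (\<Inter>k\<le>n. c i k (\<tau> k)) \<subseteq> S"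
        using lim by metis
      show ?thesis unfolding eq
        by (rule bexI[of _ w]) (use w in auto)
    qed
  qed
qed

lemma suslin_closed:
  fixes S :: "'a::{complete_space, second_countable_topology} set"
  shows "closed S \<Longrightarrow> suslin S"
  using suslin_fsigma[of "\<lambda>_. S"] by simp

text \<open>An open set is an F-sigma: its points are sorted by whether their distance to the
  complement is at least \<open>1/Suc i\<close>.\<close>

lemma suslin_open:
  fixes S :: "'a::{complete_space, second_countable_topology} set"
  assumes "open S" shows "suslin S"
proof -
  have "\<exists>i. \<forall>y. y \<notin> S \<longrightarrow> 1/Suc i \<le> dist x y" if "x \<in> S" for x
  proof -
    obtain e where e: "0 < e" "ball x e \<subseteq> S" using assms \<open>x \<in> S\<close> openE by blast
    obtain i where "1/Suc i < e" using e(1) by (metis nat_approx_posE)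
    then show ?thesis using e(2) by (intro exI[of _ i]) (force simp: not_less)
  qed
  moreover have "x \<in> S" if "\<forall>y. y \<notin> S \<longrightarrow> 1/Suc i \<le> dist x y" for x i
    using that[rule_format, of x] by (cases "x \<in> S") (auto simp: divide_le_0_iff)
  ultimately have "S = (\<Union>i. {x. \<forall>y. y \<notin> S \<longrightarrow> 1/Suc i \<le> dist x y})"
    by blast
  moreover have "closed {x. \<forall>y. y \<notin> S \<longrightarrow> 1/Suc i \<le> dist x y}" for i
  proof -
    have "{x. \<forall>y. y \<notin> S \<longrightarrow> 1/Suc i \<le> dist x y} = (\<Inter>y\<in>-S. {x. 1/Suc i \<le> dist x y})" by auto
    also have "closed \<dots>" by (intro closed_INT ballI closed_Collect_le continuous_intros)
    finally show ?thesis .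
  qed
  ultimately show ?thesis
    using suslin_fsigma[of "\<lambda>i. {x. \<forall>y. y \<notin> S \<longrightarrow> 1/Suc i \<le> dist x y}"] by argo
qed

text \<open>The induction carries the complement along. A countable union is first made disjoint;
  \<open>disjointed a i\<close> is an intersection of \<open>a i\<close> with complements of earlier
  sets, and for these the hypothesis on complements is needed.\<close>

lemma suslin_borel:
  fixes S :: "'a::{complete_space, second_countable_topology} set"
  assumes "S \<in> sets borel" shows "suslin S"
proof -
  have "S \<in> sigma_sets UNIV {S. open S}" using assms by (simp add: borel_def)
  then have "suslin S \<and> suslin (- S)"
  proof induction
    case (Basic a)
    then show ?case by (simp add: suslin_open suslin_closed closed_Compl)
  next
    case Empty
    show ?case by (simp add: suslin_open)
  next
    case (Compl a)
    then show ?case by (simp add: Compl_eq_Diff_UNIV[symmetric])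
  next
    case (Union a)
    have "disjointed a i = (\<Inter>j. if j < i then - a j else a i)" for i
    proof (intro set_eqI iffI)
      fix x assume x: "x \<in> (\<Inter>j. if j < i then - a j else a i)"
      have "x \<notin> a j" if "j < i" for j using INT_D[OF x, of j] that by simp
      moreover have "x \<in> a i" using INT_D[OF x, of i] by simp
      ultimately show "x \<in> disjointed a i" by (auto simp: disjointed_def)
    qed (auto simp: disjointed_def)
    moreover have "suslin (\<Inter>j. if j < i then - a j else a i)" for i
      by (rule suslin_INT) (use Union in auto)
    ultimately have "suslin (\<Union>i. disjointed a i)"
      by (intro suslin_UN_disjoint disjoint_family_disjointed) simp
    moreover have "suslin (\<Inter>i. - a i)" by (rule suslin_INT) (use Union in auto)
    ultimately show ?case by (simp add: UN_disjointed_eq Compl_UN)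
  qed
  then show ?thesis ..
qed

section \<open>Lusin separation for projections\<close>

definition borel_separable :: "('x::topological_space \<times> 'y) set \<Rightarrow> ('x \<times> 'y) set \<Rightarrow> bool" where
  "borel_separable P Q \<longleftrightarrow> (\<exists>B\<in>sets borel. fst ` P \<subseteq> B \<and> fst ` Q \<inter> B = {})"

lemma borel_separable_UN:
  assumes "\<And>(i::nat) (j::nat). borel_separable (P i) (Q j)"
  shows "borel_separable (\<Union>i. P i) (\<Union>j. Q j)"
proof -
  obtain B where B: "\<And>i j. B i j \<in> sets borel" "\<And>i j. fst ` P i \<subseteq> B i j" "\<And>i j. fst ` Q j \<inter> B i j = {}"
    using assms unfolding borel_separable_def by metis
  note B(1)[measurable]
  have "(\<Union>i. \<Inter>j. B i j) \<in> sets borel" by measurable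
  moreover have "fst ` (\<Union>i. P i) \<subseteq> (\<Union>i. \<Inter>j. B i j)" using B(2) by blast
  moreover have "fst ` (\<Union>j. Q j) \<inter> (\<Union>i. \<Inter>j. B i j) = {}" using B(3) by blast
  ultimately show ?thesis unfolding borel_separable_def by blast
qed

text \<open>If separation fails, it fails for some pair of members of the first covers, then inside
  these for the second covers, and so on. The two resulting choices converge to points
  \<open>v\<close> and \<open>w\<close> with distinct first coordinates, and disjoint open sets
  around these coordinates separate some finite stage.\<close>

lemma borel_separable_projections:
  fixes P Q :: "('x::t2_space \<times> 'y::topological_space) set"
  assumes "suslin P" "suslin Q" and disj: "fst ` P \<inter> fst ` Q = {}"
  shows "borel_separable P Q"
proof (rule ccontr)
  assume nsep: "\<not> borel_separable P Q"
  obtain c d where c': "complete_covers c P" and d': "complete_covers d Q"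
    using assms(1,2) unfolding suslin_def by blast
  note c = complete_covers_UN[OF c'] and d = complete_covers_UN[OF d']
  have step: "\<exists>i j. \<not> borel_separable (P' \<inter> c n i) (Q' \<inter> d n j)"
    if "\<not> borel_separable P' Q'" "P' \<subseteq> P" "Q' \<subseteq> Q" for P' Q' n
  proof (rule ccontr)
    assume "\<nexists>i j. \<not> borel_separable (P' \<inter> c n i) (Q' \<inter> d n j)"
    then have "borel_separable (\<Union>i. P' \<inter> c n i) (\<Union>j. Q' \<inter> d n j)" by (intro borel_separable_UN) blast
    moreover have "(\<Union>i. P' \<inter> c n i) = P'" "(\<Union>j. Q' \<inter> d n j) = Q'" using that(2,3) c[of n] d[of n] by auto
    ultimately show False using that(1) by simp
  qed
  define good where "good n X = (\<not> borel_separable (fst (snd X)) (snd (snd X)) \<and> fst (snd X) \<subseteq> P \<and> snd (snd X) \<subseteq> Q)"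
    for n :: nat and X :: "(nat \<times> nat) \<times> _ \<times> _"
  have "\<exists>f. \<forall>n. good n (f n) \<and>
      (fst (snd (f (Suc n))) = fst (snd (f n)) \<inter> c n (fst (fst (f (Suc n)))) \<and>
       snd (snd (f (Suc n))) = snd (snd (f n)) \<inter> d n (snd (fst (f (Suc n)))))"
  proof (rule dependent_nat_choice)
    show "\<exists>X. good 0 X" using nsep by (intro exI[of _ "((0, 0), P, Q)"]) (simp add: good_def)
  next
    fix X n assume "good n X"
    then obtain i j where "\<not> borel_separable (fst (snd X) \<inter> c n i) (snd (snd X) \<inter> d n j)"
      using step[of "fst (snd X)" "snd (snd X)" n] unfolding good_def by blast
    then show "\<exists>Y. good (Suc n) Y \<and> (fst (snd Y) = fst (snd X) \<inter> c n (fst (fst Y)) \<and>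
       snd (snd Y) = snd (snd X) \<inter> d n (snd (fst Y)))"
      using \<open>good n X\<close> by (intro exI[of _ "((i, j), fst (snd X) \<inter> c n i, snd (snd X) \<inter> d n j)"]) (auto simp: good_def)
  qed
  then obtain f where f: "\<And>n. good n (f n)"
     "\<And>n. fst (snd (f (Suc n))) = fst (snd (f n)) \<inter> c n (fst (fst (f (Suc n))))"
     "\<And>n. snd (snd (f (Suc n))) = snd (snd (f n)) \<inter> d n (snd (fst (f (Suc n))))" by blast
  define \<sigma> where "\<sigma> n = fst (fst (f (Suc n)))" for n
  define \<tau> where "\<tau> n = snd (fst (f (Suc n)))" for n
  have subP: "fst (snd (f (Suc n))) \<subseteq> (\<Inter>k\<le>n. c k (\<sigma> k))" for n
    by (induction n) (use f(2) in \<open>auto simp: \<sigma>_def atMost_Suc\<close>)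
  have subQ: "snd (snd (f (Suc n))) \<subseteq> (\<Inter>k\<le>n. d k (\<tau> k))" for n
    by (induction n) (use f(3) in \<open>auto simp: \<tau>_def atMost_Suc\<close>)
  have ns: "\<not> borel_separable (\<Inter>k\<le>n. c k (\<sigma> k)) (\<Inter>k\<le>n. d k (\<tau> k))" for n
    using f(1)[of "Suc n"] image_mono[OF subP[of n], of fst] image_mono[OF subQ[of n], of fst]
    unfolding good_def borel_separable_def by (meson disjoint_iff subset_iff)
  \<comment> \<open>The empty set is separated from everything, so both members of a non-separable
    pair are nonempty, as the completeness of the covers demands.\<close>
  have neP: "(\<Inter>k\<le>n. c k (\<sigma> k)) \<noteq> {}" for n
  proof
    assume "(\<Inter>k\<le>n. c k (\<sigma> k)) = {}"
    then show False using ns[of n] unfolding borel_separable_def by (auto intro!: bexI[of _ "{}"])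
  qed
  have neQ: "(\<Inter>k\<le>n. d k (\<tau> k)) \<noteq> {}" for n
  proof
    assume "(\<Inter>k\<le>n. d k (\<tau> k)) = {}"
    then show False using ns[of n] unfolding borel_separable_def by (auto intro!: bexI[of _ "UNIV"])
  qed
  obtain v where v: "v \<in> P" "\<And>S. open S \<Longrightarrow> v \<in> S \<Longrightarrow> \<exists>n. (\<Inter>k\<le>n. c k (\<sigma> k)) \<subseteq> S"
    using complete_covers_limit[where c = c and P = P and \<sigma> = \<sigma>, OF c' neP] by metis
  obtain w where w: "w \<in> Q" "\<And>S. open S \<Longrightarrow> w \<in> S \<Longrightarrow> \<exists>n. (\<Inter>k\<le>n. d k (\<tau> k)) \<subseteq> S"
    using complete_covers_limit[where c = d and P = Q and \<sigma> = \<tau>, OF d' neQ] by metis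
  have "fst v \<noteq> fst w" using v(1) w(1) disj by blast
  then obtain S T where ST: "open S" "open T" "fst v \<in> S" "fst w \<in> T" "S \<inter> T = {}"
    using hausdorff[of "fst v" "fst w"] by meson
  obtain m where m: "(\<Inter>k\<le>m. c k (\<sigma> k)) \<subseteq> S \<times> UNIV"
    using v(2)[of "S \<times> UNIV"] ST by (auto simp: open_Times mem_Times_iff)
  obtain n where n: "(\<Inter>k\<le>n. d k (\<tau> k)) \<subseteq> T \<times> UNIV"
    using w(2)[of "T \<times> UNIV"] ST by (auto simp: open_Times mem_Times_iff)
  have "(\<Inter>k\<le>max m n. c k (\<sigma> k)) \<subseteq> (\<Inter>k\<le>m. c k (\<sigma> k))" by (rule INF_superset_mono) auto
  from order_trans[OF this m] have 1: "fst ` (\<Inter>k\<le>max m n. c k (\<sigma> k)) \<subseteq> S"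
    by (rule order_trans[OF image_mono]) auto
  have "(\<Inter>k\<le>max m n. d k (\<tau> k)) \<subseteq> (\<Inter>k\<le>n. d k (\<tau> k))" by (rule INF_superset_mono) auto
  from order_trans[OF this n] have 2: "fst ` (\<Inter>k\<le>max m n. d k (\<tau> k)) \<subseteq> T"
    by (rule order_trans[OF image_mono]) auto
  have "borel_separable (\<Inter>k\<le>max m n. c k (\<sigma> k)) (\<Inter>k\<le>max m n. d k (\<tau> k))"
    unfolding borel_separable_def
  proof (intro bexI[of _ S] conjI 1)
    show "fst ` (\<Inter>k\<le>max m n. d k (\<tau> k)) \<inter> S = {}"
      using Int_mono[OF 2 order_refl[of S]] ST(5) by (metis Int_commute subset_empty)
  qed (use ST(1) in simp)
  then show False using ns by (rule notE[rotated])
qed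

section \<open>Borel sets with sections of bounded cardinality\<close>

text \<open>As a section has at most one point, the parts of \<open>P\<close> inside and outside a
  strip \<open>V k n\<close> have disjoint projections, and a Borel set \<open>B k n\<close>
  separates these. Over the projection of \<open>P\<close> the sets \<open>B k n\<close> thus tell
  which balls contain the unique second coordinate.\<close>

lemma borel_fst_image_unique_sections:
  fixes P :: "('x::{complete_space, second_countable_topology} \<times> 'y::{complete_space, second_countable_topology}) set"
  assumes P: "P \<in> sets borel" and unique: "\<And>x y y'. (x, y) \<in> P \<Longrightarrow> (x, y') \<in> P \<Longrightarrow> y = y'"
  shows "fst ` P \<in> sets borel"
proof -
  obtain d :: "nat \<Rightarrow> 'y" where d: "\<And>x e. 0 < e \<Longrightarrow> \<exists>i. dist (d i) x < e"
    using dense_sequence by blast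
  define V where "V k n = (UNIV :: 'x set) \<times> ball (d k) (1/2^n)" for k n :: nat
  have "open (V k n)" for k n by (simp add: V_def open_Times)
  then have [measurable]: "V k n \<in> sets borel" for k n by simp
  note P[measurable]
  have "borel_separable (P \<inter> V k n) (P - V k n)" for k n
  proof (intro borel_separable_projections suslin_borel)
    show "fst ` (P \<inter> V k n) \<inter> fst ` (P - V k n) = {}"
      using unique by (force simp: V_def)
  qed measurable
  then obtain B where B[measurable]: "\<And>k n. B k n \<in> sets borel"
    and B1: "\<And>k n. fst ` (P \<inter> V k n) \<subseteq> B k n" and B2: "\<And>k n. fst ` (P - V k n) \<inter> B k n = {}"
    unfolding borel_separable_def by metis
  have B_iff: "x \<in> B k n \<longleftrightarrow> y \<in> ball (d k) (1/2^n)" if "(x, y) \<in> P" for x y k n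
    using B1[of k n] B2[of k n] that by (force simp: V_def)
  define h where "h n x = d (LEAST k. x \<in> B k n)" for n x
  have [measurable]: "h n \<in> borel_measurable borel" for n
    unfolding h_def by (rule measurable_compose[OF measurable_Least]) auto
  define C where "C = {x. Cauchy (\<lambda>n. h n x)}"
  have [measurable]: "C \<in> sets borel"
    using sets_Collect_Cauchy[of h borel] by (simp add: C_def)
  \<comment> \<open>Off the projection of \<open>P\<close> the sequence \<open>h n x\<close> need
    not converge; the constant value \<open>d 0\<close> makes the limit a Borel function on the
    whole space.\<close>
  define h' where "h' n x = (if x \<in> C then h n x else d 0)" for n x
  have [measurable]: "h' n \<in> borel_measurable borel" for n
    unfolding h'_def by measurable
  define H where "H x = lim (\<lambda>n. h' n x)" for x
  have lim: "(\<lambda>n. h' n x) \<longlonglongrightarrow> H x" for x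
    unfolding H_def h'_def C_def
    by (cases "Cauchy (\<lambda>n. h n x)") (auto simp: Cauchy_convergent convergent_LIMSEQ_iff[symmetric])
  have [measurable]: "H \<in> borel_measurable borel"
    by (rule borel_measurable_LIMSEQ_metric[OF _ lim]) measurable
  have "H x = y" if "(x, y) \<in> P" for x y
  proof -
    have close: "dist (h n x) y < 1/2^n" for n
    proof -
      obtain k where "dist (d k) y < 1/2^n" using d[of "1/2^n" y] by auto
      then have "x \<in> B k n" using B_iff[OF that] by simp
      then have "x \<in> B (LEAST k. x \<in> B k n) n" by (rule LeastI)
      then show ?thesis using B_iff[OF that] by (simp add: h_def)
    qed
    have "(\<lambda>n. h n x) \<longlonglongrightarrow> y"
    proof (rule metric_tendsto_imp_tendsto[OF _ always_eventually])
      show "(\<lambda>n. (1/2)^n :: real) \<longlonglongrightarrow> 0" by (rule LIMSEQ_power_zero) simp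
      show "\<forall>n. dist (h n x) y \<le> dist ((1/2)^n :: real) 0"
        using close by (simp add: power_one_over less_imp_le)
    qed
    moreover from this have "x \<in> C" by (auto simp: C_def intro: LIMSEQ_imp_Cauchy)
    ultimately show ?thesis by (simp add: H_def h'_def limI)
  qed
  \<comment> \<open>The separating sets define a Borel function whose graph contains \<open>P\<close>.\<close>
  then have "fst ` P = {x. (x, H x) \<in> P}" by force
  also have "\<dots> \<in> sets borel"
  proof -
    have "(\<lambda>x. (x, H x)) \<in> borel \<rightarrow>\<^sub>M (borel \<Otimes>\<^sub>M borel)" by measurable
    then have "(\<lambda>x. (x, H x)) \<in> borel \<rightarrow>\<^sub>M borel" by (simp add: borel_prod)
    from measurable_sets[OF this P] show ?thesis by (simp add: vimage_def)
  qed
  finally show ?thesis .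
qed

lemma countable_base_sequence:
  obtains U :: "nat \<Rightarrow> 'a::second_countable_topology set"
  where "\<And>n. open (U n)" "\<And>S x. open S \<Longrightarrow> x \<in> S \<Longrightarrow> \<exists>n. x \<in> U n \<and> U n \<subseteq> S"
proof -
  obtain B :: "'a set set" where B: "countable B" "topological_basis B"
    using ex_countable_basis by blast
  have "B \<noteq> {}" using topological_basisE[OF B(2) open_UNIV UNIV_I] by blast
  show ?thesis
  proof
    show "open (from_nat_into B n)" for n
      using topological_basis_open[OF B(2) from_nat_into[OF \<open>B \<noteq> {}\<close>]] .
    show "\<exists>n. x \<in> from_nat_into B n \<and> from_nat_into B n \<subseteq> S" if "open S" "x \<in> S" for S x
      using topological_basisE[OF B(2) that] from_nat_into_surj[OF B(1)] by metis
  qed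
qed

lemma finite_set_separation:
  fixes S :: "'a::metric_space set"
  assumes "finite S"
  obtains r where "0 < r" "\<And>x y. x \<in> S \<Longrightarrow> y \<in> S \<Longrightarrow> x \<noteq> y \<Longrightarrow> r \<le> dist x y"
proof -
  let ?D = "insert 1 ((\<lambda>(x, y). dist x y) ` {p \<in> S \<times> S. fst p \<noteq> snd p})"
  have fin: "finite ?D" using assms by auto
  show ?thesis
  proof (rule that[of "Min ?D"])
    show "0 < Min ?D" using fin by (subst Min_gr_iff) auto
    show "Min ?D \<le> dist x y" if "x \<in> S" "y \<in> S" "x \<noteq> y" for x y
      using fin that by (intro Min_le) force+
  qed
qed

text \<open>A section with exactly \<open>D\<close> points is listed by a function with one value in
  each of \<open>D\<close> pairwise disjoint basic open sets. For a fixed list \<open>s\<close> of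
  such sets the listing is unique, so the projection of the set \<open>Q s\<close> of listings is
  Borel, and there are only countably many \<open>s\<close>. Uniqueness depends on \<open>D\<close>
  being the maximum: a larger section could have several listings.\<close>

lemma borel_full_sections:
  fixes P :: "('x::polish_space \<times> 'y::polish_space) set"
  assumes P: "P \<in> sets borel" and fin: "\<And>x. finite {y. (x, y) \<in> P}"
    and bd: "\<And>x. card {y. (x, y) \<in> P} \<le> D"
  shows "{x. card {y. (x, y) \<in> P} = D} \<in> sets borel"
proof -
  obtain U :: "nat \<Rightarrow> 'y set" where U: "\<And>n. open (U n)"
    "\<And>S x. open S \<Longrightarrow> x \<in> S \<Longrightarrow> \<exists>n. x \<in> U n \<and> U n \<subseteq> S"
    using countable_base_sequence by blast
  define good where "good = {s. length s = D \<and> (\<forall>i<D. \<forall>j<D. i \<noteq> j \<longrightarrow> U (s ! i) \<inter> U (s ! j) = {})}"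
  \<comment> \<open>Values from index \<open>D\<close> on are pinned to \<open>undefined\<close>, so
    that a listing is unique as an element of the whole function space.\<close>
  define Q where "Q s = {(x, f :: nat \<Rightarrow> 'y). (\<forall>i<D. (x, f i) \<in> P \<and> f i \<in> U (s ! i)) \<and> (\<forall>i. D \<le> i \<longrightarrow> f i = undefined)}" for s
  have ev[measurable]: "(\<lambda>p::'x \<times> (nat \<Rightarrow> 'y). snd p i) \<in> borel_measurable (borel \<Otimes>\<^sub>M borel)" for i
    by (rule measurable_compose[OF measurable_snd])
       (intro borel_measurable_continuous_onI continuous_on_product_coordinates)
  have [measurable]: "P \<in> sets (borel \<Otimes>\<^sub>M borel)" unfolding borel_prod by (rule P)
  have [measurable]: "U n \<in> sets borel" for n using U(1) by simp
  have Q_borel: "Q s \<in> sets borel" for s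
  proof -
    have "Measurable.pred (borel \<Otimes>\<^sub>M borel) (\<lambda>p::'x \<times> (nat \<Rightarrow> 'y).
      (\<forall>i<D. (fst p, snd p i) \<in> P \<and> snd p i \<in> U (s ! i)) \<and> (\<forall>i. D \<le> i \<longrightarrow> snd p i \<in> {undefined}))"
      by measurable
    then show ?thesis unfolding Q_def borel_prod[symmetric] by (simp add: pred_def case_prod_unfold space_pair_measure)
  qed
  have inj: "inj_on f {..<D} \<and> f ` {..<D} = {y. (x, y) \<in> P} \<and> card {y. (x, y) \<in> P} = D"
    if "s \<in> good" "(x, f) \<in> Q s" for s x f
  proof -
    have "inj_on f {..<D}"
    proof (rule inj_onI, rule ccontr)
      fix i j assume ij: "i \<in> {..<D}" "j \<in> {..<D}" "f i = f j" "i \<noteq> j"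
      then have "f i \<in> U (s ! i) \<inter> U (s ! j)" using that(2) by (auto simp: Q_def)
      then show False using that(1) ij by (auto simp: good_def)
    qed
    moreover have sub: "f ` {..<D} \<subseteq> {y. (x, y) \<in> P}" using that by (auto simp: Q_def)
    ultimately have "card (f ` {..<D}) = D" by (simp add: card_image)
    then show ?thesis using card_seteq[OF fin sub] bd[of x] card_mono[OF fin sub] \<open>inj_on f {..<D}\<close> by auto
  qed
  have "fst ` Q s \<in> sets borel" if s: "s \<in> good" for s
  proof (rule borel_fst_image_unique_sections[OF Q_borel])
    fix x f f' assume q: "(x, f) \<in> Q s" "(x, f') \<in> Q s"
    show "f = f'"
    proof
      fix i show "f i = f' i"
      proof (cases "i < D")
        case True
        \<comment> \<open>The values of \<open>f\<close> exhaust the section, so \<open>f' i\<close>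
          is some \<open>f j\<close>; it then lies in both \<open>U (s ! i)\<close> and
          \<open>U (s ! j)\<close>, which forces \<open>i = j\<close>.\<close>
        then have "f' i \<in> f ` {..<D}" using inj[OF s q(1)] q(2) by (auto simp: Q_def)
        then obtain j where j: "j < D" "f' i = f j" by auto
        have "f' i \<in> U (s ! i) \<inter> U (s ! j)" using q j True by (auto simp: Q_def)
        moreover have "U (s ! i) \<inter> U (s ! j) = {}" if "i \<noteq> j"
          using s True j(1) that by (simp add: good_def)
        ultimately have "i = j" by auto
        then show ?thesis using j by simp
      qed (use q in \<open>auto simp: Q_def\<close>)
    qed
  qed
  moreover have "{x. card {y. (x, y) \<in> P} = D} = (\<Union>s\<in>good. fst ` Q s)"
  proof (intro set_eqI iffI)
    fix x assume "x \<in> {x. card {y. (x, y) \<in> P} = D}"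
    then have cx: "card {y. (x, y) \<in> P} = D" by simp
    then obtain f where f: "bij_betw f {..<D} {y. (x, y) \<in> P}"
      using ex_bij_betw_nat_finite[OF fin[of x]] by (auto simp: lessThan_atLeast0)
    obtain r where r: "0 < r" "\<And>y z. (x, y) \<in> P \<Longrightarrow> (x, z) \<in> P \<Longrightarrow> y \<noteq> z \<Longrightarrow> r \<le> dist y z"
      using finite_set_separation[OF fin[of x]] by (metis mem_Collect_eq)
    have "\<forall>i. \<exists>n. f i \<in> U n \<and> U n \<subseteq> ball (f i) (r/2)" using U(2) r(1) by simp
    then obtain n where n: "\<And>i. f i \<in> U (n i)" "\<And>i. U (n i) \<subseteq> ball (f i) (r/2)" by metis
    define s where "s = map n [0..<D]"
    have "U (n i) \<inter> U (n j) = {}" if "i < D" "j < D" "i \<noteq> j" for i j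
    proof -
      have "f i \<noteq> f j" using f that unfolding bij_betw_def inj_on_def by auto
      moreover have "(x, f i) \<in> P" "(x, f j) \<in> P" using bij_betwE[OF f] that by auto
      ultimately have "r \<le> dist (f i) (f j)" using r(2) by blast
      then have "ball (f i) (r/2) \<inter> ball (f j) (r/2) = {}" by (intro disjoint_ballI) auto
      then show ?thesis using n(2) by blast
    qed
    then have "s \<in> good" by (simp add: good_def s_def)
    moreover have "(x, \<lambda>i. if i < D then f i else undefined) \<in> Q s"
      using n(1) bij_betwE[OF f] by (auto simp: Q_def s_def)
    ultimately show "x \<in> (\<Union>s\<in>good. fst ` Q s)" by force
  next
    fix x assume "x \<in> (\<Union>s\<in>good. fst ` Q s)"
    then show "x \<in> {x. card {y. (x, y) \<in> P} = D}" using inj by force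
  qed
  ultimately show ?thesis by (auto intro!: sets.countable_UN')
qed

text \<open>Induction on the bound: the points whose section has the maximal size form a Borel set,
  and after emptying their sections the bound drops by one.\<close>

lemma measurable_card_section:
  fixes P :: "('x::polish_space \<times> 'y::polish_space) set"
  assumes "P \<in> sets (borel \<Otimes>\<^sub>M borel)" "\<And>x. finite {y. (x, y) \<in> P}" "\<And>x. card {y. (x, y) \<in> P} \<le> D"
  shows "(\<lambda>x. card {y. (x, y) \<in> P}) \<in> borel \<rightarrow>\<^sub>M count_space UNIV"
  using assms
proof (induction D arbitrary: P)
  case 0
  then have "(\<lambda>x. card {y. (x, y) \<in> P}) = (\<lambda>x. 0)" by auto
  then show ?case by simp
next
  case (Suc D)
  define A where "A = {x. card {y. (x, y) \<in> P} = Suc D}"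
  have A[measurable]: "A \<in> sets borel"
    unfolding A_def by (rule borel_full_sections[OF Suc.prems(1)[unfolded borel_prod] Suc.prems(2,3)])
  note Suc.prems(1)[measurable]
  have sub: "{y. (x, y) \<in> P - A \<times> UNIV} = (if x \<in> A then {} else {y. (x, y) \<in> P})" for x by auto
  have [measurable]: "(\<lambda>x. card {y. (x, y) \<in> P - A \<times> UNIV}) \<in> borel \<rightarrow>\<^sub>M count_space UNIV"
  proof (rule Suc.IH)
    show "P - A \<times> UNIV \<in> sets (borel \<Otimes>\<^sub>M borel)" by measurable
    show "finite {y. (x, y) \<in> P - A \<times> UNIV}" for x using Suc.prems(2) unfolding sub by simp
    show "card {y. (x, y) \<in> P - A \<times> UNIV} \<le> D" for x
      using Suc.prems(3)[of x] unfolding sub by (auto simp: A_def)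
  qed
  have "(\<lambda>x. card {y. (x, y) \<in> P}) = (\<lambda>x. if x \<in> A then Suc D else card {y. (x, y) \<in> P - A \<times> UNIV})"
    by (auto simp: A_def)
  also have "\<dots> \<in> borel \<rightarrow>\<^sub>M count_space UNIV" by measurable
  finally show ?case .
qed

text \<open>\<open>\<phi> n\<close> picks the only point of the section in the \<open>n\<close>-th
  basic open set, and \<open>x\<close> itself if there is no such point or more than one; this
  default is why \<open>x\<close> is inserted on both sides. Some basic open set isolates each point
  of a finite section, and measurability reduces to counting points of sections.\<close>

lemma borel_selectors:
  fixes P :: "('a::polish_space \<times> 'a) set"
  assumes P[measurable]: "P \<in> sets (borel \<Otimes>\<^sub>M borel)" and fin: "\<And>x. finite {y. (x, y) \<in> P}"
    and bd: "\<And>x. card {y. (x, y) \<in> P} \<le> D"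
  obtains \<phi> :: "nat \<Rightarrow> 'a \<Rightarrow> 'a" where "\<And>n. \<phi> n \<in> borel_measurable borel"
    "\<And>x. insert x {y. (x, y) \<in> P} = insert x (range (\<lambda>n. \<phi> n x))"
proof -
  obtain U :: "nat \<Rightarrow> 'a set" where U: "\<And>n. open (U n)"
    "\<And>S x. open S \<Longrightarrow> x \<in> S \<Longrightarrow> \<exists>n. x \<in> U n \<and> U n \<subseteq> S"
    using countable_base_sequence by blast
  have [measurable]: "U n \<in> sets borel" for n using U(1) by simp
  have meas: "(\<lambda>x. card {y. (x, y) \<in> P \<and> y \<in> B}) \<in> borel \<rightarrow>\<^sub>M count_space UNIV"
    if [measurable]: "B \<in> sets borel" for B
  proof -
    have "(\<lambda>x. card {y. (x, y) \<in> P \<inter> UNIV \<times> B}) \<in> borel \<rightarrow>\<^sub>M count_space UNIV"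
    proof (rule measurable_card_section[where D = D])
      show "P \<inter> UNIV \<times> B \<in> sets (borel \<Otimes>\<^sub>M borel)" by measurable
      show "finite {y. (x, y) \<in> P \<inter> UNIV \<times> B}" for x by (rule finite_subset[OF _ fin[of x]]) auto
      show "card {y. (x, y) \<in> P \<inter> UNIV \<times> B} \<le> D" for x
        by (rule order_trans[OF card_mono[OF fin[of x]] bd[of x]]) auto
    qed
    then show ?thesis by simp
  qed
  define one where "one n x \<longleftrightarrow> card {y. (x, y) \<in> P \<and> y \<in> U n} = 1" for n x
  define \<phi> where "\<phi> n x = (if one n x then THE y. (x, y) \<in> P \<and> y \<in> U n else x)" for n x
  have one: "{y. (x, y) \<in> P \<and> y \<in> U n} = {\<phi> n x}" if o: "one n x" for n x
  proof -
    obtain z where "{y. (x, y) \<in> P \<and> y \<in> U n} = {z}"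
      using o unfolding one_def by (elim card_1_singletonE)
    then have "(x, y) \<in> P \<and> y \<in> U n \<longleftrightarrow> y = z" for y by blast
    then show ?thesis using that by (simp add: \<phi>_def)
  qed
  have [measurable]: "Measurable.pred borel (one n)" for n
    unfolding one_def using meas[of "U n"] by measurable
  show ?thesis
  proof (rule that[of \<phi>])
    fix n show "\<phi> n \<in> borel_measurable borel"
    proof (rule measurableI)
      fix B :: "'a set" assume B[measurable]: "B \<in> sets borel"
      have "\<phi> n x \<in> B \<longleftrightarrow> (if one n x then card {y. (x, y) \<in> P \<and> y \<in> U n \<inter> B} = 1 else x \<in> B)" for x
      proof (cases "one n x")
        case True
        have "{y. (x, y) \<in> P \<and> y \<in> U n \<inter> B} = {y. (x, y) \<in> P \<and> y \<in> U n} \<inter> B" by auto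
        then show ?thesis using True one[OF True] by auto
      qed (simp add: \<phi>_def)
      then have "\<phi> n -` B \<inter> space borel = {x. if one n x then card {y. (x, y) \<in> P \<and> y \<in> U n \<inter> B} = 1 else x \<in> B}"
        by auto
      also have "\<dots> \<in> sets borel"
        using meas[of "U n \<inter> B"] by measurable
      finally show "\<phi> n -` B \<inter> space borel \<in> sets borel" .
    qed simp
  next
    fix x
    have "\<exists>n. y = \<phi> n x" if "(x, y) \<in> P" for y
    proof -
      obtain r where r: "0 < r" "\<And>y z. (x, y) \<in> P \<Longrightarrow> (x, z) \<in> P \<Longrightarrow> y \<noteq> z \<Longrightarrow> r \<le> dist y z"
        using finite_set_separation[OF fin[of x]] by (metis mem_Collect_eq)
      obtain n where n: "y \<in> U n" "U n \<subseteq> ball y r" using U(2)[of "ball y r" y] r(1) by auto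
      have "{z. (x, z) \<in> P \<and> z \<in> U n} = {y}"
        using n that r(2)[OF that] by force
      then have "one n x" by (simp add: one_def)
      then show ?thesis using one[of n x] \<open>{z. (x, z) \<in> P \<and> z \<in> U n} = {y}\<close> by blast
    qed
    moreover have "\<phi> n x = x \<or> (x, \<phi> n x) \<in> P" for n
      using one[of n x] by (cases "one n x") (auto simp: \<phi>_def)
    ultimately show "insert x {y. (x, y) \<in> P} = insert x (range (\<lambda>n. \<phi> n x))" by auto
  qed
qed

section \<open>Components and mass transport\<close>

lemma Upair_commute: "Upair x y = Upair y x"
  by (simp add: Upair_inject)

lemma sym_pairs_of: "sym (pairs_of F)"
  by (auto simp: sym_def pairs_of_def Upair_commute)

lemma component_refl [simp]: "x \<in> component F x"
  by (simp add: component_def)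

lemma component_edge: "Upair x y \<in> F \<Longrightarrow> y \<in> component F x"
  by (auto simp: component_def pairs_of_def)

lemma component_mono: "F \<subseteq> G \<Longrightarrow> component F x \<subseteq> component G x"
  unfolding component_def using rtrancl_mono[of "pairs_of F" "pairs_of G"]
  by (auto simp: pairs_of_def)

lemma component_sym: "y \<in> component F x \<longleftrightarrow> x \<in> component F y"
  unfolding component_def using sym_rtrancl[OF sym_pairs_of[of F]] by (auto dest: symD)

lemma component_eq: "y \<in> component F x \<Longrightarrow> component F y = component F x"
  using component_sym[of y F x] unfolding component_def by (auto intro: rtrancl_trans)

lemma component_eq_iff: "component F x = component F y \<longleftrightarrow> y \<in> component F x"
  by (metis component_eq component_refl)

lemma component_step: "y \<in> component F x \<Longrightarrow> Upair y z \<in> F \<Longrightarrow> z \<in> component F x"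
  by (metis component_edge component_eq)

lemma component_subsetI:
  assumes "x \<in> S" and closed: "\<And>y z. y \<in> S \<Longrightarrow> Upair y z \<in> F \<Longrightarrow> z \<in> S"
  shows "component F x \<subseteq> S"
proof
  fix y assume "y \<in> component F x"
  then have "(x, y) \<in> (pairs_of F)\<^sup>*" by (simp add: component_def)
  then show "y \<in> S"
    by induction (use assms in \<open>auto simp: pairs_of_def\<close>)
qed

text \<open>Sums range over the whole vertex type, so that the interchange of two sums needs no
  countability; in the transport arguments the summand vanishes outside one component, which is
  countable.\<close>

abbreviation csum :: "('b \<Rightarrow> ennreal) \<Rightarrow> ennreal" where
  "csum f \<equiv> \<integral>\<^sup>+ y. f y \<partial>count_space UNIV"

lemma csum_swap: "csum (\<lambda>x. csum (\<lambda>y. f x y)) = csum (\<lambda>y. csum (\<lambda>x. f x y))"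
  using nn_integral_fst_count_space[of "\<lambda>(x, y). f x y"] nn_integral_snd_count_space[of "\<lambda>(x, y). f x y"]
  by simp

text \<open>The enumeration may repeat values, so only the first index of each value counts. In this
  form the sum is a series whose terms can be checked for measurability one by one.\<close>

lemma csum_enum:
  fixes \<psi> :: "nat \<Rightarrow> 'b"
  assumes "\<And>y. f y \<noteq> 0 \<Longrightarrow> y \<in> range \<psi>"
  shows "csum f = (\<Sum>n. if \<forall>m<n. \<psi> m \<noteq> \<psi> n then f (\<psi> n) else 0)"
proof -
  define N where "N = {n. \<forall>m<n. \<psi> m \<noteq> \<psi> n}"
  have inj: "inj_on \<psi> N"
    by (rule inj_onI) (metis (mono_tags, lifting) N_def linorder_neqE_nat mem_Collect_eq)
  have "\<exists>n\<in>N. y = \<psi> n" if y: "y \<in> range \<psi>" for y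
  proof -
    obtain k where k: "y = \<psi> k" using y by auto
    define n where "n = (LEAST k. y = \<psi> k)"
    have "y = \<psi> n" unfolding n_def by (rule LeastI[of _ k]) (rule k)
    moreover have "n \<in> N" unfolding N_def
    proof (intro CollectI allI impI)
      fix m assume "m < n"
      then have "y \<noteq> \<psi> m" unfolding n_def by (rule not_less_Least)
      then show "\<psi> m \<noteq> \<psi> n" using \<open>y = \<psi> n\<close> by simp
    qed
    ultimately show ?thesis by blast
  qed
  then have img: "\<psi> ` N = range \<psi>" by auto
  have "csum f = (\<integral>\<^sup>+ y. f y \<partial>count_space (range \<psi>))"
    by (rule nn_integral_count_space_eq) (use assms in auto)
  also have "\<dots> = (\<integral>\<^sup>+ n. f (\<psi> n) \<partial>count_space N)"
    by (rule nn_integral_bij_count_space[symmetric]) (use inj img in \<open>auto simp: bij_betw_def\<close>)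
  also have "\<dots> = csum (\<lambda>n. f (\<psi> n) * indicator N n)"
    by (rule nn_integral_count_space_indicator) simp
  also have "\<dots> = (\<Sum>n. f (\<psi> n) * indicator N n)"
    by (rule nn_integral_count_space_nat)
  also have "\<dots> = (\<Sum>n. if \<forall>m<n. \<psi> m \<noteq> \<psi> n then f (\<psi> n) else 0)"
    by (rule suminf_cong) (auto simp: N_def)
  finally show ?thesis .
qed

section \<open>Borel enumeration of components and measurability of component predicates\<close>

locale graphing_space =
  fixes \<mu> :: "'a::polish_space measure" and E :: "'a uprod set"
  assumes graphing: "graphing \<mu> E"
begin

sublocale prob_space \<mu>
  using graphing by (simp add: graphing_def)

lemma sets_mu [measurable_cong]: "sets \<mu> = sets borel"
  using graphing by (simp add: graphing_def)

lemma space_mu [simp]: "space \<mu> = UNIV"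
  using sets_eq_imp_space_eq[OF sets_mu] by simp

lemma no_loop: "Upair x x \<notin> E"
  using graphing by (simp add: graphing_def)

lemma finite_nbrs: "finite {y. Upair x y \<in> E}"
  using graphing unfolding graphing_def by blast

lemma finite_nbrs_subset: "F \<subseteq> E \<Longrightarrow> finite {y. Upair x y \<in> F}"
  by (rule finite_subset[OF _ finite_nbrs[of x]]) auto

lemma pairs_measurable [measurable]: "pairs_of E \<in> sets (borel \<Otimes>\<^sub>M borel)"
  using graphing by (simp add: graphing_def)

text \<open>The vertices reached from \<open>x\<close> by finite words in the Borel selectors of
  neighbours are exactly those of its component, and there are countably many words. A selector may
  also return its argument, which does no harm.\<close>

lemma component_enumeration:
  "\<exists>\<psi> :: nat \<Rightarrow> 'a \<Rightarrow> 'a. (\<forall>n. \<psi> n \<in> borel_measurable borel) \<and> (\<forall>x. component E x = range (\<lambda>n. \<psi> n x))"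
proof -
  obtain D where "\<And>x. card {y. Upair x y \<in> E} \<le> D"
    using graphing unfolding graphing_def deg_def by blast
  then obtain \<phi> :: "nat \<Rightarrow> 'a \<Rightarrow> 'a" where \<phi>[measurable]: "\<And>n. \<phi> n \<in> borel_measurable borel"
    and nb: "\<And>x. insert x {y. (x, y) \<in> pairs_of E} = insert x (range (\<lambda>n. \<phi> n x))"
    using borel_selectors[OF pairs_measurable, of D] finite_nbrs by (auto simp: pairs_of_def)
  define \<psi> where "\<psi> k = fold \<phi> (from_nat k :: nat list)" for k
  have "fold \<phi> w \<in> borel_measurable borel" for w
  proof (induction w)
    case (Cons n w)
    have "fold \<phi> (n # w) = (\<lambda>x. fold \<phi> w (\<phi> n x))" by (auto simp: fun_eq_iff)
    then show ?case using measurable_compose[OF \<phi> Cons] by simp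
  qed (simp add: id_def)
  moreover have "fold \<phi> w x \<in> component E x" for w x
  proof (induction w arbitrary: x)
    case (Cons n w)
    have "\<phi> n x \<in> insert x {y. (x, y) \<in> pairs_of E}" unfolding nb by simp
    then have "\<phi> n x \<in> component E x" using component_edge[of x _ E]
      by (auto simp: pairs_of_def)
    then show ?case using Cons[of "\<phi> n x"] component_eq by fastforce
  qed simp
  moreover have "\<exists>w. y = fold \<phi> w x" if "y \<in> component E x" for x y
  proof -
    have "(x, y) \<in> (pairs_of E)\<^sup>*" using that by (simp add: component_def)
    then show ?thesis
    proof induction
      case base
      show ?case by (rule exI[of _ "[]"]) simp
    next
      case (step y z)
      then obtain w where w: "y = fold \<phi> w x" by blast
      have "z = y \<or> (\<exists>n. z = \<phi> n y)" using nb[of y] step(2) by auto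
      then show ?case
      proof
        assume "\<exists>n. z = \<phi> n y"
        then obtain n where "z = \<phi> n y" ..
        then show ?thesis using w by (intro exI[of _ "w @ [n]"]) simp
      qed (use w in auto)
    qed
  qed
  ultimately have *: "component E x = range (\<lambda>w. fold \<phi> w x)" "fold \<phi> w \<in> borel_measurable borel" for x w
    by (fast, blast)
  have "range (\<lambda>n. \<psi> n x) = range (\<lambda>w. fold \<phi> w x)" for x
    unfolding \<psi>_def using image_image[of "\<lambda>w. fold \<phi> w x" from_nat UNIV, symmetric]
    by (simp add: surj_from_nat)
  then show ?thesis using * by (intro exI[of _ \<psi>]) (simp add: \<psi>_def)
qed

definition \<psi> :: "nat \<Rightarrow> 'a \<Rightarrow> 'a" where
  "\<psi> = (SOME \<psi>. (\<forall>n. \<psi> n \<in> borel_measurable borel) \<and> (\<forall>x. component E x = range (\<lambda>n. \<psi> n x)))"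

lemma psi_measurable [measurable]: "\<psi> n \<in> borel_measurable borel"
  and component_psi: "component E x = range (\<lambda>n. \<psi> n x)"
  using someI_ex[OF component_enumeration] unfolding \<psi>_def[symmetric] by auto

text \<open>The sum over all vertices becomes a series along the enumeration \<open>\<psi>\<close>
  of the component of the base point \<open>p z\<close>; the support condition permits this.\<close>

lemma measurable_csum:
  assumes f[measurable]: "(\<lambda>p. f (fst p) (snd p)) \<in> borel_measurable (M \<Otimes>\<^sub>M borel)"
    and p[measurable]: "p \<in> borel_measurable M"
    and supp: "\<And>z y. z \<in> space M \<Longrightarrow> f z y \<noteq> 0 \<Longrightarrow> y \<in> component E (p z)"
  shows "(\<lambda>z. csum (f z)) \<in> borel_measurable M"
proof -
  have [measurable]: "(\<lambda>z. f z (\<psi> n (p z))) \<in> borel_measurable M" for n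
    using measurable_compose[OF measurable_Pair[OF measurable_ident measurable_compose[OF p psi_measurable]] f] by simp
  have "csum (f z) = (\<Sum>n. if \<forall>m<n. \<psi> m (p z) \<noteq> \<psi> n (p z) then f z (\<psi> n (p z)) else 0)" if "z \<in> space M" for z
    by (rule csum_enum) (use supp[OF that] component_psi in auto)
  moreover have "(\<lambda>z. \<Sum>n. if \<forall>m<n. \<psi> m (p z) \<noteq> \<psi> n (p z) then f z (\<psi> n (p z)) else 0) \<in> borel_measurable M"
    by measurable
  ultimately show ?thesis by (simp cong: measurable_cong)
qed

text \<open>Families of edge sets depending measurably on a parameter are needed because the graph of all edges
  above a given edge varies with that edge.\<close>

definition measurable_edges :: "'z measure \<Rightarrow> ('z \<Rightarrow> 'a uprod set) \<Rightarrow> bool" where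
  "measurable_edges M G \<longleftrightarrow> (\<forall>z. G z \<subseteq> E) \<and>
     Measurable.pred (M \<Otimes>\<^sub>M (borel \<Otimes>\<^sub>M borel)) (\<lambda>p. Upair (fst (snd p)) (snd (snd p)) \<in> G (fst p))"

lemma measurable_edgesD:
  assumes "measurable_edges M G" "h \<in> N \<rightarrow>\<^sub>M M" "f \<in> borel_measurable N" "g \<in> borel_measurable N"
  shows "Measurable.pred N (\<lambda>z. Upair (f z) (g z) \<in> G (h z))"
proof -
  have "(\<lambda>z. (h z, f z, g z)) \<in> N \<rightarrow>\<^sub>M (M \<Otimes>\<^sub>M (borel \<Otimes>\<^sub>M borel))" using assms by measurable
  from measurable_compose[OF this, of _ "count_space UNIV"] show ?thesis
    using assms(1) unfolding measurable_edges_def pred_def[symmetric] by fastforce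
qed

text \<open>The last intermediate vertex of a walk lies in the component of its start
  \<open>f z\<close>, hence is some \<open>\<psi> n (f z)\<close>; the quantifier over it becomes
  countable.\<close>

lemma measurable_relpow:
  assumes G: "measurable_edges M G" and "h \<in> N \<rightarrow>\<^sub>M M" "f \<in> borel_measurable N" "g \<in> borel_measurable N"
  shows "Measurable.pred N (\<lambda>z. (f z, g z) \<in> (pairs_of (G (h z))) ^^ k)"
  using assms(2-)
proof (induction k arbitrary: g)
  case 0
  note [measurable] = 0
  show ?case by simp measurable
next
  case (Suc k)
  note [measurable] = Suc.prems
  have "(f z, g z) \<in> (pairs_of (G (h z))) ^^ Suc k \<longleftrightarrow>
      (\<exists>n. (f z, \<psi> n (f z)) \<in> (pairs_of (G (h z))) ^^ k \<and> Upair (\<psi> n (f z)) (g z) \<in> G (h z))" for z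
  proof -
    have "u \<in> range (\<lambda>n. \<psi> n (f z))" if "(f z, u) \<in> (pairs_of (G (h z))) ^^ k" for u
    proof -
      have "u \<in> component (G (h z)) (f z)" using relpow_imp_rtrancl[OF that] by (simp add: component_def)
      then show ?thesis using component_mono[of "G (h z)" E] G component_psi unfolding measurable_edges_def by blast
    qed
    then show ?thesis by (auto simp: pairs_of_def relcomp_unfold)
  qed
  moreover have [measurable]: "Measurable.pred N (\<lambda>z. (f z, \<psi> n (f z)) \<in> (pairs_of (G (h z))) ^^ k)" for n
    by (rule Suc.IH) measurable
  moreover have [measurable]: "Measurable.pred N (\<lambda>z. Upair (\<psi> n (f z)) (g z) \<in> G (h z))" for n
    by (rule measurable_edgesD[OF G]) measurable
  ultimately show ?case by simp
qed

lemma measurable_component: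
  assumes G: "measurable_edges M G" and [measurable]: "h \<in> N \<rightarrow>\<^sub>M M" "f \<in> borel_measurable N" "g \<in> borel_measurable N"
  shows "Measurable.pred N (\<lambda>z. g z \<in> component (G (h z)) (f z))"
proof -
  have [measurable]: "Measurable.pred N (\<lambda>z. (f z, g z) \<in> (pairs_of (G (h z))) ^^ k)" for k
    by (rule measurable_relpow[OF G]) measurable
  have "Measurable.pred N (\<lambda>z. \<exists>k. (f z, g z) \<in> (pairs_of (G (h z))) ^^ k)" by measurable
  then show ?thesis by (simp add: component_def rtrancl_is_UN_relpow)
qed

lemma measurable_finite_component:
  assumes G: "measurable_edges M G" and [measurable]: "h \<in> N \<rightarrow>\<^sub>M M" "f \<in> borel_measurable N"
  shows "Measurable.pred N (\<lambda>z. finite (component (G (h z)) (f z)))"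
proof -
  have [measurable]: "Measurable.pred N (\<lambda>z. \<psi> n (f z) \<in> component (G (h z)) (f z))" for n
    by (rule measurable_component[OF G]) measurable
  \<comment> \<open>Finiteness as a countable condition: the values at the first \<open>N\<close>
    indices of the enumeration already exhaust the component.\<close>
  have "finite (component (G (h z)) x) \<longleftrightarrow>
    (\<exists>N. \<forall>n. \<psi> n x \<in> component (G (h z)) x \<longrightarrow> (\<exists>m<N. \<psi> n x = \<psi> m x))" (is "?l \<longleftrightarrow> ?r") for x z
  proof
    assume ?l
    have sub: "component (G (h z)) x \<subseteq> range (\<lambda>n. \<psi> n x)"
      using component_mono[of "G (h z)" E] G component_psi unfolding measurable_edges_def by blast
    obtain I where I: "finite I" "component (G (h z)) x = (\<lambda>n. \<psi> n x) ` I"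
      using finite_subset_image[OF \<open>?l\<close> sub] by blast
    show ?r
    proof (rule exI[of _ "Suc (Max I)"], intro allI impI)
      fix n assume "\<psi> n x \<in> component (G (h z)) x"
      then obtain m where "m \<in> I" "\<psi> n x = \<psi> m x" using I by auto
      then show "\<exists>m<Suc (Max I). \<psi> n x = \<psi> m x" using I(1) by (metis Max_ge le_imp_less_Suc)
    qed
  next
    assume ?r
    then obtain N where N: "\<And>n. \<psi> n x \<in> component (G (h z)) x \<Longrightarrow> \<exists>m<N. \<psi> n x = \<psi> m x" by blast
    have "component (G (h z)) x \<subseteq> (\<lambda>m. \<psi> m x) ` {..<N}"
    proof
      fix y assume y: "y \<in> component (G (h z)) x"
      then have "y \<in> component E x" using component_mono[of "G (h z)" E] G unfolding measurable_edges_def by blast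
      then show "y \<in> (\<lambda>m. \<psi> m x) ` {..<N}" using component_psi[of x] N y by auto
    qed
    then show ?l by (rule finite_subset) simp
  qed
  then show ?thesis by simp
qed

section \<open>The mass transport principle\<close>

definition edge :: "'a \<Rightarrow> 'a \<Rightarrow> bool" where "edge x y \<longleftrightarrow> Upair x y \<in> E"

lemma edge_sym: "edge x y \<longleftrightarrow> edge y x"
  by (simp add: edge_def Upair_commute)

lemma measurable_edges_const:
  assumes "F \<subseteq> E" "pairs_of F \<in> sets (borel \<Otimes>\<^sub>M borel)"
  shows "measurable_edges M (\<lambda>_. F)"
proof -
  note assms(2)[measurable]
  have "Measurable.pred (M \<Otimes>\<^sub>M (borel \<Otimes>\<^sub>M borel)) (\<lambda>p. snd p \<in> pairs_of F)" by measurable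
  then show ?thesis using assms(1) unfolding measurable_edges_def pairs_of_def by (simp add: case_prod_unfold)
qed

lemma measurable_edges_E: "measurable_edges M (\<lambda>_. E)"
  by (rule measurable_edges_const) auto

lemma measurable_edge [measurable (raw)]:
  assumes [measurable]: "f \<in> borel_measurable N" "g \<in> borel_measurable N"
  shows "Measurable.pred N (\<lambda>z. edge (f z) (g z))"
  unfolding edge_def by (rule measurable_edgesD[OF measurable_edges_E[of N], where h = "\<lambda>z. z"]) measurable

lemma edge_component: "edge x y \<Longrightarrow> y \<in> component E x"
  by (simp add: edge_def component_edge)

text \<open>For a rectangle \<open>P = A \<times> B\<close> this is the defining identity of a
  graphing. Both sides are measures in \<open>P\<close>, so it extends to all Borel sets by the
  Dynkin argument for an intersection-stable generator; bounded degrees make both sides finite,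
  which the complement step uses.\<close>

lemma edge_mass_transport_set:
  assumes "P \<in> sets (borel \<Otimes>\<^sub>M borel)"
  shows "(\<integral>\<^sup>+ x. csum (\<lambda>y. if edge x y then indicator P (x, y) else 0) \<partial>\<mu>) =
    (\<integral>\<^sup>+ x. csum (\<lambda>y. if edge x y then indicator P (y, x) else 0) \<partial>\<mu>)"
proof -
  define L where "L P x = csum (\<lambda>y. if edge x y then indicator P (x, y) else 0)" for P x
  define R where "R P x = csum (\<lambda>y. if edge x y then indicator P (y, x) else 0)" for P x
  have Lm[measurable]: "L P \<in> borel_measurable borel" if [measurable]: "P \<in> sets (borel \<Otimes>\<^sub>M borel)" for P
    unfolding L_def by (rule measurable_csum[where p = "\<lambda>x. x"]) (measurable, auto dest: edge_component split: if_splits)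
  have Rm[measurable]: "R P \<in> borel_measurable borel" if [measurable]: "P \<in> sets (borel \<Otimes>\<^sub>M borel)" for P
    unfolding R_def by (rule measurable_csum[where p = "\<lambda>x. x"]) (measurable, auto dest: edge_component split: if_splits)
  have deg_in: "csum (\<lambda>y. if edge x y then indicator B y else 0) = of_nat (deg_in E B x)" for B x
  proof -
    have "(\<lambda>y. if edge x y then indicator B y else 0 :: ennreal) = indicator {y \<in> B. Upair x y \<in> E}"
      by (auto simp: edge_def indicator_def fun_eq_iff)
    moreover have "finite {y \<in> B. Upair x y \<in> E}" by (rule finite_subset[OF _ finite_nbrs[of x]]) auto
    ultimately show ?thesis by (simp add: deg_in_def emeasure_count_space_finite)
  qed
  have rect: "integral\<^sup>N \<mu> (L (A \<times> B)) = integral\<^sup>N \<mu> (R (A \<times> B))"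
    if AB: "A \<in> sets borel" "B \<in> sets borel" for A B
  proof -
    have "L (A \<times> B) x = of_nat (deg_in E B x) * indicator A x" for x
      unfolding L_def deg_in[symmetric] by (cases "x \<in> A") (auto simp: indicator_times cong: if_cong)
    then have 1: "L (A \<times> B) = (\<lambda>x. of_nat (deg_in E B x) * indicator A x)" ..
    have "R (A \<times> B) x = of_nat (deg_in E A x) * indicator B x" for x
      unfolding R_def deg_in[symmetric] by (cases "x \<in> B") (auto simp: indicator_times cong: if_cong)
    then have 2: "R (A \<times> B) = (\<lambda>x. of_nat (deg_in E A x) * indicator B x)" ..
    show ?thesis unfolding 1 2 using graphing AB unfolding graphing_def by simp
  qed
  have mono: "L P x \<le> L UNIV x" "R P x \<le> R UNIV x" for P x
    unfolding L_def R_def by (auto intro!: nn_integral_mono simp: indicator_def)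
  obtain D where D: "\<And>x. deg E x \<le> D"
    using graphing unfolding graphing_def by blast
  have LU: "L UNIV x \<le> of_nat D" "R UNIV x \<le> of_nat D" for x
    using deg_in[of x UNIV] D[of x] unfolding L_def R_def deg_in_def deg_def
    by (simp_all add: indicator_def cong: if_cong)
  have fin: "integral\<^sup>N \<mu> (L P) \<noteq> \<infinity>" "integral\<^sup>N \<mu> (R P) \<noteq> \<infinity>" for P
  proof -
    have "integral\<^sup>N \<mu> (L P) \<le> (\<integral>\<^sup>+ x. of_nat D \<partial>\<mu>)" "integral\<^sup>N \<mu> (R P) \<le> (\<integral>\<^sup>+ x. of_nat D \<partial>\<mu>)"
      by (rule nn_integral_mono, rule order_trans[OF mono(1) LU(1)], rule nn_integral_mono, rule order_trans[OF mono(2) LU(2)])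
    then show "integral\<^sup>N \<mu> (L P) \<noteq> \<infinity>" "integral\<^sup>N \<mu> (R P) \<noteq> \<infinity>"
      by (auto simp: emeasure_space_1[simplified] top_unique)
  qed
  have P: "P \<in> sigma_sets (UNIV \<times> UNIV) {a \<times> b |a b. a \<in> sets borel \<and> b \<in> sets borel}"
    using assms by (simp add: sets_pair_measure)
  have closed: "{a \<times> b |a b. a \<in> sets borel \<and> b \<in> sets borel} \<subseteq> Pow (UNIV \<times> UNIV :: ('a \<times> 'a) set)"
    by auto
  have "integral\<^sup>N \<mu> (L P) = integral\<^sup>N \<mu> (R P)"
    using Int_stable_pair_measure_generator[of "borel :: 'a measure" "borel :: 'a measure"] closed P
  proof (induction rule: sigma_sets_induct_disjoint)
    case (basic A)
    then show ?case using rect by auto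
  next
    case empty
    show ?case by (simp add: L_def R_def cong: if_cong)
  next
    case (compl A)
    have A[measurable]: "A \<in> sets (borel \<Otimes>\<^sub>M borel)" using compl by (simp add: sets_pair_measure)
    have "L (UNIV \<times> UNIV) x = L A x + L (UNIV \<times> UNIV - A) x" for x
      unfolding L_def by (subst nn_integral_add[symmetric]) (auto intro!: nn_integral_cong simp: indicator_def)
    then have "L (UNIV \<times> UNIV) = (\<lambda>x. L A x + L (UNIV \<times> UNIV - A) x)" ..
    then have 1: "integral\<^sup>N \<mu> (L (UNIV \<times> UNIV)) = integral\<^sup>N \<mu> (L A) + integral\<^sup>N \<mu> (L (UNIV \<times> UNIV - A))"
      by (simp only:) (rule nn_integral_add; measurable)
    have "R (UNIV \<times> UNIV) x = R A x + R (UNIV \<times> UNIV - A) x" for x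
      unfolding R_def by (subst nn_integral_add[symmetric]) (auto intro!: nn_integral_cong simp: indicator_def)
    then have "R (UNIV \<times> UNIV) = (\<lambda>x. R A x + R (UNIV \<times> UNIV - A) x)" ..
    then have 2: "integral\<^sup>N \<mu> (R (UNIV \<times> UNIV)) = integral\<^sup>N \<mu> (R A) + integral\<^sup>N \<mu> (R (UNIV \<times> UNIV - A))"
      by (simp only:) (rule nn_integral_add; measurable)
    show ?case using 1 2 rect[of UNIV UNIV] compl fin(1)[of A] by (simp add: ennreal_add_left_cancel)
  next
    case (union A)
    have A[measurable]: "A n \<in> sets (borel \<Otimes>\<^sub>M borel)" for n using union by (auto simp: sets_pair_measure)
    have ind: "indicator (\<Union>n. A n) p = (\<Sum>n. indicator (A n) p :: ennreal)" for p
      using union(1) by (rule suminf_indicator[symmetric])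
    have "L (\<Union>n. A n) x = (\<Sum>n. L (A n) x)" for x
      unfolding L_def by (subst nn_integral_suminf[symmetric]) (auto intro!: nn_integral_cong simp: ind)
    then have "L (\<Union>n. A n) = (\<lambda>x. \<Sum>n. L (A n) x)" ..
    then have 1: "integral\<^sup>N \<mu> (L (\<Union>n. A n)) = (\<Sum>n. integral\<^sup>N \<mu> (L (A n)))"
      by (simp only:) (rule nn_integral_suminf; measurable)
    have "R (\<Union>n. A n) x = (\<Sum>n. R (A n) x)" for x
      unfolding R_def by (subst nn_integral_suminf[symmetric]) (auto intro!: nn_integral_cong simp: ind)
    then have "R (\<Union>n. A n) = (\<lambda>x. \<Sum>n. R (A n) x)" ..
    then have 2: "integral\<^sup>N \<mu> (R (\<Union>n. A n)) = (\<Sum>n. integral\<^sup>N \<mu> (R (A n)))"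
      by (simp only:) (rule nn_integral_suminf; measurable)
    show ?case using 1 2 union by simp
  qed
  then show ?thesis unfolding L_def[abs_def] R_def[abs_def] .
qed

definition edge_sum :: "('a \<times> 'a \<Rightarrow> ennreal) \<Rightarrow> 'a \<Rightarrow> ennreal" where
  "edge_sum K x = csum (\<lambda>y. if edge x y then K (x, y) else 0)"

lemma edge_sum_measurable [measurable]:
  assumes [measurable]: "K \<in> borel_measurable (borel \<Otimes>\<^sub>M borel)"
  shows "edge_sum K \<in> borel_measurable borel"
  unfolding edge_sum_def
  by (rule measurable_csum[where p = "\<lambda>x. x"]) (measurable, auto dest: edge_component split: if_splits)

lemma edge_sum_mult: "edge_sum (\<lambda>p. c * K p) x = c * edge_sum K x"
  unfolding edge_sum_def
  by (subst nn_integral_cmult[symmetric]) (auto intro!: nn_integral_cong)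

lemma edge_sum_add: "edge_sum (\<lambda>p. K p + L p) x = edge_sum K x + edge_sum L x"
  unfolding edge_sum_def
  by (subst nn_integral_add[symmetric]) (auto intro!: nn_integral_cong)

lemma edge_sum_mono: "(\<And>p. K p \<le> L p) \<Longrightarrow> edge_sum K x \<le> edge_sum L x"
  unfolding edge_sum_def by (rule nn_integral_mono) auto

lemma edge_sum_SUP:
  assumes "incseq U"
  shows "edge_sum (\<lambda>p. SUP i. U i p) x = (SUP i. edge_sum (U i) x)"
proof -
  have "edge_sum (\<lambda>p. SUP i. U i p) x = csum (\<lambda>y. SUP i::nat. if edge x y then U i (x, y) else 0)"
    unfolding edge_sum_def by (rule nn_integral_cong) auto
  also have "\<dots> = (SUP i. csum (\<lambda>y. if edge x y then U i (x, y) else 0))"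
    by (rule nn_integral_monotone_convergence_SUP)
      (use assms in \<open>auto simp: incseq_def le_fun_def\<close>)
  finally show ?thesis by (simp add: edge_sum_def)
qed

lemma edge_mass_transport:
  assumes "K \<in> borel_measurable (borel \<Otimes>\<^sub>M borel)"
  shows "(\<integral>\<^sup>+ x. edge_sum K x \<partial>\<mu>) = (\<integral>\<^sup>+ x. edge_sum (\<lambda>p. K (snd p, fst p)) x \<partial>\<mu>)"
  using assms
proof (induction K rule: borel_measurable_induct)
  case (cong f g)
  then have "f = g" by (auto simp: space_pair_measure)
  then show ?case using cong by simp
next
  case (set A)
  then show ?case using edge_mass_transport_set[of A] by (simp add: edge_sum_def cong: if_cong)
next
  case (mult u c)
  note [measurable] = mult(2)
  show ?case using mult(4) by (simp add: edge_sum_mult nn_integral_cmult)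
next
  case (add u v)
  note [measurable] = add.hyps(1,3)
  show ?case using add.IH by (simp add: edge_sum_add nn_integral_add)
next
  case (seq U)
  note [measurable] = seq(1)
  have inc: "incseq (\<lambda>i p. U i (snd p, fst p))" using seq.hyps(3) by (auto simp: incseq_def le_fun_def)
  have inc1: "incseq (\<lambda>i x. edge_sum (U i) x)"
    using seq.hyps(3) by (auto simp: incseq_def le_fun_def intro!: edge_sum_mono)
  have inc2: "incseq (\<lambda>i x. edge_sum (\<lambda>p. U i (snd p, fst p)) x)"
    using inc by (auto simp: incseq_def le_fun_def intro!: edge_sum_mono)
  have "(\<integral>\<^sup>+ x. edge_sum (\<Squnion>i. U i) x \<partial>\<mu>) = (\<integral>\<^sup>+ x. (SUP i. edge_sum (U i) x) \<partial>\<mu>)"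
    by (simp add: edge_sum_SUP[OF seq.hyps(3), symmetric] image_comp SUP_apply[abs_def])
  also have "\<dots> = (SUP i. \<integral>\<^sup>+ x. edge_sum (U i) x \<partial>\<mu>)"
    by (rule nn_integral_monotone_convergence_SUP[OF inc1]) measurable
  also have "\<dots> = (SUP i. \<integral>\<^sup>+ x. edge_sum (\<lambda>p. U i (snd p, fst p)) x \<partial>\<mu>)"
    using seq.IH by simp
  also have "\<dots> = (\<integral>\<^sup>+ x. (SUP i. edge_sum (\<lambda>p. U i (snd p, fst p)) x) \<partial>\<mu>)"
    by (rule nn_integral_monotone_convergence_SUP[OF inc2, symmetric]) measurable
  also have "\<dots> = (\<integral>\<^sup>+ x. edge_sum (\<lambda>p. (\<Squnion>i. U i) (snd p, fst p)) x \<partial>\<mu>)"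
    by (simp add: edge_sum_SUP[OF inc, symmetric] image_comp)
  finally show ?case .
qed

definition steps :: "nat \<Rightarrow> 'a \<Rightarrow> 'a \<Rightarrow> bool" where
  "steps k x y \<longleftrightarrow> (x, y) \<in> pairs_of E ^^ k"

lemma steps_measurable [measurable (raw)]:
  assumes [measurable]: "f \<in> borel_measurable N" "g \<in> borel_measurable N"
  shows "Measurable.pred N (\<lambda>z. steps k (f z) (g z))"
  unfolding steps_def
  by (rule measurable_relpow[OF measurable_edges_E[of N], where h = "\<lambda>z. z"]) measurable

lemma steps_component: "steps k x y \<Longrightarrow> y \<in> component E x"
  unfolding steps_def component_def using relpow_imp_rtrancl by fastforce

lemma component_steps: "y \<in> component E x \<longleftrightarrow> (\<exists>k. steps k x y)"
  by (simp add: component_def steps_def rtrancl_is_UN_relpow)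

lemma steps_Suc: "steps (Suc k) x z \<longleftrightarrow> (\<exists>y. steps k x y \<and> edge y z)"
  by (auto simp: steps_def edge_def pairs_of_def relcomp_unfold)

lemma finite_steps: "finite {y. steps k x y}"
proof (induction k)
  case 0
  show ?case by (simp add: steps_def)
next
  case (Suc k)
  have "{z. steps (Suc k) x z} = (\<Union>y\<in>{y. steps k x y}. {z. Upair y z \<in> E})"
    by (auto simp: steps_Suc edge_def)
  then show ?case using Suc finite_nbrs by auto
qed

text \<open>The point of integration travels along the walk: the induction hypothesis moves it from
  the start over the first \<open>k\<close> steps to the last midpoint, and the edge identity moves
  it from there to the end.\<close>

lemma steps_mass_transport:
  assumes "(\<lambda>p. K (fst p) (snd p)) \<in> borel_measurable (borel \<Otimes>\<^sub>M borel)"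
  shows "(\<integral>\<^sup>+ x. csum (\<lambda>y. if steps k x y then K x y else 0) \<partial>\<mu>) =
    (\<integral>\<^sup>+ x. csum (\<lambda>y. if steps k y x then K y x else 0) \<partial>\<mu>)"
  using assms
proof (induction k arbitrary: K)
  case 0
  have "(if steps 0 x y then K x y else 0) = (if steps 0 y x then K y x else 0)" for x y
    by (auto simp: steps_def)
  then show ?case by presburger
next
  case (Suc k)
  note Suc.prems[measurable]
  have K2[measurable (raw)]: "(\<lambda>z. K (f z) (g z)) \<in> borel_measurable N"
    if [measurable]: "f \<in> borel_measurable N" "g \<in> borel_measurable N" for f g :: "'z \<Rightarrow> 'a" and N
    using measurable_compose[OF _ Suc.prems, of "\<lambda>z. (f z, g z)" N] by simp
  \<comment> \<open>Dividing by the number of midpoints compensates for the multiplicity of walks in the composition.\<close>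
  define c where "c x z = csum (\<lambda>y. if steps k x y \<and> edge y z then 1 else 0)" for x z
  have c_card: "c x z = of_nat (card {y. steps k x y \<and> edge y z})" for x z
  proof -
    have "(\<lambda>y. if steps k x y \<and> edge y z then 1 else 0 :: ennreal) = indicator {y. steps k x y \<and> edge y z}"
      by (auto simp: indicator_def)
    moreover have "finite {y. steps k x y \<and> edge y z}" by (rule finite_subset[OF _ finite_steps[of k x]]) auto
    ultimately show ?thesis unfolding c_def by (simp add: emeasure_count_space_finite)
  qed
  have fin: "finite {y. steps k x y \<and> edge y z}" for x z by (rule finite_subset[OF _ finite_steps[of k x]]) auto
  have c0: "c x z \<noteq> 0 \<longleftrightarrow> steps (Suc k) x z" for x z
    using fin[of x z] by (auto simp: c_card steps_Suc card_eq_0_iff)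
  have cm: "(\<lambda>p. c (fst p) (snd p)) \<in> borel_measurable (borel \<Otimes>\<^sub>M borel)"
    unfolding c_def
    by (rule measurable_csum[where p = fst]) (measurable, auto dest: steps_component split: if_splits)
  have [measurable (raw)]: "(\<lambda>z. c (f z) (g z)) \<in> borel_measurable N"
    if [measurable]: "f \<in> borel_measurable N" "g \<in> borel_measurable N" for f g :: "'z \<Rightarrow> 'a" and N
    using measurable_compose[OF _ cm, of "\<lambda>z. (f z, g z)" N] by simp
  define J where "J x z = K x z / c x z" for x z
  have Jm: "(\<lambda>p. J (fst p) (snd p)) \<in> borel_measurable (borel \<Otimes>\<^sub>M borel)" unfolding J_def by measurable
  have [measurable (raw)]: "(\<lambda>z. J (f z) (g z)) \<in> borel_measurable N"
    if [measurable]: "f \<in> borel_measurable N" "g \<in> borel_measurable N" for f g :: "'z \<Rightarrow> 'a" and N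
    using measurable_compose[OF _ Jm, of "\<lambda>z. (f z, g z)" N] by simp
  have split: "(if steps (Suc k) x z then K x z else 0) = csum (\<lambda>y. if steps k x y \<and> edge y z then J x z else 0)" for x z
  proof -
    have "csum (\<lambda>y. if steps k x y \<and> edge y z then J x z else 0) = J x z * c x z"
      unfolding c_def by (subst nn_integral_cmult[symmetric]) (auto intro!: nn_integral_cong)
    also have "\<dots> = (if steps (Suc k) x z then K x z else 0)"
    proof (cases "steps (Suc k) x z")
      case True
      moreover have "c x z < top" by (simp add: c_card less_top[symmetric])
      ultimately have "c x z / c x z = 1" using c0[of x z] by (intro ennreal_divide_self) auto
      then show ?thesis using True by (simp add: J_def ennreal_divide_times)
    qed (use c0[of x z] in simp)
    finally show ?thesis by simp
  qed
  define L where "L x y = csum (\<lambda>z. if edge y z then J x z else 0)" for x y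
  have Lm: "(\<lambda>p. L (fst p) (snd p)) \<in> borel_measurable (borel \<Otimes>\<^sub>M borel)"
    unfolding L_def
    by (rule measurable_csum[where p = snd]) (measurable, auto dest: edge_component split: if_splits)
  define M where "M x z = csum (\<lambda>y. if steps k y x then J y z else 0)" for x z
  have Mm: "(\<lambda>p. M (fst p) (snd p)) \<in> borel_measurable (borel \<Otimes>\<^sub>M borel)"
    unfolding M_def
    by (rule measurable_csum[where p = fst])
      (measurable, auto dest: steps_component component_sym[THEN iffD1] split: if_splits)
  have "(\<integral>\<^sup>+ x. csum (\<lambda>z. if steps (Suc k) x z then K x z else 0) \<partial>\<mu>) =
    (\<integral>\<^sup>+ x. csum (\<lambda>y. csum (\<lambda>z. if steps k x y \<and> edge y z then J x z else 0)) \<partial>\<mu>)"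
    unfolding split by (subst csum_swap) simp
  also have "\<dots> = (\<integral>\<^sup>+ x. csum (\<lambda>y. if steps k x y then L x y else 0) \<partial>\<mu>)"
    unfolding L_def by (intro nn_integral_cong) (auto intro!: nn_integral_cong)
  also have "\<dots> = (\<integral>\<^sup>+ x. csum (\<lambda>y. if steps k y x then L y x else 0) \<partial>\<mu>)"
    by (rule Suc.IH[OF Lm])
  also have "\<dots> = (\<integral>\<^sup>+ x. csum (\<lambda>y. csum (\<lambda>z. if steps k y x \<and> edge x z then J y z else 0)) \<partial>\<mu>)"
    unfolding L_def by (intro nn_integral_cong) (auto intro!: nn_integral_cong)
  also have "\<dots> = (\<integral>\<^sup>+ x. csum (\<lambda>z. csum (\<lambda>y. if steps k y x \<and> edge x z then J y z else 0)) \<partial>\<mu>)"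
    by (subst csum_swap) simp
  also have "\<dots> = (\<integral>\<^sup>+ x. csum (\<lambda>z. if edge x z then M x z else 0) \<partial>\<mu>)"
    unfolding M_def by (intro nn_integral_cong) (auto intro!: nn_integral_cong)
  also have "\<dots> = (\<integral>\<^sup>+ x. csum (\<lambda>z. if edge x z then M z x else 0) \<partial>\<mu>)"
    using edge_mass_transport[OF Mm] by (simp add: edge_sum_def cong: if_cong)
  also have "\<dots> = (\<integral>\<^sup>+ x. csum (\<lambda>z. csum (\<lambda>y. if steps k y z \<and> edge z x then J y x else 0)) \<partial>\<mu>)"
    unfolding M_def by (intro nn_integral_cong) (auto intro!: nn_integral_cong simp: edge_sym)
  also have "\<dots> = (\<integral>\<^sup>+ x. csum (\<lambda>y. csum (\<lambda>z. if steps k y z \<and> edge z x then J y x else 0)) \<partial>\<mu>)"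
    by (subst csum_swap) simp
  also have "\<dots> = (\<integral>\<^sup>+ x. csum (\<lambda>y. if steps (Suc k) y x then K y x else 0) \<partial>\<mu>)"
    unfolding split ..
  finally show ?case .
qed

text \<open>The kernel is cut up by graph distance: \<open>L k\<close> drops the pairs joined by a
  shorter walk, so each pair in a common component occurs in exactly one \<open>J k\<close>, and the
  pieces add up to \<open>K\<close>.\<close>

lemma mass_transport:
  assumes K[measurable]: "(\<lambda>p. K (fst p) (snd p)) \<in> borel_measurable (borel \<Otimes>\<^sub>M borel)"
    and supp: "\<And>x y. K x y \<noteq> 0 \<Longrightarrow> y \<in> component E x"
  shows "(\<integral>\<^sup>+ x. csum (\<lambda>y. K x y) \<partial>\<mu>) = (\<integral>\<^sup>+ x. csum (\<lambda>y. K y x) \<partial>\<mu>)"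
proof -
  have Km: "(\<lambda>z. K (f z) (g z)) \<in> borel_measurable N"
    if [measurable]: "f \<in> borel_measurable N" "g \<in> borel_measurable N" for f g :: "'z \<Rightarrow> 'a" and N
    using measurable_compose[OF _ K, of "\<lambda>z. (f z, g z)" N] by simp
  have [measurable]: "(\<lambda>p. K (snd p) (fst p)) \<in> borel_measurable (borel \<Otimes>\<^sub>M borel)"
    by (rule Km) measurable
  define L where "L k x y = (if \<forall>j<k. \<not> steps j x y then K x y else 0)" for k x y
  have Lm: "(\<lambda>p. L k (fst p) (snd p)) \<in> borel_measurable (borel \<Otimes>\<^sub>M borel)" for k
    unfolding L_def by measurable
  define J where "J k x y = (if steps k x y then L k x y else 0)" for k x y
  have J1: "(\<lambda>p. J k (fst p) (snd p)) \<in> borel_measurable (borel \<Otimes>\<^sub>M borel)"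
    and J2: "(\<lambda>p. J k (snd p) (fst p)) \<in> borel_measurable (borel \<Otimes>\<^sub>M borel)" for k
    unfolding J_def L_def by measurable
  have J1': "(\<lambda>x. csum (\<lambda>y. J k x y)) \<in> borel_measurable borel" for k
    by (rule measurable_csum[where p = "\<lambda>x. x", OF J1]) (auto simp: J_def dest: steps_component split: if_splits)
  have J2': "(\<lambda>x. csum (\<lambda>y. J k y x)) \<in> borel_measurable borel" for k
    by (rule measurable_csum[where p = "\<lambda>x. x", OF J2])
      (auto simp: J_def dest: steps_component component_sym[THEN iffD1] split: if_splits)
  have sum: "K x y = (\<Sum>k. J k x y)" for x y
  proof (cases "y \<in> component E x")
    case True
    then have ex: "\<exists>k. steps k x y" by (simp add: component_steps)
    define m where "m = (LEAST k. steps k x y)"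
    have m: "steps m x y" unfolding m_def by (rule LeastI_ex[OF ex])
    have m': "\<not> steps j x y" if "j < m" for j using that unfolding m_def by (rule not_less_Least)
    have "J k x y = (if k = m then K x y else 0)" for k
      by (cases k m rule: linorder_cases) (use m m' in \<open>auto simp: J_def L_def\<close>)
    then show ?thesis using sums_single[of m "\<lambda>_. K x y"] by (simp add: sums_iff)
  next
    case False
    then have "K x y = 0" using supp by blast
    moreover have "J k x y = 0" for k using False by (auto simp: J_def dest: steps_component)
    ultimately show ?thesis by simp
  qed
  have "(\<integral>\<^sup>+ x. csum (\<lambda>y. K x y) \<partial>\<mu>) = (\<integral>\<^sup>+ x. (\<Sum>k. csum (\<lambda>y. J k x y)) \<partial>\<mu>)"
    unfolding sum by (subst nn_integral_suminf) auto
  also have "\<dots> = (\<Sum>k. \<integral>\<^sup>+ x. csum (\<lambda>y. J k x y) \<partial>\<mu>)"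
    by (rule nn_integral_suminf) (use J1' in measurable)
  also have "\<dots> = (\<Sum>k. \<integral>\<^sup>+ x. csum (\<lambda>y. J k y x) \<partial>\<mu>)"
    unfolding J_def steps_mass_transport[OF Lm] ..
  also have "\<dots> = (\<integral>\<^sup>+ x. (\<Sum>k. csum (\<lambda>y. J k y x)) \<partial>\<mu>)"
    by (rule nn_integral_suminf[symmetric]) (use J2' in measurable)
  also have "\<dots> = (\<integral>\<^sup>+ x. csum (\<lambda>y. K y x) \<partial>\<mu>)"
    unfolding sum by (subst nn_integral_suminf) auto
  finally show ?thesis .
qed

end

section \<open>Borel linear orders, roots and the rank\<close>

text \<open>The order of 0-1 sequences by their first difference, read through the tests
  \<open>b k\<close>. Countably many Borel tests that separate points yield a Borel strict linear
  order.\<close>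

definition lex_less :: "(nat \<Rightarrow> 'b \<Rightarrow> bool) \<Rightarrow> 'b \<Rightarrow> 'b \<Rightarrow> bool" where
  "lex_less b x y \<longleftrightarrow> (\<exists>k. (\<forall>j<k. b j x = b j y) \<and> \<not> b k x \<and> b k y)"

lemma lex_less_irrefl: "\<not> lex_less b x x"
  by (simp add: lex_less_def)

lemma lex_less_trans:
  assumes "lex_less b x y" "lex_less b y z" shows "lex_less b x z"
proof -
  obtain k l where k: "\<forall>j<k. b j x = b j y" "\<not> b k x" "b k y"
    and l: "\<forall>j<l. b j y = b j z" "\<not> b l y" "b l z"
    using assms by (auto simp: lex_less_def)
  have "k \<noteq> l" using k l by auto
  then show ?thesis unfolding lex_less_def
    by (intro exI[of _ "min k l"]) (use k l in \<open>auto simp: min_def\<close>)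
qed

lemma lex_less_total:
  assumes "b k x \<noteq> b k y"
  shows "lex_less b x y \<or> lex_less b y x"
proof -
  define m where "m = (LEAST k. b k x \<noteq> b k y)"
  have "b m x \<noteq> b m y" unfolding m_def by (rule LeastI[of _ k]) (rule assms)
  moreover have "b j x = b j y" if "j < m" for j
    using not_less_Least[OF that[unfolded m_def]] by blast
  ultimately show ?thesis unfolding lex_less_def by metis
qed

lemma borel_strict_linear_order:
  "\<exists>r :: 'a::{second_countable_topology, t2_space} \<Rightarrow> 'a \<Rightarrow> bool.
     (\<forall>x. \<not> r x x) \<and> (\<forall>x y z. r x y \<longrightarrow> r y z \<longrightarrow> r x z) \<and> (\<forall>x y. x \<noteq> y \<longrightarrow> r x y \<or> r y x) \<and>
     Measurable.pred (borel \<Otimes>\<^sub>M borel) (\<lambda>p. r (fst p) (snd p))"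
proof -
  obtain U :: "nat \<Rightarrow> 'a set" where U: "\<And>n. open (U n)"
    "\<And>S x. open S \<Longrightarrow> x \<in> S \<Longrightarrow> \<exists>n. x \<in> U n \<and> U n \<subseteq> S"
    using countable_base_sequence by blast
  have [measurable]: "U n \<in> sets borel" for n using U(1) by simp
  define r where "r = lex_less (\<lambda>n x. x \<in> U n)"
  have "r x y \<or> r y x" if ne: "x \<noteq> y" for x y
  proof -
    obtain n where "x \<in> U n" "U n \<subseteq> - {y}" using U(2)[of "- {y}" x] ne by (auto simp: open_Compl)
    then have "(x \<in> U n) \<noteq> (y \<in> U n)" by auto
    then show ?thesis unfolding r_def by (rule lex_less_total)
  qed
  moreover have "Measurable.pred (borel \<Otimes>\<^sub>M borel) (\<lambda>p. r (fst p) (snd p))"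
    unfolding r_def lex_less_def by measurable
  ultimately show ?thesis
    by (intro exI[of _ r]) (auto simp: r_def lex_less_irrefl intro: lex_less_trans)
qed

text \<open>Linearity is required on all unordered pairs, not only on edges; measurability is stated
  on ordered pairs, through which Borel sets of edges are encoded.\<close>

definition edge_order :: "('a::topological_space uprod \<Rightarrow> 'a uprod \<Rightarrow> bool) \<Rightarrow> bool" where
  "edge_order r \<longleftrightarrow> (\<forall>e. \<not> r e e) \<and> (\<forall>e e' e''. r e e' \<longrightarrow> r e' e'' \<longrightarrow> r e e'') \<and>
     (\<forall>e e'. e \<noteq> e' \<longrightarrow> r e e' \<or> r e' e) \<and>
     Measurable.pred ((borel \<Otimes>\<^sub>M borel) \<Otimes>\<^sub>M (borel \<Otimes>\<^sub>M borel))
       (\<lambda>q. r (Upair (fst (fst q)) (snd (fst q))) (Upair (fst (snd q)) (snd (snd q))))"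

text \<open>Heavier edges come first; equal weights are compared lexicographically by tests
  \<open>b k\<close> that ask whether the two ends lie, in one order or the other, in a given pair
  of basic open sets. These tests separate distinct unordered pairs, since one of the pairs has an
  end that is not an end of the other.\<close>

lemma edge_order_by_weight:
  fixes w :: "'a::{second_countable_topology, t2_space} uprod \<Rightarrow> real"
  assumes w: "(\<lambda>p. w (Upair (fst p) (snd p))) \<in> borel_measurable (borel \<Otimes>\<^sub>M borel)"
  shows "\<exists>above. edge_order above \<and> (\<forall>e e'. above e e' \<longrightarrow> w e' \<le> w e)"
proof -
  obtain U :: "nat \<Rightarrow> 'a set" where U: "\<And>n. open (U n)"
    "\<And>S x. open S \<Longrightarrow> x \<in> S \<Longrightarrow> \<exists>n. x \<in> U n \<and> U n \<subseteq> S"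
    using countable_base_sequence by blast
  have [measurable]: "U n \<in> sets borel" for n using U(1) by simp
  define b where "b k e \<longleftrightarrow> (\<exists>x y. e = Upair x y \<and> x \<in> U (fst (prod_decode k)) \<and> y \<in> U (snd (prod_decode k)))" for k e
  have b: "b k (Upair x y) \<longleftrightarrow> x \<in> U (fst (prod_decode k)) \<and> y \<in> U (snd (prod_decode k)) \<or>
      y \<in> U (fst (prod_decode k)) \<and> x \<in> U (snd (prod_decode k))" for k x y
    by (auto simp: b_def)
  have sep1: "\<exists>k. b k (Upair x y) \<noteq> b k (Upair u v)" if ne: "x \<noteq> u" "x \<noteq> v" for x y u v
  proof -
    obtain n where n: "x \<in> U n" "U n \<subseteq> - {u, v}" using U(2)[of "- {u, v}" x] ne by (auto simp: open_Compl)
    obtain m where m: "y \<in> U m" using U(2)[of UNIV y] by auto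
    have "b (prod_encode (n, m)) (Upair x y)" "\<not> b (prod_encode (n, m)) (Upair u v)"
      unfolding b using n m by auto
    then show ?thesis by auto
  qed
  have sep: "\<exists>k. b k e \<noteq> b k e'" if "e \<noteq> e'" for e e'
  proof -
    obtain x y where e: "e = Upair x y" by (cases e)
    obtain u v where e': "e' = Upair u v" by (cases e')
    have "(x \<noteq> u \<and> x \<noteq> v) \<or> (y \<noteq> u \<and> y \<noteq> v) \<or> (u \<noteq> x \<and> u \<noteq> y) \<or> (v \<noteq> x \<and> v \<noteq> y)"
      using that e e' by auto
    then show ?thesis
      using sep1[of x u v y] sep1[of y u v x] sep1[of u x y v] sep1[of v x y u] e e' Upair_commute[of x y] Upair_commute[of u v]
      by metis
  qed
  define r where "r e e' \<longleftrightarrow> w e' < w e \<or> w e' = w e \<and> lex_less b e' e" for e e'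
  have "\<not> r e e" for e by (simp add: r_def lex_less_irrefl)
  moreover have "r e e''" if "r e e'" "r e' e''" for e e' e''
    using that lex_less_trans[of b e'' e' e] unfolding r_def by auto
  moreover have "r e e' \<or> r e' e" if "e \<noteq> e'" for e e'
    using sep[OF that] lex_less_total[of b _ e e'] unfolding r_def by (metis linorder_less_linear)
  moreover have "Measurable.pred ((borel \<Otimes>\<^sub>M borel) \<Otimes>\<^sub>M (borel \<Otimes>\<^sub>M borel))
       (\<lambda>q. r (Upair (fst (fst q)) (snd (fst q))) (Upair (fst (snd q)) (snd (snd q))))"
  proof -
    have [measurable]: "(\<lambda>q::('a \<times> 'a) \<times> ('a \<times> 'a). w (Upair (fst (fst q)) (snd (fst q)))) \<in> borel_measurable ((borel \<Otimes>\<^sub>M borel) \<Otimes>\<^sub>M (borel \<Otimes>\<^sub>M borel))"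
      by (rule measurable_compose[OF measurable_fst w])
    have [measurable]: "(\<lambda>q::('a \<times> 'a) \<times> ('a \<times> 'a). w (Upair (fst (snd q)) (snd (snd q)))) \<in> borel_measurable ((borel \<Otimes>\<^sub>M borel) \<Otimes>\<^sub>M (borel \<Otimes>\<^sub>M borel))"
      by (rule measurable_compose[OF measurable_snd w])
    show ?thesis unfolding r_def lex_less_def b by measurable
  qed
  moreover have "w e' \<le> w e" if "r e e'" for e e' using that by (auto simp: r_def)
  ultimately show ?thesis unfolding edge_order_def by blast
qed

lemma csum_if_eq: "csum (\<lambda>y. if y = r then c else 0) = c"
proof -
  have "csum (\<lambda>y. if y = r then c else 0) = csum (\<lambda>y. c * indicator {r} y)"
    by (rule nn_integral_cong) auto
  also have "\<dots> = c" by (subst nn_integral_cmult_indicator) auto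
  finally show ?thesis .
qed

lemma csum_if_const:
  assumes "finite A"
  shows "csum (\<lambda>y. if y \<in> A then c else 0) = c * of_nat (card A)"
proof -
  have "csum (\<lambda>y. if y \<in> A then c else 0) = csum (\<lambda>y. c * indicator A y)"
    by (rule nn_integral_cong) auto
  also have "\<dots> = c * of_nat (card A)"
    using assms by (subst nn_integral_cmult_indicator) (auto simp: emeasure_count_space_finite)
  finally show ?thesis .
qed

section \<open>Roots of finite components\<close>

context graphing_space
begin

definition vless :: "'a \<Rightarrow> 'a \<Rightarrow> bool" where
  "vless = (SOME r. (\<forall>x. \<not> r x x) \<and> (\<forall>x y z. r x y \<longrightarrow> r y z \<longrightarrow> r x z) \<and> (\<forall>x y. x \<noteq> y \<longrightarrow> r x y \<or> r y x) \<and>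
     Measurable.pred (borel \<Otimes>\<^sub>M borel) (\<lambda>p. r (fst p) (snd p)))"

lemma vless_irrefl: "\<not> vless x x"
  and vless_trans: "vless x y \<Longrightarrow> vless y z \<Longrightarrow> vless x z"
  and vless_total: "x \<noteq> y \<Longrightarrow> vless x y \<or> vless y x"
  and vless_pred: "Measurable.pred (borel \<Otimes>\<^sub>M borel) (\<lambda>p. vless (fst p) (snd p))"
  using someI_ex[OF borel_strict_linear_order[where 'a = 'a]] unfolding vless_def[symmetric] by blast+

lemma vless_asym: "vless x y \<Longrightarrow> \<not> vless y x"
  using vless_irrefl vless_trans by blast

lemma vless_measurable [measurable (raw)]:
  assumes [measurable]: "f \<in> borel_measurable N" "g \<in> borel_measurable N"
  shows "Measurable.pred N (\<lambda>z. vless (f z) (g z))"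
  using measurable_compose[OF _ vless_pred, of "\<lambda>z. (f z, g z)" N] by simp

definition is_root :: "'a uprod set \<Rightarrow> 'a \<Rightarrow> bool" where
  "is_root F v \<longleftrightarrow> finite (component F v) \<and> (\<forall>u\<in>component F v. u = v \<or> vless v u)"

lemma root_antimono: "F \<subseteq> G \<Longrightarrow> is_root G v \<Longrightarrow> is_root F v"
  using component_mono[of F G v] unfolding is_root_def by (meson finite_subset subset_iff)

lemma root_unique:
  assumes "is_root F u" "is_root F v" "u \<in> component F v"
  shows "u = v"
proof -
  have "v \<in> component F u" using assms(3) by (rule component_sym[THEN iffD1])
  then have "v = u \<or> vless u v" using assms(1) by (simp add: is_root_def)
  moreover have "u = v \<or> vless v u" using assms(2,3) by (simp add: is_root_def)
  ultimately show ?thesis using vless_asym by metis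
qed

lemma finite_has_vless_least:
  assumes "finite S" "S \<noteq> {}"
  shows "\<exists>v\<in>S. \<forall>u\<in>S. u = v \<or> vless v u"
  using assms
proof (induction rule: finite_ne_induct)
  case (insert x S)
  then obtain v where v: "v \<in> S" "\<forall>u\<in>S. u = v \<or> vless v u" by blast
  show ?case
  proof (cases "vless x v")
    case True
    then show ?thesis using v vless_trans by (intro bexI[of _ x]) auto
  next
    case False
    then show ?thesis using v vless_total[of x v] by (intro bexI[of _ v]) auto
  qed
qed simp

lemma root_exists:
  assumes "finite (component F x)"
  obtains r where "r \<in> component F x" "is_root F r"
  using finite_has_vless_least[OF assms] component_eq[of _ F x] assms component_refl
  unfolding is_root_def by (metis empty_iff)

lemma measurable_root:
  assumes G: "measurable_edges M G" and [measurable]: "h \<in> N \<rightarrow>\<^sub>M M" "f \<in> borel_measurable N"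
  shows "Measurable.pred N (\<lambda>z. is_root (G (h z)) (f z))"
proof -
  have [measurable]: "Measurable.pred N (\<lambda>z. \<psi> n (f z) \<in> component (G (h z)) (f z))" for n
    by (rule measurable_component[OF G]) measurable
  have [measurable]: "Measurable.pred N (\<lambda>z. finite (component (G (h z)) (f z)))"
    by (rule measurable_finite_component[OF G]) measurable
  have "component (G (h z)) x \<subseteq> range (\<lambda>n. \<psi> n x)" for z x
    using component_mono[of "G (h z)" E] G component_psi unfolding measurable_edges_def by blast
  then have "is_root (G (h z)) x \<longleftrightarrow> finite (component (G (h z)) x) \<and>
    (\<forall>n. \<psi> n x \<in> component (G (h z)) x \<longrightarrow> \<psi> n x = x \<or> vless x (\<psi> n x))" for z x
    unfolding is_root_def by blast
  then show ?thesis by simp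
qed

lemma edge_setsD: "A \<in> edge_sets E \<Longrightarrow> A \<subseteq> E" "A \<in> edge_sets E \<Longrightarrow> pairs_of A \<in> sets (borel \<Otimes>\<^sub>M borel)"
  by (auto simp: edge_sets_def)

lemma measurable_edges_edge_sets: "A \<in> edge_sets E \<Longrightarrow> measurable_edges M (\<lambda>_. A)"
  by (intro measurable_edges_const edge_setsD)

lemma measurable_root_const [measurable]:
  assumes "A \<in> edge_sets E"
  shows "Measurable.pred borel (is_root A)"
  using measurable_root[OF measurable_edges_edge_sets[OF assms], of "\<lambda>x. x" borel borel "\<lambda>x. x"] by simp

lemma root_sets [measurable]: "A \<in> edge_sets E \<Longrightarrow> {v. is_root A v} \<in> sets borel"
  using measurable_root_const[of A] by (simp add: pred_def)

text \<open>Every vertex of a finite component sends the reciprocal of the component size to the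
  root. A root receives 1 in total and infinite components have no root, so mass transport turns the
  integral in the rank into the measure of the set of roots.\<close>

lemma rank_eq:
  assumes A: "A \<in> edge_sets E"
  shows "rank \<mu> A = measure \<mu> {v. \<not> is_root A v}"
proof -
  have [measurable]: "Measurable.pred (borel \<Otimes>\<^sub>M borel) (\<lambda>p. snd p \<in> component A (fst p))"
    by (rule measurable_component[OF measurable_edges_edge_sets[OF A, of borel], where h = fst]) measurable
  note measurable_root_const[OF A, measurable]
  \<comment> \<open>The component size is written as a sum over vertices, so that
    \<open>measurable_csum\<close> applies to it.\<close>
  define s where "s x = csum (\<lambda>y. if y \<in> component A x then 1 else 0)" for x
  have AE: "component A x \<subseteq> component E x" for x using edge_setsD(1)[OF A] by (rule component_mono)
  have [measurable]: "s \<in> borel_measurable borel"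
    unfolding s_def by (rule measurable_csum[where p = "\<lambda>x. x"]) (measurable, use AE in \<open>auto split: if_splits\<close>)
  have s: "s x = of_nat (card (component A x))" if "finite (component A x)" for x
    using csum_if_const[OF that, of 1] by (simp add: s_def)
  define K where "K x y = (if is_root A y \<and> y \<in> component A x then 1 / s x else 0)" for x y
  have Km: "(\<lambda>p. K (fst p) (snd p)) \<in> borel_measurable (borel \<Otimes>\<^sub>M borel)"
    unfolding K_def by measurable
  have K_out: "csum (\<lambda>y. K x y) = ennreal (1 / real (card (component A x)))" for x
  proof (cases "finite (component A x)")
    case True
    then obtain r where r: "r \<in> component A x" "is_root A r" by (rule root_exists)
    have "K x y = (if y = r then 1 / s x else 0)" for y
    proof -
      have "y = r" if "is_root A y" "y \<in> component A x"
        using root_unique[OF that(1) r(2)] that(2) unfolding component_eq[OF r(1)] .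
      then have "is_root A y \<and> y \<in> component A x \<longleftrightarrow> y = r" using r by metis
      then show ?thesis unfolding K_def by (simp only:)
    qed
    then have "csum (\<lambda>y. K x y) = 1 / s x" by (simp add: csum_if_eq)
    moreover have "card (component A x) \<noteq> 0" using True component_refl[of x A] by (metis card_eq_0_iff empty_iff)
    ultimately show ?thesis
      using s[OF True] by (simp add: divide_ennreal[symmetric] ennreal_of_nat_eq_real_of_nat)
  next
    case False
    then have "K x y = 0" for y
      unfolding K_def is_root_def using component_eq[of y A x] by metis
    then show ?thesis using False by simp
  qed
  have K_in: "csum (\<lambda>y. K y x) = indicator {v. is_root A v} x" for x
  proof (cases "is_root A x")
    case True
    then have fin: "finite (component A x)" by (simp add: is_root_def)
    have "K y x = (if y \<in> component A x then 1 / s x else 0)" for y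
      using True unfolding K_def s_def component_sym[of x A y]
      by (cases "y \<in> component A x") (simp_all add: component_eq)
    then have "csum (\<lambda>y. K y x) = 1 / s x * s x"
      using csum_if_const[OF fin, of "1 / s x"] s[OF fin] by simp
    also have "\<dots> = 1"
    proof -
      have "card (component A x) \<noteq> 0" using fin component_refl[of x A] by (metis card_eq_0_iff empty_iff)
      then show ?thesis unfolding s[OF fin] by (simp add: ennreal_divide_times less_top[symmetric])
    qed
    finally show ?thesis using True by simp
  qed (simp add: K_def)
  have "(\<integral>\<^sup>+ x. ennreal (1 / real (card (component A x))) \<partial>\<mu>) = (\<integral>\<^sup>+ x. csum (\<lambda>y. K x y) \<partial>\<mu>)"
    by (simp add: K_out)
  also have "\<dots> = (\<integral>\<^sup>+ x. csum (\<lambda>y. K y x) \<partial>\<mu>)"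
    by (rule mass_transport[OF Km]) (use AE in \<open>auto simp: K_def split: if_splits\<close>)
  also have "\<dots> = emeasure \<mu> {v. is_root A v}"
    unfolding K_in using root_sets[OF A] by (subst nn_integral_indicator) (auto simp: sets_mu)
  finally have nn: "(\<integral>\<^sup>+ x. ennreal (1 / real (card (component A x))) \<partial>\<mu>) = emeasure \<mu> {v. is_root A v}" .
  \<comment> \<open>Measurability of the reciprocal size is inherited from the outgoing mass, which
    equals it.\<close>
  have "(\<lambda>x. csum (\<lambda>y. K x y)) \<in> borel_measurable borel"
    by (rule measurable_csum[where p = "\<lambda>x. x", OF Km]) (use AE in \<open>auto simp: K_def split: if_splits\<close>)
  then have "(\<lambda>x. enn2real (csum (\<lambda>y. K x y))) \<in> borel_measurable borel" by measurable
  then have [measurable]: "(\<lambda>x. 1 / real (card (component A x))) \<in> borel_measurable borel"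
    by (simp add: K_out)
  have "(\<integral>x. 1 / real (card (component A x)) \<partial>\<mu>) = measure \<mu> {v. is_root A v}"
    by (subst integral_eq_nn_integral) (auto simp: nn measure_def)
  moreover have "measure \<mu> {v. \<not> is_root A v} = 1 - measure \<mu> {v. is_root A v}"
    using prob_compl[of "{v. is_root A v}"] root_sets[OF A] by (simp add: sets_mu Compl_eq_Diff_UNIV[symmetric] Collect_neg_eq)
  ultimately show ?thesis by (simp add: rank_def)
qed

end

section \<open>The edge measure\<close>

context graphing_space
begin

lemma sigma_algebra_edge_sets: "sigma_algebra E (edge_sets E)"
proof (rule sigma_algebra_iff2[THEN iffD2], intro conjI ballI allI impI)
  show "edge_sets E \<subseteq> Pow E" by (auto simp: edge_sets_def)
  show "{} \<in> edge_sets E" by (simp add: edge_sets_def pairs_of_def)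
next
  fix A assume "A \<in> edge_sets E"
  then have [measurable]: "pairs_of A \<in> sets (borel \<Otimes>\<^sub>M borel)" by (rule edge_setsD)
  have "pairs_of (E - A) = pairs_of E - pairs_of A" by (auto simp: pairs_of_def)
  then show "E - A \<in> edge_sets E" by (auto simp: edge_sets_def)
next
  fix A :: "nat \<Rightarrow> 'a uprod set" assume A: "range A \<subseteq> edge_sets E"
  then have [measurable]: "pairs_of (A n) \<in> sets (borel \<Otimes>\<^sub>M borel)" for n by (auto simp: edge_sets_def)
  have "pairs_of (\<Union>n. A n) = (\<Union>n. pairs_of (A n))" by (auto simp: pairs_of_def)
  then show "(\<Union>n. A n) \<in> edge_sets E" using A by (auto simp: edge_sets_def)
qed

abbreviation \<eta> :: "'a uprod measure" where "\<eta> \<equiv> edge_measure \<mu> E"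

lemma sets_edge_measure [simp]: "sets \<eta> = edge_sets E"
  unfolding edge_measure_def by (rule sigma_algebra.sets_measure_of_eq[OF sigma_algebra_edge_sets])

lemma space_edge_measure [simp]: "space \<eta> = E"
  unfolding edge_measure_def by (rule sigma_algebra.space_measure_of_eq[OF sigma_algebra_edge_sets])

lemma sets_edge_space [simp]: "sets (edge_space E) = edge_sets E"
  unfolding edge_space_def by (rule sigma_algebra.sets_measure_of_eq[OF sigma_algebra_edge_sets])

lemma edge_sets_Int [intro]: "A \<in> edge_sets E \<Longrightarrow> B \<in> edge_sets E \<Longrightarrow> A \<inter> B \<in> edge_sets E"
  and edge_sets_Un [intro]: "A \<in> edge_sets E \<Longrightarrow> B \<in> edge_sets E \<Longrightarrow> A \<union> B \<in> edge_sets E"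
  and edge_sets_Diff [intro]: "A \<in> edge_sets E \<Longrightarrow> B \<in> edge_sets E \<Longrightarrow> A - B \<in> edge_sets E"
  using sets.Int[of A \<eta> B] sets.Un[of A \<eta> B] sets.Diff[of A \<eta> B] by simp_all

lemma measurable_mem_edge_sets:
  assumes "A \<in> edge_sets E" "f \<in> borel_measurable N" "g \<in> borel_measurable N"
  shows "Measurable.pred N (\<lambda>z. Upair (f z) (g z) \<in> A)"
  using measurable_edgesD[OF measurable_edges_edge_sets[OF assms(1), of N], of "\<lambda>z. z" N f g] assms by simp

definition degree :: "'a uprod set \<Rightarrow> 'a \<Rightarrow> ennreal" where
  "degree F x = csum (\<lambda>y. if Upair x y \<in> F then 1 else 0)"

lemma degree_eq_deg: "F \<subseteq> E \<Longrightarrow> degree F x = of_nat (deg F x)"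
  using csum_if_const[OF finite_nbrs_subset[of F x], of 1] by (simp add: degree_def deg_def)

lemma degree_measurable: 
  assumes A: "A \<in> edge_sets E" shows "degree A \<in> borel_measurable borel"
proof -
  have [measurable]: "Measurable.pred (borel \<Otimes>\<^sub>M borel) (\<lambda>p. Upair (fst p) (snd p) \<in> A)"
    by (rule measurable_mem_edge_sets[OF A]) measurable
  show ?thesis unfolding degree_def
    by (rule measurable_csum[where p = "\<lambda>x. x"])
      (measurable, use edge_setsD(1)[OF A] in \<open>auto intro!: component_edge split: if_splits\<close>)
qed

text \<open>\<open>measure_of\<close> takes the prescribed values only for a positive and countably
  additive set function. Additivity is checked on \<open>degree\<close>, where a disjoint union
  passes through the vertex sum and then through the integral.\<close>

lemma emeasure_edge_measure:
  assumes "A \<in> edge_sets E"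
  shows "emeasure \<eta> A = ennreal (1/2) * (\<integral>\<^sup>+ x. degree A x \<partial>\<mu>)"
proof -
  let ?m = "\<lambda>F. ennreal (1/2) * (\<integral>\<^sup>+ x. of_nat (deg F x) \<partial>\<mu>)"
  have m: "?m F = ennreal (1/2) * (\<integral>\<^sup>+ x. degree F x \<partial>\<mu>)" if "F \<in> edge_sets E" for F
    using degree_eq_deg[OF edge_setsD(1)[OF that]] by simp
  have "countably_additive (edge_sets E) ?m"
  proof (rule countably_additiveI)
    fix A :: "nat \<Rightarrow> 'a uprod set"
    assume A: "range A \<subseteq> edge_sets E" "disjoint_family A" "(\<Union>i. A i) \<in> edge_sets E"
    have "(if Upair x y \<in> (\<Union>i. A i) then 1 else 0) = (\<Sum>i. if Upair x y \<in> A i then 1 else 0 :: ennreal)" for x y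
      using suminf_indicator[OF A(2), of "Upair x y"] by (simp add: indicator_def of_bool_def)
    then have d: "degree (\<Union>i. A i) x = (\<Sum>i. degree (A i) x)" for x
      unfolding degree_def by (subst nn_integral_suminf[symmetric]) auto
    have "(\<Sum>i. ?m (A i)) = (\<Sum>i. ennreal (1/2) * (\<integral>\<^sup>+ x. degree (A i) x \<partial>\<mu>))"
      using A(1) by (intro suminf_cong m) auto
    also have "\<dots> = ennreal (1/2) * (\<Sum>i. \<integral>\<^sup>+ x. degree (A i) x \<partial>\<mu>)"
      by (rule ennreal_suminf_cmult)
    also have "(\<Sum>i. \<integral>\<^sup>+ x. degree (A i) x \<partial>\<mu>) = (\<integral>\<^sup>+ x. (\<Sum>i. degree (A i) x) \<partial>\<mu>)"
      using degree_measurable A(1) by (intro nn_integral_suminf[symmetric]) (auto simp: measurable_def sets_mu)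
    finally show "(\<Sum>i. ?m (A i)) = ?m (\<Union>i. A i)"
      using m[OF A(3)] by (simp add: d)
  qed
  moreover have "positive (edge_sets E) ?m" by (simp add: positive_def deg_def)
  ultimately have "emeasure \<eta> A = ?m A" unfolding edge_measure_def
    by (intro emeasure_measure_of_sigma sigma_algebra_edge_sets assms)
  then show ?thesis using m[OF assms] by simp
qed

lemma finite_measure_edge_measure: "finite_measure \<eta>"
proof
  obtain D where D: "\<And>x. deg E x \<le> D"
    using graphing unfolding graphing_def by blast
  have E: "E \<in> edge_sets E" by (simp add: edge_sets_def)
  have "(\<integral>\<^sup>+ x. degree E x \<partial>\<mu>) \<le> (\<integral>\<^sup>+ x. of_nat D \<partial>\<mu>)"
    by (rule nn_integral_mono) (simp add: degree_eq_deg D)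
  also have "\<dots> < \<infinity>" by (simp add: emeasure_space_1[simplified] ennreal_of_nat_eq_real_of_nat)
  finally show "emeasure \<eta> (space \<eta>) \<noteq> \<infinity>"
    by (simp add: emeasure_edge_measure[OF E] ennreal_mult_eq_top_iff)
qed

lemma rank_mono:
  assumes "A \<in> edge_sets E" "B \<in> edge_sets E" "A \<subseteq> B"
  shows "rank \<mu> A \<le> rank \<mu> B"
proof -
  have "{v. \<not> is_root B v} \<in> sets \<mu>"
    using root_sets[OF assms(2)] by (auto simp: sets_mu Collect_neg_eq)
  then show ?thesis using root_antimono[OF assms(3)] unfolding rank_eq[OF assms(1)] rank_eq[OF assms(2)]
    by (intro finite_measure_mono) auto
qed

text \<open>Almost every vertex is isolated in an edge set of measure zero, hence is its own root.
  This gives the absolute continuity of the measures in \<open>mm_plus\<close>.\<close>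

lemma rank_null:
  assumes A: "A \<in> edge_sets E" "emeasure \<eta> A = 0"
  shows "rank \<mu> A = 0"
proof -
  have [measurable]: "degree A \<in> borel_measurable \<mu>" using degree_measurable[OF A(1)] by measurable
  have "(\<integral>\<^sup>+ x. degree A x \<partial>\<mu>) = 0" using A by (simp add: emeasure_edge_measure)
  then have "AE x in \<mu>. degree A x = 0" by (simp add: nn_integral_0_iff_AE)
  moreover have "is_root A x" if "degree A x = 0" for x
  proof -
    have "{y. Upair x y \<in> A} = {}"
      using that finite_nbrs_subset[OF edge_setsD(1)[OF A(1)], of x] degree_eq_deg[OF edge_setsD(1)[OF A(1)], of x]
      by (simp add: deg_def)
    then have "component A x \<subseteq> {x}" by (intro component_subsetI) auto
    then show ?thesis by (auto simp: is_root_def intro: finite_subset)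
  qed
  ultimately have "AE x in \<mu>. x \<notin> {v. \<not> is_root A v}" by (auto elim!: AE_mp)
  moreover have "{v. \<not> is_root A v} \<in> sets \<mu>"
    using root_sets[OF A(1)] by (auto simp: sets_mu Collect_neg_eq)
  ultimately show ?thesis unfolding rank_eq[OF A(1)] by (simp add: AE_iff_measurable[OF _ refl] prob_eq_0)
qed

end

section \<open>The wired maximal spanning forest\<close>

lemma component_insert:
  assumes "v \<in> component F x \<union> component F y"
  shows "component (insert (Upair x y) F) v = component F x \<union> component F y"
proof (rule antisym)
  show "component (insert (Upair x y) F) v \<subseteq> component F x \<union> component F y"
  proof (rule component_subsetI[OF assms])
    fix a b assume ab: "a \<in> component F x \<union> component F y" "Upair a b \<in> insert (Upair x y) F"
    show "b \<in> component F x \<union> component F y"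
    proof (cases "Upair a b \<in> F")
      case True
      then show ?thesis using ab(1) component_step[of a F x b] component_step[of a F y b] by blast
    next
      case False
      then have "b = x \<or> b = y" using ab(2) by auto
      then show ?thesis by auto
    qed
  qed
next
  let ?G = "insert (Upair x y) F"
  have xy: "component ?G x = component ?G y"
    unfolding component_eq_iff by (rule component_edge) simp
  have sub: "component F x \<subseteq> component ?G x" "component F y \<subseteq> component ?G y"
    by (intro component_mono; blast)+
  then have "v \<in> component ?G x" using assms xy by blast
  then have "component ?G v = component ?G x" by (rule component_eq)
  then show "component F x \<union> component F y \<subseteq> component ?G v" using sub xy by blast
qed

lemma component_insert_other:
  assumes "v \<notin> component F x \<union> component F y"
  shows "component (insert (Upair x y) F) v = component F v"
proof (rule antisym)
  show "component (insert (Upair x y) F) v \<subseteq> component F v"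
  proof (rule component_subsetI)
    fix a b assume ab: "a \<in> component F v" "Upair a b \<in> insert (Upair x y) F"
    have "v \<in> component F a" using ab(1) by (rule component_sym[THEN iffD1])
    then have "a \<noteq> x" "a \<noteq> y" using assms by auto
    then have "Upair a b \<in> F" using ab(2) by auto
    then show "b \<in> component F v" using ab(1) component_step by metis
  qed simp
qed (rule component_mono, blast)

section \<open>Adding the edges from the highest one downwards\<close>

locale ordered_graphing = graphing_space +
  fixes above :: "'a uprod \<Rightarrow> 'a uprod \<Rightarrow> bool"
  assumes order: "edge_order above"
begin

lemma above_irrefl: "\<not> above e e"
  and above_trans: "above e e' \<Longrightarrow> above e' e'' \<Longrightarrow> above e e''"
  and above_total: "e \<noteq> e' \<Longrightarrow> above e e' \<or> above e' e"
  and above_pred: "Measurable.pred ((borel \<Otimes>\<^sub>M borel) \<Otimes>\<^sub>M (borel \<Otimes>\<^sub>M borel))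
       (\<lambda>q. above (Upair (fst (fst q)) (snd (fst q))) (Upair (fst (snd q)) (snd (snd q))))"
  using order unfolding edge_order_def by blast+

lemma above_measurable [measurable (raw)]:
  assumes [measurable]: "f \<in> borel_measurable N" "g \<in> borel_measurable N" "h \<in> borel_measurable N" "k \<in> borel_measurable N"
  shows "Measurable.pred N (\<lambda>z. above (Upair (f z) (g z)) (Upair (h z) (k z)))"
  using measurable_compose[OF _ above_pred, of "\<lambda>z. ((f z, g z), (h z, k z))" N] by simp

lemma finite_has_above_max:
  assumes "finite S" "S \<noteq> {}"
  shows "\<exists>m\<in>S. \<forall>e\<in>S. \<not> above e m"
  using assms
proof (induction rule: finite_ne_induct)
  case (singleton x)
  then show ?case by (simp add: above_irrefl)
next
  case (insert x S)
  then obtain m where m: "m \<in> S" "\<forall>e\<in>S. \<not> above e m" by blast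
  show ?case
  proof (cases "above x m")
    case True
    have "\<not> above e x" if "e \<in> S" for e using above_trans[OF _ True] m(2) that by blast
    then show ?thesis using above_irrefl by (intro bexI[of _ x]) auto
  next
    case False
    then show ?thesis using m by (intro bexI[of _ m]) auto
  qed
qed

definition up :: "'a uprod \<Rightarrow> 'a uprod set" where
  "up e = {e'\<in>E. above e' e}"

definition upc :: "'a uprod \<Rightarrow> 'a uprod set" where
  "upc e = {e'\<in>E. e' = e \<or> above e' e}"

definition up_closed :: "'a uprod set \<Rightarrow> bool" where
  "up_closed U \<longleftrightarrow> U \<subseteq> E \<and> (\<forall>e\<in>U. upc e \<subseteq> U)"

text \<open>The vertex that stops being a root when the edge is added to all higher ones.\<close>

definition charged :: "'a \<Rightarrow> 'a uprod \<Rightarrow> bool" where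
  "charged v e \<longleftrightarrow> is_root (up e) v \<and> \<not> is_root (upc e) v"

text \<open>Membership is expressed by the loss of a root rather than by components, because the
  lost root is what mass is sent to; \<open>charged_exists\<close> supplies the link to
  components.\<close>

definition forest :: "'a uprod set" where
  "forest = {e\<in>E. \<exists>v. charged v e}"

lemma upc_insert: "e \<in> E \<Longrightarrow> upc e = insert e (up e)"
  by (auto simp: upc_def up_def)

lemma upc_subset_up: "above e e' \<Longrightarrow> upc e \<subseteq> up e'"
  using above_trans unfolding upc_def up_def by blast

lemma up_subset_upc: "up e \<subseteq> upc e"
  by (auto simp: upc_def up_def)

lemma self_in_upc: "e \<in> E \<Longrightarrow> e \<in> upc e"
  by (simp add: upc_def)

lemma up_closedD: "up_closed U \<Longrightarrow> e \<in> U \<Longrightarrow> upc e \<subseteq> U"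
  by (simp add: up_closed_def)

lemma up_closed_above: 
  assumes "up_closed U" "e \<notin> U" "e \<in> E" shows "U \<subseteq> upc e"
proof
  fix d assume d: "d \<in> U"
  then have "d \<in> E" "d \<noteq> e" using assms by (auto simp: up_closed_def)
  moreover have "\<not> above e d" using up_closedD[OF assms(1) d] assms(2,3) by (auto simp: upc_def)
  ultimately show "d \<in> upc e" using above_total by (auto simp: upc_def)
qed

text \<open>The root property is lost for good when edges are added, so the lower of two charging
  edges would meet a vertex that is no longer a root.\<close>

lemma charged_unique_edge:
  assumes "charged v e" "charged v e'"
  shows "e = e'"
proof (rule ccontr)
  assume "e \<noteq> e'"
  then have "above e e' \<or> above e' e" by (rule above_total)
  then show False
    using assms root_antimono[OF upc_subset_up] unfolding charged_def by blast
qed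

lemma charged_component:
  assumes "charged v (Upair x y)" "Upair x y \<in> E"
  shows "v \<in> component (up (Upair x y)) x \<union> component (up (Upair x y)) y"
proof (rule ccontr)
  assume "\<not> ?thesis"
  from component_insert_other[OF this] show False
    using assms unfolding charged_def is_root_def upc_insert[OF assms(2)] by auto
qed

lemma charged_component_E:
  assumes "charged v (Upair x y)" "Upair x y \<in> E"
  shows "v \<in> component E x"
proof -
  have "up (Upair x y) \<subseteq> E" by (auto simp: up_def)
  then have "v \<in> component E x \<union> component E y"
    using charged_component[OF assms] component_mono[of "up (Upair x y)" E x] component_mono[of "up (Upair x y)" E y] by auto
  moreover have "component E y = component E x" using assms(2) by (metis component_edge component_eq)
  ultimately show ?thesis by blast
qed

text \<open>The edge merges at most two components, so two charged vertices would be the roots of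
  its two end components. Both are then finite, and the smaller root remains the root of the union,
  so it is not charged.\<close>

lemma charged_unique_vertex:
  assumes ch: "charged u e" "charged v e" and e: "e \<in> E"
  shows "u = v"
proof (rule ccontr)
  assume ne: "u \<noteq> v"
  obtain x y where xy: "e = Upair x y" by (cases e)
  define C where "C = component (up e) x \<union> component (up e) y"
  have uv: "u \<in> C" "v \<in> C" using charged_component[of _ x y] ch e unfolding C_def xy by blast+
  have roots: "is_root (up e) u" "is_root (up e) v" using ch by (auto simp: charged_def)
  have cl: "component (upc e) w = C" if "w \<in> C" for w
    unfolding upc_insert[OF e] by (rule component_insert[of w "up e" x y, folded xy C_def, OF that])
  have "u \<notin> component (up e) v" using root_unique[OF roots] ne by metis
  then have C: "C = component (up e) u \<union> component (up e) v"
    using uv component_eq[of u "up e" x] component_eq[of u "up e" y] component_eq[of v "up e" x] component_eq[of v "up e" y]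
      component_refl[of u "up e"]
    unfolding C_def by auto
  have fin: "finite C" using roots unfolding C is_root_def by simp
  have below: "w = u \<or> w = v \<or> vless u w \<or> vless v w" if "w \<in> C" for w
    using that roots unfolding C is_root_def by auto
  have "vless u v \<or> vless v u" using ne by (rule vless_total)
  then have "is_root (upc e) u \<or> is_root (upc e) v"
    unfolding is_root_def cl[OF uv(1)] cl[OF uv(2)] using fin below vless_trans by metis
  then show False using ch by (simp add: charged_def)
qed

text \<open>When the component of \<open>y\<close> is infinite, the union has no root and the root
  on the side of \<open>x\<close> is charged; when it is finite, the two distinct old roots cannot
  both be roots of the union.\<close>

lemma charged_exists:
  assumes e: "Upair x y \<in> E" and fin: "finite (component (up (Upair x y)) x)"
    and sep: "y \<notin> component (up (Upair x y)) x"
  shows "\<exists>v. charged v (Upair x y)"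
proof -
  let ?F = "up (Upair x y)" and ?G = "upc (Upair x y)"
  let ?C = "component ?F x \<union> component ?F y"
  have cl: "component ?G w = ?C" if "w \<in> ?C" for w
    unfolding upc_insert[OF e] using that by (rule component_insert)
  obtain r where r: "r \<in> component ?F x" "is_root ?F r" using root_exists[OF fin] by blast
  show ?thesis
  proof (cases "finite (component ?F y)")
    case False
    then have "\<not> is_root ?G r" using cl[of r] r(1) by (simp add: is_root_def)
    then show ?thesis using r(2) unfolding charged_def by blast
  next
    case True
    obtain s where s: "s \<in> component ?F y" "is_root ?F s" using root_exists[OF True] by blast
    have ne: "r \<noteq> s"
    proof
      assume "r = s"
      then have "component ?F x = component ?F y" using r(1) s(1) component_eq by metis
      then show False using sep component_refl by metis
    qed
    have cr: "component ?G r = ?C" "component ?G s = ?C" using cl r(1) s(1) by blast+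
    have "\<not> is_root ?G r \<or> \<not> is_root ?G s"
    proof (rule ccontr)
      assume "\<not> ?thesis"
      then have "r = s" by (intro root_unique[of ?G]) (use cr r(1) in auto)
      then show False using ne by blast
    qed
    then show ?thesis using r(2) s(2) unfolding charged_def by blast
  qed
qed

lemma measurable_edges_up:
  assumes [measurable]: "f \<in> borel_measurable M" "g \<in> borel_measurable M"
  shows "measurable_edges M (\<lambda>z. up (Upair (f z) (g z)))" "measurable_edges M (\<lambda>z. upc (Upair (f z) (g z)))"
proof -
  let ?N = "M \<Otimes>\<^sub>M (borel \<Otimes>\<^sub>M borel)"
  have [measurable]: "Measurable.pred ?N (\<lambda>p. above (Upair (fst (snd p)) (snd (snd p))) (Upair (f (fst p)) (g (fst p))))"
    by (rule above_measurable) measurable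
  have "Measurable.pred ?N (\<lambda>p. edge (fst (snd p)) (snd (snd p)) \<and> above (Upair (fst (snd p)) (snd (snd p))) (Upair (f (fst p)) (g (fst p))))"
    by measurable
  then show "measurable_edges M (\<lambda>z. up (Upair (f z) (g z)))"
    unfolding measurable_edges_def up_def mem_Collect_eq edge_def by auto
  have "Measurable.pred ?N (\<lambda>p. edge (fst (snd p)) (snd (snd p)) \<and>
      ((fst (snd p) = f (fst p) \<and> snd (snd p) = g (fst p) \<or> fst (snd p) = g (fst p) \<and> snd (snd p) = f (fst p)) \<or>
       above (Upair (fst (snd p)) (snd (snd p))) (Upair (f (fst p)) (g (fst p)))))"
    by measurable
  then show "measurable_edges M (\<lambda>z. upc (Upair (f z) (g z)))"
    unfolding measurable_edges_def upc_def mem_Collect_eq edge_def Upair_inject by auto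
qed

lemma measurable_is_root_upc:
  assumes [measurable]: "f \<in> borel_measurable N" "g \<in> borel_measurable N" "v \<in> borel_measurable N"
  shows "Measurable.pred N (\<lambda>z. is_root (upc (Upair (f z) (g z))) (v z))"
  using measurable_root[OF measurable_edges_up(2)[of f N g], of "\<lambda>z. z" N v] by simp

lemma measurable_charged [measurable (raw)]:
  assumes [measurable]: "f \<in> borel_measurable N" "g \<in> borel_measurable N" "v \<in> borel_measurable N"
  shows "Measurable.pred N (\<lambda>z. charged (v z) (Upair (f z) (g z)))"
proof -
  have [measurable]: "Measurable.pred N (\<lambda>z. is_root (up (Upair (f z) (g z))) (v z))"
    using measurable_root[OF measurable_edges_up(1)[of f N g], of "\<lambda>z. z" N v] by simp
  have [measurable]: "Measurable.pred N (\<lambda>z. is_root (upc (Upair (f z) (g z))) (v z))"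
    by (rule measurable_is_root_upc) measurable
  show ?thesis unfolding charged_def by measurable
qed

text \<open>A charged vertex lies in the component of the ends of its edge, so its existence is a
  countable disjunction along \<open>\<psi>\<close>.\<close>

lemma forest_edge_sets: "forest \<in> edge_sets E"
proof -
  have "Upair x y \<in> forest \<longleftrightarrow> edge x y \<and> (\<exists>n. charged (\<psi> n x) (Upair x y))" for x y
  proof -
    have "\<exists>n. v = \<psi> n x" if "charged v (Upair x y)" "Upair x y \<in> E" for v
      using charged_component_E[OF that] unfolding component_psi by auto
    then show ?thesis unfolding forest_def edge_def by auto
  qed
  then have "pairs_of forest = {p. edge (fst p) (snd p) \<and> (\<exists>n. charged (\<psi> n (fst p)) (Upair (fst p) (snd p)))}"
    by (auto simp: pairs_of_def)
  also have "\<dots> \<in> sets (borel \<Otimes>\<^sub>M borel)"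
  proof -
    have "Measurable.pred (borel \<Otimes>\<^sub>M borel) (\<lambda>p. edge (fst p) (snd p) \<and> (\<exists>n. charged (\<psi> n (fst p)) (Upair (fst p) (snd p))))"
      by measurable
    then show ?thesis by (simp add: pred_def space_pair_measure)
  qed
  finally show ?thesis by (auto simp: edge_sets_def forest_def)
qed

lemma charged_set_measurable:
  assumes U: "U \<in> edge_sets E"
  shows "{v. \<exists>e\<in>U. charged v e} \<in> sets borel"
proof -
  have [measurable]: "Measurable.pred borel (\<lambda>v. Upair (\<psi> n v) (\<psi> m v) \<in> U)" for n m
    by (rule measurable_mem_edge_sets[OF U]) measurable
  have "(\<exists>e\<in>U. charged v e) \<longleftrightarrow> (\<exists>n m. Upair (\<psi> n v) (\<psi> m v) \<in> U \<and> charged v (Upair (\<psi> n v) (\<psi> m v)))" for v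
  proof
    assume "\<exists>e\<in>U. charged v e"
    then obtain x y where xy: "Upair x y \<in> U" "charged v (Upair x y)" by (metis uprod_exhaust)
    then have xyE: "Upair x y \<in> E" using edge_setsD(1)[OF U] by blast
    have "x \<in> component E v" using charged_component_E[OF xy(2) xyE] by (rule component_sym[THEN iffD1])
    moreover from this have "y \<in> component E v" using xyE component_step by metis
    ultimately show "\<exists>n m. Upair (\<psi> n v) (\<psi> m v) \<in> U \<and> charged v (Upair (\<psi> n v) (\<psi> m v))"
      using xy component_psi[of v] by auto
  qed blast
  then show ?thesis by simp
qed

text \<open>Each end of a forest edge in \<open>U\<close> sends mass 1 to the vertex charged by that
  edge. The mass sent is the degree in the forest part; a charged vertex receives 2, one unit from
  each end of its only edge, which cancels the factor 1/2 of the edge measure.\<close>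

lemma emeasure_forest:
  assumes U: "U \<in> edge_sets E"
  shows "emeasure \<eta> (forest \<inter> U) = emeasure \<mu> {v. \<exists>e\<in>U. charged v e}"
proof -
  have UE: "U \<subseteq> E" using U by (rule edge_setsD)
  define k where "k x y v = (if Upair x y \<in> U \<and> charged v (Upair x y) then 1 else 0 :: ennreal)" for x y v
  define K where "K x v = csum (\<lambda>y. k x y v)" for x v
  have [measurable]: "Measurable.pred ((borel \<Otimes>\<^sub>M borel) \<Otimes>\<^sub>M borel) (\<lambda>p. Upair (fst (fst p)) (snd p) \<in> U)"
    by (rule measurable_mem_edge_sets[OF U]) measurable
  have Km: "(\<lambda>p. K (fst p) (snd p)) \<in> borel_measurable (borel \<Otimes>\<^sub>M borel)"
    unfolding K_def k_def
    by (rule measurable_csum[where p = fst]) (measurable, use UE in \<open>auto intro!: component_edge split: if_splits\<close>)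
  have supp: "v \<in> component E x" if "K x v \<noteq> 0" for x v
  proof (rule ccontr)
    assume "v \<notin> component E x"
    then have "k x y v = 0" for y using charged_component_E[of v x y] UE by (auto simp: k_def)
    then show False using that by (simp add: K_def)
  qed
  have out: "csum (\<lambda>v. K x v) = degree (forest \<inter> U) x" for x
  proof -
    have k: "csum (\<lambda>v. k x y v) = (if Upair x y \<in> forest \<inter> U then 1 else 0)" for y
    proof (cases "Upair x y \<in> forest \<inter> U")
      case True
      then obtain v where v: "charged v (Upair x y)" by (auto simp: forest_def)
      have "charged u (Upair x y) \<longleftrightarrow> u = v" for u
        using charged_unique_vertex[OF _ v] v True UE by blast
      then have "k x y u = (if u = v then 1 else 0)" for u using True by (simp add: k_def)
      then show ?thesis using True by (simp add: csum_if_eq)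
    next
      case False
      then have "k x y u = 0" for u using UE by (auto simp: k_def forest_def)
      then show ?thesis using False by simp
    qed
    have "csum (\<lambda>v. K x v) = csum (\<lambda>y. csum (\<lambda>v. k x y v))"
      unfolding K_def by (rule csum_swap)
    then show ?thesis by (simp only: k degree_def)
  qed
  have inn: "csum (\<lambda>x. K x v) = 2 * indicator {v. \<exists>e\<in>U. charged v e} v" for v
  proof (cases "\<exists>e\<in>U. charged v e")
    case True
    then obtain a b where ab: "Upair a b \<in> U" "charged v (Upair a b)" by (metis uprod_exhaust)
    have "a \<noteq> b" using ab(1) UE no_loop by auto
    have "charged v (Upair x y) \<Longrightarrow> Upair x y = Upair a b" for x y using charged_unique_edge ab(2) by blast
    then have k: "k x y v = (if x = a \<and> y = b \<or> x = b \<and> y = a then 1 else 0)" for x y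
      unfolding k_def using ab Upair_commute[of a b] Upair_inject[of x y a b] by metis
    have "K x v = (if x = a then 1 else 0) + (if x = b then 1 else 0)" for x
    proof -
      have "K x v = csum (\<lambda>y. (if y = b then (if x = a then 1 else 0) else 0) + (if y = a then (if x = b then 1 else 0) else 0))"
        unfolding K_def k using \<open>a \<noteq> b\<close> by (intro nn_integral_cong) auto
      also have "\<dots> = (if x = a then 1 else 0) + (if x = b then 1 else 0)"
        by (subst nn_integral_add) (simp_all only: csum_if_eq measurable_count_space_eq1 borel_measurable_count_space, auto)
      finally show ?thesis .
    qed
    then have "csum (\<lambda>x. K x v) = csum (\<lambda>x. if x = a then 1 else 0) + csum (\<lambda>x. if x = b then 1 else 0)"
      by (simp add: nn_integral_add)
    also have "\<dots> = 2" by (simp add: csum_if_eq)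
    finally show ?thesis using True by simp
  next
    case False
    then have "k x y v = 0" for x y by (auto simp: k_def)
    then have "K x v = 0" for x by (simp add: K_def)
    then show ?thesis using False by simp
  qed
  have "emeasure \<eta> (forest \<inter> U) = ennreal (1/2) * (\<integral>\<^sup>+ x. degree (forest \<inter> U) x \<partial>\<mu>)"
    by (intro emeasure_edge_measure edge_sets_Int forest_edge_sets U)
  also have "(\<integral>\<^sup>+ x. degree (forest \<inter> U) x \<partial>\<mu>) = (\<integral>\<^sup>+ x. csum (\<lambda>v. K x v) \<partial>\<mu>)" by (simp add: out)
  also have "\<dots> = (\<integral>\<^sup>+ v. csum (\<lambda>x. K x v) \<partial>\<mu>)" by (rule mass_transport[OF Km supp])
  also have "\<dots> = 2 * emeasure \<mu> {v. \<exists>e\<in>U. charged v e}"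
    unfolding inn using charged_set_measurable[OF U] by (subst nn_integral_cmult_indicator) (auto simp: sets_mu)
  also have "ennreal (1/2) * (2 * emeasure \<mu> {v. \<exists>e\<in>U. charged v e}) = emeasure \<mu> {v. \<exists>e\<in>U. charged v e}"
  proof -
    have "ennreal (1/2) * 2 = ennreal (1/2 * 2)" by (subst ennreal_mult) auto
    then show ?thesis by (simp add: mult.assoc[symmetric])
  qed
  finally show ?thesis .
qed

text \<open>A path uses finitely many edges, and all of them belong to \<open>upc e\<close> for the
  lowest one \<open>e\<close>.\<close>

lemma component_up_closed:
  assumes R: "up_closed R" and u: "u \<in> component R v"
  shows "u = v \<or> (\<exists>e\<in>R. u \<in> component (upc e) v)"
proof -
  have "(v, u) \<in> (pairs_of R)\<^sup>*" using u by (simp add: component_def)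
  then show ?thesis
  proof induction
    case (step y z)
    define d where "d = Upair y z"
    have d: "d \<in> R" "d \<in> E" using step(2) R by (auto simp: pairs_of_def d_def up_closed_def)
    show ?case
    proof (cases "y = v")
      case True
      have "Upair v z \<in> upc d" using self_in_upc[OF d(2)] True by (simp add: d_def)
      then show ?thesis using d(1) component_edge by metis
    next
      case False
      then obtain e where e: "e \<in> R" "y \<in> component (upc e) v" using step.IH by blast
      have "\<exists>m\<in>R. upc e \<subseteq> upc m \<and> d \<in> upc m"
      proof (cases "d \<in> upc e")
        case False
        then have "above e d" using above_total[of e d] d(2) by (auto simp: upc_def)
        then have "upc e \<subseteq> upc d" using upc_subset_up up_subset_upc by blast
        then show ?thesis using d self_in_upc by blast
      qed (use e in blast)
      then obtain m where m: "m \<in> R" "upc e \<subseteq> upc m" "d \<in> upc m" by blast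
      have "y \<in> component (upc m) v" using e(2) component_mono[OF m(2)] by blast
      then have "z \<in> component (upc m) v" using m(3) unfolding d_def by (rule component_step)
      then show ?thesis using m(1) by blast
    qed
  qed simp
qed

lemma finite_incident:
  assumes "finite C"
  shows "finite {e\<in>E. \<exists>a\<in>C. \<exists>b. e = Upair a b}"
proof -
  have "{e\<in>E. \<exists>a\<in>C. \<exists>b. e = Upair a b} = (\<Union>a\<in>C. Upair a ` {b. Upair a b \<in> E})" by auto
  then show ?thesis using assms finite_nbrs by simp
qed

text \<open>A vertex may stop being a root only in the limit, without being charged by any edge. Such a vertex
  is the least one of an infinite cluster, and these clusters are disjoint; transporting mass from it to
  its whole cluster shows that this happens with measure zero.\<close>

definition root_edges :: "'a uprod set \<Rightarrow> 'a \<Rightarrow> 'a uprod set" where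
  "root_edges U v = {e\<in>U. is_root (upc e) v}"

definition unsettled :: "'a uprod set \<Rightarrow> 'a \<Rightarrow> bool" where
  "unsettled U v \<longleftrightarrow> \<not> is_root U v \<and> \<not> (\<exists>e\<in>U. charged v e)"

lemma upc_mono: "d \<in> upc e \<Longrightarrow> upc d \<subseteq> upc e"
  using above_trans by (auto simp: upc_def)

lemma up_closed_root_edges:
  assumes "up_closed U" shows "up_closed (root_edges U v)"
  unfolding up_closed_def
proof (intro conjI ballI subsetI)
  show "e \<in> E" if "e \<in> root_edges U v" for e
    using that assms by (auto simp: root_edges_def up_closed_def)
  fix e d assume e: "e \<in> root_edges U v" and d: "d \<in> upc e"
  have "d \<in> U" using e d up_closedD[OF assms] by (auto simp: root_edges_def)
  moreover have "is_root (upc d) v"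
    using e root_antimono[OF upc_mono[OF d]] by (simp add: root_edges_def)
  ultimately show "d \<in> root_edges U v" by (simp add: root_edges_def)
qed

text \<open>By \<open>component_up_closed\<close>, every other vertex of the cluster is reached at a
  stage at which \<open>v\<close> is still the root.\<close>

lemma root_edges_least:
  assumes U: "up_closed U" and u: "u \<in> component (root_edges U v) v"
  shows "u = v \<or> vless v u"
  using component_up_closed[OF up_closed_root_edges[OF U] u] by (auto simp: root_edges_def is_root_def)

text \<open>If the cluster \<open>C\<close> were finite, \<open>U\<close> would have to leave it, as
  otherwise \<open>v\<close> would be a root of \<open>U\<close>. By local finiteness the edges of
  \<open>U\<close> outside \<open>R\<close> that touch \<open>C\<close> have a highest element
  \<open>e\<close>. Above \<open>e\<close> the component of \<open>v\<close> stays in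
  \<open>C\<close>, so \<open>v\<close> is a root of \<open>up e\<close>; not being charged, it is a
  root of \<open>upc e\<close> too, which puts \<open>e\<close> into \<open>R\<close>.\<close>

lemma unsettled_infinite:
  assumes U: "up_closed U" and v: "unsettled U v"
  shows "infinite (component (root_edges U v) v)"
proof
  define R where "R = root_edges U v"
  define C where "C = component R v"
  assume "finite (component (root_edges U v) v)"
  then have fin: "finite C" by (simp add: C_def R_def)
  have least: "u = v \<or> vless v u" if "u \<in> C" for u using root_edges_least[OF U] that by (simp add: C_def R_def)
  have sub_root: "is_root F v" if "component F v \<subseteq> C" for F
    using that least fin finite_subset unfolding is_root_def by blast
  have "\<not> component U v \<subseteq> C" using sub_root v by (auto simp: unsettled_def)
  then obtain a b where ab: "a \<in> C" "Upair a b \<in> U" "b \<notin> C"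
    using component_subsetI[of v C U] component_refl[of v R] unfolding C_def by metis
  define B where "B = {e\<in>U. e \<notin> R \<and> (\<exists>a\<in>C. \<exists>b. e = Upair a b)}"
  have "Upair a b \<notin> R" using ab component_step[of a R v b] unfolding C_def by blast
  then have "Upair a b \<in> B" using ab by (auto simp: B_def)
  moreover have "finite B"
    by (rule finite_subset[OF _ finite_incident[OF fin]]) (use U in \<open>auto simp: B_def up_closed_def\<close>)
  ultimately obtain e where e: "e \<in> B" "\<forall>d\<in>B. \<not> above d e" using finite_has_above_max by blast
  have eU: "e \<in> U" "e \<notin> R" using e(1) by (auto simp: B_def)
  have "component (up e) v \<subseteq> C"
  proof (rule component_subsetI)
    show "v \<in> C" by (simp add: C_def)
    fix x y assume xy: "x \<in> C" "Upair x y \<in> up e"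
    have "Upair x y \<in> U" using xy(2) up_subset_upc up_closedD[OF U eU(1)] by blast
    moreover have "Upair x y \<notin> B" using e(2) xy(2) by (auto simp: up_def)
    ultimately have "Upair x y \<in> R" using xy(1) by (auto simp: B_def)
    then show "y \<in> C" using xy(1) component_step unfolding C_def by metis
  qed
  then have "is_root (up e) v" by (rule sub_root)
  then have "is_root (upc e) v" using v eU(1) by (auto simp: unsettled_def charged_def)
  then show False using eU by (simp add: R_def root_edges_def)
qed

text \<open>Since the clusters meet, \<open>u\<close> lies in that of \<open>v\<close>, and a single
  stage \<open>e\<close> already connects the two. If \<open>e\<close> is in the smaller set of root
  edges, each of \<open>u\<close> and \<open>v\<close> would be less than the other; if not,
  \<open>upc e\<close> contains that whole set, and the infinite cluster of \<open>u\<close> would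
  lie in the finite component of \<open>v\<close> at stage \<open>e\<close>.\<close>

lemma unsettled_unique_aux:
  assumes U: "up_closed U" and u: "unsettled U u" and sub: "root_edges U u \<subseteq> root_edges U v"
    and x: "x \<in> component (root_edges U u) u" "x \<in> component (root_edges U v) v"
  shows "u = v"
proof -
  define R S where "R = root_edges U u" and "S = root_edges U v"
  have R: "up_closed R" and S: "up_closed S" using up_closed_root_edges[OF U] by (auto simp: R_def S_def)
  have "x \<in> component S u" using x(1) component_mono[OF sub] by (auto simp: R_def S_def)
  then have uS: "u \<in> component S v"
    using x(2) unfolding S_def by (metis component_eq component_refl)
  show ?thesis
  proof (rule ccontr)
    assume ne: "u \<noteq> v"
    then obtain e where e: "e \<in> S" "u \<in> component (upc e) v" using component_up_closed[OF S uS] by blast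
    have eE: "e \<in> E" using e(1) S by (auto simp: up_closed_def)
    have eq: "component (upc e) u = component (upc e) v" using e(2) by (rule component_eq)
    show False
    proof (cases "e \<in> R")
      case True
      have "v \<in> component (upc e) u" by (simp add: eq)
      then have "v \<in> component R u" using component_mono[OF up_closedD[OF R True]] by blast
      then have "vless u v" using root_edges_least[OF U] ne by (auto simp: R_def)
      moreover have "vless v u" using root_edges_least[OF U] uS ne by (auto simp: S_def)
      ultimately show False using vless_asym by blast
    next
      case False
      have "component R u \<subseteq> component (upc e) v"
        using component_mono[OF up_closed_above[OF R False eE], of u] eq by simp
      moreover have "finite (component (upc e) v)" using e(1) by (simp add: S_def root_edges_def is_root_def)
      ultimately have "finite (component R u)" by (rule finite_subset)
      then show False using unsettled_infinite[OF U u] by (simp add: R_def)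
    qed
  qed
qed

lemma up_closed_linear:
  assumes "up_closed R" "up_closed S" shows "R \<subseteq> S \<or> S \<subseteq> R"
proof (rule ccontr)
  assume "\<not> ?thesis"
  then obtain d where d: "d \<in> R" "d \<notin> S" and "\<not> S \<subseteq> R" by blast
  have "S \<subseteq> upc d" using up_closed_above[OF assms(2) d(2)] d(1) assms(1) by (auto simp: up_closed_def)
  also have "\<dots> \<subseteq> R" using up_closedD[OF assms(1) d(1)] .
  finally show False using \<open>\<not> S \<subseteq> R\<close> by blast
qed

lemma unsettled_unique:
  assumes U: "up_closed U" and "unsettled U u" "unsettled U v"
    and "x \<in> component (root_edges U u) u" "x \<in> component (root_edges U v) v"
  shows "u = v"
  using up_closed_linear[OF up_closed_root_edges[OF U, of u] up_closed_root_edges[OF U, of v]]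
    unsettled_unique_aux[OF U assms(2) _ assms(4,5)] unsettled_unique_aux[OF U assms(3) _ assms(5,4)] by auto

lemma AE_settled:
  assumes U: "up_closed U" "U \<in> edge_sets E"
  shows "AE v in \<mu>. \<not> unsettled U v"
proof -
  have G: "measurable_edges borel (root_edges U)"
  proof -
    have [measurable]: "Measurable.pred (borel \<Otimes>\<^sub>M (borel \<Otimes>\<^sub>M borel)) (\<lambda>p. Upair (fst (snd p)) (snd (snd p)) \<in> U)"
      by (rule measurable_mem_edge_sets[OF U(2)]) measurable
    have [measurable]: "Measurable.pred (borel \<Otimes>\<^sub>M (borel \<Otimes>\<^sub>M borel)) (\<lambda>p. is_root (upc (Upair (fst (snd p)) (snd (snd p)))) (fst p))"
      by (rule measurable_is_root_upc) measurable
    have "Measurable.pred (borel \<Otimes>\<^sub>M (borel \<Otimes>\<^sub>M borel))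
       (\<lambda>p. Upair (fst (snd p)) (snd (snd p)) \<in> U \<and> is_root (upc (Upair (fst (snd p)) (snd (snd p)))) (fst p))"
      by measurable
    then show ?thesis using U(1) unfolding measurable_edges_def root_edges_def up_closed_def by auto
  qed
  have [measurable]: "Measurable.pred borel (unsettled U)"
  proof -
    have "{v. \<exists>e\<in>U. charged v e} \<in> sets borel" by (rule charged_set_measurable[OF U(2)])
    then have [measurable]: "Measurable.pred borel (\<lambda>v. \<exists>e\<in>U. charged v e)" by (simp add: pred_def)
    note measurable_root_const[OF U(2), measurable]
    show ?thesis unfolding unsettled_def by measurable
  qed
  have [measurable]: "Measurable.pred (borel \<Otimes>\<^sub>M borel) (\<lambda>p. snd p \<in> component (root_edges U (fst p)) (fst p))"
    by (rule measurable_component[OF G]) measurable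
  define K :: "'a \<Rightarrow> 'a \<Rightarrow> ennreal" where
    "K v x = (if unsettled U v \<and> x \<in> component (root_edges U v) v then 1 else 0)" for v x
  have Km: "(\<lambda>p. K (fst p) (snd p)) \<in> borel_measurable (borel \<Otimes>\<^sub>M borel)"
    unfolding K_def by measurable
  have sub: "component (root_edges U v) v \<subseteq> component E v" for v
    using U(1) by (intro component_mono) (auto simp: root_edges_def up_closed_def)
  \<comment> \<open>The mass sent is infinite because the cluster is; the mass received is at most 1
    because the clusters are disjoint.\<close>
  have "csum (\<lambda>x. K v x) = \<infinity> * indicator {v. unsettled U v} v" for v
  proof (cases "unsettled U v")
    case True
    then have "(\<lambda>x. K v x) = indicator (component (root_edges U v) v)" by (auto simp: K_def indicator_def)
    then show ?thesis using True unsettled_infinite[OF U(1) True] by (simp add: emeasure_count_space_infinite)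
  qed (simp add: K_def)
  then have "(\<integral>\<^sup>+ v. csum (\<lambda>x. K v x) \<partial>\<mu>) = \<infinity> * emeasure \<mu> {v. unsettled U v}"
    by (simp add: nn_integral_cmult_indicator)
  moreover have "(\<integral>\<^sup>+ v. csum (\<lambda>x. K v x) \<partial>\<mu>) = (\<integral>\<^sup>+ x. csum (\<lambda>v. K v x) \<partial>\<mu>)"
    by (rule mass_transport[OF Km]) (use sub in \<open>auto simp: K_def split: if_splits\<close>)
  moreover have "(\<integral>\<^sup>+ x. csum (\<lambda>v. K v x) \<partial>\<mu>) \<le> (\<integral>\<^sup>+ x. 1 \<partial>\<mu>)"
  proof (rule nn_integral_mono)
    fix x
    show "csum (\<lambda>v. K v x) \<le> 1"
    proof (cases "\<exists>v. K v x \<noteq> 0")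
      case True
      then obtain v where v: "unsettled U v" "x \<in> component (root_edges U v) v" by (auto simp: K_def split: if_splits)
      have "csum (\<lambda>u. K u x) \<le> csum (\<lambda>u. if u = v then 1 else 0)"
      proof (rule nn_integral_mono)
        fix u
        have "u = v" if "unsettled U u" "x \<in> component (root_edges U u) u"
          by (rule unsettled_unique[OF U(1) that(1) v(1) that(2) v(2)])
        then show "K u x \<le> (if u = v then 1 else 0)" unfolding K_def by (cases "u = v") auto
      qed
      then show ?thesis by (simp add: csum_if_eq)
    qed simp
  qed
  ultimately have "\<infinity> * emeasure \<mu> {v. unsettled U v} \<le> 1"
    by (simp add: emeasure_space_1[simplified])
  then have "emeasure \<mu> {v. unsettled U v} = 0"
    by (cases "emeasure \<mu> {v. unsettled U v} = 0") (auto simp: ennreal_top_mult top_unique)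
  then show ?thesis by (subst AE_iff_measurable[OF _ refl]) auto
qed

text \<open>Charged vertices are non-roots because the root property never returns; the converse
  holds outside the null set of unsettled vertices.\<close>

lemma emeasure_forest_up_closed:
  assumes U: "up_closed U" "U \<in> edge_sets E"
  shows "emeasure \<eta> (forest \<inter> U) = ennreal (rank \<mu> U)"
proof -
  have "emeasure \<mu> {v. \<exists>e\<in>U. charged v e} = emeasure \<mu> {v. \<not> is_root U v}"
  proof (rule emeasure_eq_AE)
    show "AE v in \<mu>. v \<in> {v. \<exists>e\<in>U. charged v e} \<longleftrightarrow> v \<in> {v. \<not> is_root U v}"
      using AE_settled[OF U]
    proof eventually_elim
      case (elim v)
      have "\<not> is_root U v" if "e \<in> U" "charged v e" for e
        using root_antimono[OF up_closedD[OF U(1) that(1)]] that(2) by (auto simp: charged_def)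
      then show ?case using elim by (auto simp: unsettled_def)
    qed
    show "{v. \<exists>e\<in>U. charged v e} \<in> sets \<mu>" using charged_set_measurable[OF U(2)] by (simp add: sets_mu)
    show "{v. \<not> is_root U v} \<in> sets \<mu>" using root_sets[OF U(2)] by (auto simp: sets_mu Collect_neg_eq)
  qed
  then show ?thesis by (simp add: emeasure_forest[OF U(2)] rank_eq[OF U(2)] emeasure_eq_measure)
qed

text \<open>If \<open>U\<close> left the finite forest component \<open>S\<close> of
  \<open>v\<close>, the highest of the finitely many edges of \<open>U\<close> that cross the
  boundary of \<open>S\<close> would join a component contained in \<open>S\<close>, hence finite,
  to a vertex outside. It would then be a forest edge, and its outer end would belong to
  \<open>S\<close>.\<close>

lemma is_root_forest:
  assumes U: "up_closed U"
  shows "is_root (forest \<inter> U) v \<longleftrightarrow> is_root U v"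
proof
  assume r: "is_root (forest \<inter> U) v"
  define S where "S = component (forest \<inter> U) v"
  have fin: "finite S" using r by (simp add: S_def is_root_def)
  have "component U v \<subseteq> S"
  proof (rule ccontr)
    assume "\<not> component U v \<subseteq> S"
    then obtain a b where ab: "a \<in> S" "Upair a b \<in> U" "b \<notin> S"
      using component_subsetI[of v S U] component_refl[of v "forest \<inter> U"] unfolding S_def by metis
    define B where "B = {e\<in>U. \<exists>a\<in>S. \<exists>b. b \<notin> S \<and> e = Upair a b}"
    have "Upair a b \<in> B" using ab unfolding B_def by blast
    moreover have "finite B"
      by (rule finite_subset[OF _ finite_incident[OF fin]]) (use U in \<open>auto simp: B_def up_closed_def\<close>)
    ultimately obtain e where e: "e \<in> B" "\<forall>d\<in>B. \<not> above d e" using finite_has_above_max by blast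
    then obtain c d where cd: "e = Upair c d" "c \<in> S" "d \<notin> S" and eU: "e \<in> U" by (auto simp: B_def)
    have sub: "component (up e) c \<subseteq> S"
    proof (rule component_subsetI[OF cd(2)], rule ccontr)
      fix x y assume xy: "x \<in> S" "Upair x y \<in> up e" "y \<notin> S"
      have "Upair x y \<in> U" using xy(2) up_subset_upc up_closedD[OF U eU] by blast
      then have "Upair x y \<in> B" using xy unfolding B_def by blast
      then show False using e(2) xy(2) by (auto simp: up_def)
    qed
    have "\<exists>v. charged v (Upair c d)"
    proof (rule charged_exists)
      show "Upair c d \<in> E" using eU U cd(1) by (auto simp: up_closed_def)
      show "finite (component (up (Upair c d)) c)" using sub fin finite_subset cd(1) by blast
      show "d \<notin> component (up (Upair c d)) c" using sub cd by blast
    qed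
    then have "Upair c d \<in> forest \<inter> U" using eU U cd(1) by (auto simp: forest_def up_closed_def)
    then have "d \<in> S" using cd(2) component_step unfolding S_def by metis
    then show False using cd(3) by blast
  qed
  then show "is_root U v" using r finite_subset unfolding is_root_def S_def by blast
qed (rule root_antimono[of "forest \<inter> U" U], blast)

lemma rank_forest:
  assumes "up_closed U" "U \<in> edge_sets E"
  shows "rank \<mu> (forest \<inter> U) = rank \<mu> U"
  unfolding rank_eq[OF assms(2)] rank_eq[OF edge_sets_Int[OF forest_edge_sets assms(2)]] is_root_forest[OF assms(1)] ..

end

section \<open>Rank inequalities obtained from the forest\<close>

lemma (in graphing_space) ordered_graphing_by_weight:
  assumes "(\<lambda>p. w (Upair (fst p) (snd p))) \<in> borel_measurable (borel \<Otimes>\<^sub>M borel)"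
  obtains above where "ordered_graphing \<mu> E above" "\<And>e e'. above e e' \<Longrightarrow> w e' \<le> (w e :: real)"
proof -
  obtain above where "edge_order above" "\<forall>e e'. above e e' \<longrightarrow> w e' \<le> w e"
    using edge_order_by_weight[OF assms] by blast
  then show ?thesis using that[of above] graphing_space_axioms
    by (auto simp: ordered_graphing_def ordered_graphing_axioms_def)
qed

text \<open>In a suitable order both \<open>A\<close> and \<open>A \<union> B\<close> are upward
  closed, so their ranks are the edge measures of two parts of one forest, whose difference lies in
  \<open>B\<close>.\<close>

lemma (in graphing_space) rank_Un_le:
  assumes A: "A \<in> edge_sets E" and B: "B \<in> edge_sets E"
  shows "rank \<mu> (A \<union> B) \<le> rank \<mu> A + measure \<eta> B"
proof -
  \<comment> \<open>Only the order of the values 2, 1, 0 matters: \<open>A\<close> comes first, then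
    the rest of \<open>B\<close>, then everything else.\<close>
  define w :: "'a uprod \<Rightarrow> real" where "w e = (if e \<in> A then 2 else if e \<in> B then 1 else 0)" for e
  have [measurable]: "Measurable.pred (borel \<Otimes>\<^sub>M borel) (\<lambda>p. Upair (fst p) (snd p) \<in> A)"
    "Measurable.pred (borel \<Otimes>\<^sub>M borel) (\<lambda>p. Upair (fst p) (snd p) \<in> B)"
    by (rule measurable_mem_edge_sets[OF A] measurable_mem_edge_sets[OF B]; measurable)+
  have "(\<lambda>p. w (Upair (fst p) (snd p))) \<in> borel_measurable (borel \<Otimes>\<^sub>M borel)"
    unfolding w_def by measurable
  then obtain above where o: "ordered_graphing \<mu> E above" and w: "\<And>e e'. above e e' \<Longrightarrow> w e' \<le> w e"
    using ordered_graphing_by_weight[of w] by metis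
  interpret ordered_graphing \<mu> E above by (rule o)
  have upA: "up_closed A" and upAB: "up_closed (A \<union> B)"
    using edge_setsD(1)[OF A] edge_setsD(1)[OF B] w
    unfolding up_closed_def upc_def w_def by (force split: if_splits)+
  interpret \<eta>: finite_measure \<eta> by (rule finite_measure_edge_measure)
  have AB: "A \<union> B \<in> edge_sets E" using A B by blast
  have rank_nn: "0 \<le> rank \<mu> F" if "F \<in> edge_sets E" for F by (simp add: rank_eq[OF that])
  have 1: "measure \<eta> (forest \<inter> (A \<union> B)) = rank \<mu> (A \<union> B)" "measure \<eta> (forest \<inter> A) = rank \<mu> A"
    using emeasure_forest_up_closed[OF upAB AB] emeasure_forest_up_closed[OF upA A] rank_nn[OF A] rank_nn[OF AB]
    by (simp_all add: measure_def)
  have "forest \<inter> (A \<union> B) \<subseteq> (forest \<inter> A) \<union> B" by blast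
  then have "measure \<eta> (forest \<inter> (A \<union> B)) \<le> measure \<eta> ((forest \<inter> A) \<union> B)"
    using A B forest_edge_sets by (intro \<eta>.finite_measure_mono) auto
  also have "\<dots> \<le> measure \<eta> (forest \<inter> A) + measure \<eta> B"
    using A B forest_edge_sets by (intro measure_Un_le) auto
  finally show ?thesis unfolding 1 .
qed

text \<open>On all of \<open>?F\<close> rank and edge measure agree, and adding
  \<open>?F - A\<close> to \<open>A\<close> raises the rank by at most its edge measure, so
  \<open>A\<close> must account for the rest. The bound \<open>rank_Un_le\<close> comes from an
  order of its own and is not tied to the present forest.\<close>

lemma (in ordered_graphing) forest_le_rank:
  assumes U: "up_closed U" "U \<in> edge_sets E" and A: "A \<in> edge_sets E" "A \<subseteq> forest \<inter> U"
  shows "emeasure \<eta> A \<le> ennreal (rank \<mu> A)"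
proof -
  interpret \<eta>: finite_measure \<eta> by (rule finite_measure_edge_measure)
  let ?F = "forest \<inter> U"
  have F: "?F \<in> edge_sets E" using forest_edge_sets U(2) by blast
  have "measure \<eta> ?F = rank \<mu> U"
    using emeasure_forest_up_closed[OF U] by (simp add: measure_def rank_eq[OF U(2)])
  also have "\<dots> = rank \<mu> (A \<union> (?F - A))" using rank_forest[OF U] A(2) by (simp add: Un_absorb1)
  also have "\<dots> \<le> rank \<mu> A + measure \<eta> (?F - A)" using A(1) F by (intro rank_Un_le) auto
  finally have "measure \<eta> A \<le> rank \<mu> A"
    using \<eta>.finite_measure_Diff[of ?F A] F A by simp
  then show ?thesis by (simp add: \<eta>.emeasure_eq_measure ennreal_leI)
qed

section \<open>Optimality of the forest\<close>

text \<open>\<open>ennreal\<close> cuts off negative values, so the left side is the integral of the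
  positive part and levels \<open>t \<ge> 0\<close> are enough.\<close>

lemma (in finite_measure) nn_integral_layer_cake:
  fixes g :: "'a \<Rightarrow> real"
  assumes [measurable]: "g \<in> borel_measurable M"
  shows "(\<integral>\<^sup>+ x. ennreal (g x) \<partial>M) = (\<integral>\<^sup>+ t\<in>{0..}. emeasure M {x\<in>space M. t < g x} \<partial>lborel)"
proof -
  interpret pair_sigma_finite M lborel ..
  have "ennreal (g x) = (\<integral>\<^sup>+ t. indicator {(x, t). 0 \<le> t \<and> t < g x} (x, t) \<partial>lborel)" for x
  proof -
    have "(\<lambda>t. indicator {(x, t). 0 \<le> t \<and> t < g x} (x, t)) = (indicator {0..<g x} :: real \<Rightarrow> ennreal)"
      by (auto simp: indicator_def fun_eq_iff)
    then show ?thesis by (cases "0 \<le> g x") (auto simp: ennreal_neg)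
  qed
  then have "(\<integral>\<^sup>+ x. ennreal (g x) \<partial>M) = (\<integral>\<^sup>+ x. (\<integral>\<^sup>+ t. indicator {(x, t). 0 \<le> t \<and> t < g x} (x, t) \<partial>lborel) \<partial>M)"
    by simp
  also have "\<dots> = (\<integral>\<^sup>+ t. (\<integral>\<^sup>+ x. indicator {(x, t). 0 \<le> t \<and> t < g x} (x, t) \<partial>M) \<partial>lborel)"
  proof (rule Fubini'[symmetric])
    have "Measurable.pred (M \<Otimes>\<^sub>M lborel) (\<lambda>p. 0 \<le> snd p \<and> snd p < g (fst p))" by measurable
    then have "(\<lambda>p. if 0 \<le> snd p \<and> snd p < g (fst p) then 1 else 0 :: ennreal) \<in> borel_measurable (M \<Otimes>\<^sub>M lborel)"
      by measurable
    then show "case_prod (\<lambda>x t. indicator {(x, t). 0 \<le> t \<and> t < g x} (x, t) :: ennreal) \<in> borel_measurable (M \<Otimes>\<^sub>M lborel)"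
      by (rule measurable_cong[THEN iffD1, rotated]) (auto simp: indicator_def)
  qed
  also have "\<dots> = (\<integral>\<^sup>+ t\<in>{0..}. emeasure M {x\<in>space M. t < g x} \<partial>lborel)"
  proof (rule nn_integral_cong)
    fix t :: real
    have "(\<integral>\<^sup>+ x. indicator {(x, t). 0 \<le> t \<and> t < g x} (x, t) \<partial>M) = (\<integral>\<^sup>+ x. indicator {0..} t * indicator {x\<in>space M. t < g x} x \<partial>M)"
      by (rule nn_integral_cong) (auto simp: indicator_def)
    also have "\<dots> = emeasure M {x\<in>space M. t < g x} * indicator {0..} t"
      by (subst nn_integral_cmult_indicator) (auto simp: mult.commute)
    finally show "(\<integral>\<^sup>+ x. indicator {(x, t). 0 \<le> t \<and> t < g x} (x, t) \<partial>M) = emeasure M {x\<in>space M. t < g x} * indicator {0..} t" .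
  qed
  finally show ?thesis .
qed

section \<open>Measures bounded by the rank and their densities\<close>

context graphing_space
begin

sublocale \<eta>: finite_measure \<eta>
  by (rule finite_measure_edge_measure)

lemma mm_plusD:
  assumes "\<gamma> \<in> mm_plus \<mu> E"
  shows "sets \<gamma> = edge_sets E" "space \<gamma> = E" "finite_measure \<gamma>" "absolutely_continuous \<eta> \<gamma>"
    "\<And>A. A \<in> edge_sets E \<Longrightarrow> emeasure \<gamma> A \<le> ennreal (rank \<mu> A)"
proof -
  show sets: "sets \<gamma> = edge_sets E" using assms by (simp add: mm_plus_def)
  have "sets \<gamma> = sets \<eta>" by (simp add: sets)
  from sets_eq_imp_space_eq[OF this] show space: "space \<gamma> = E" by simp
  show le: "emeasure \<gamma> A \<le> ennreal (rank \<mu> A)" if "A \<in> edge_sets E" for A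
    using assms that by (simp add: mm_plus_def)
  have E: "E \<in> edge_sets E" by (simp add: edge_sets_def)
  show "finite_measure \<gamma>"
    by (rule finite_measureI) (use le[OF E] in \<open>auto simp: space top_unique\<close>)
  show "absolutely_continuous \<eta> \<gamma>"
    unfolding absolutely_continuous_def null_sets_def using le rank_null by (force simp: sets)
qed

lemma rn_density_nonneg: "0 \<le> rn_density \<mu> E \<gamma> e"
  by (simp add: rn_density_def)

lemma rn_density_measurable [measurable]: "rn_density \<mu> E \<gamma> \<in> borel_measurable \<eta>"
  unfolding rn_density_def by measurable

lemma nn_integral_rn_density:
  assumes \<gamma>: "\<gamma> \<in> mm_plus \<mu> E" and h[measurable]: "h \<in> borel_measurable \<eta>"
  shows "(\<integral>\<^sup>+ e. ennreal (rn_density \<mu> E \<gamma> e * h e) \<partial>\<eta>) = (\<integral>\<^sup>+ e. ennreal (h e) \<partial>\<gamma>)"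
proof -
  interpret \<gamma>: finite_measure \<gamma> using \<gamma> by (rule mm_plusD)
  have s: "sets \<gamma> = sets \<eta>" using mm_plusD(1)[OF \<gamma>] by simp
  have "(\<integral>\<^sup>+ e. ennreal (h e) \<partial>\<gamma>) = (\<integral>\<^sup>+ e. RN_deriv \<eta> \<gamma> e * ennreal (h e) \<partial>\<eta>)"
    by (rule \<eta>.RN_deriv_nn_integral[OF mm_plusD(4)[OF \<gamma>] s]) measurable
  also have "\<dots> = (\<integral>\<^sup>+ e. ennreal (rn_density \<mu> E \<gamma> e * h e) \<partial>\<eta>)"
  proof (rule nn_integral_cong_AE)
    show "AE e in \<eta>. RN_deriv \<eta> \<gamma> e * ennreal (h e) = ennreal (rn_density \<mu> E \<gamma> e * h e)"
      using \<eta>.RN_deriv_finite[OF \<gamma>.sigma_finite_measure_axioms mm_plusD(4)[OF \<gamma>] s]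
      by eventually_elim (simp add: rn_density_def ennreal_mult' less_top)
  qed
  finally show ?thesis by simp
qed

lemma integrable_rn_density_mult:
  assumes \<gamma>: "\<gamma> \<in> mm_plus \<mu> E" and h[measurable]: "h \<in> borel_measurable \<eta>"
    and bd: "AE e in \<eta>. \<bar>h e\<bar> \<le> C"
  shows "integrable \<eta> (\<lambda>e. rn_density \<mu> E \<gamma> e * h e)"
proof (rule Bochner_Integration.integrable_bound)
  interpret \<gamma>: finite_measure \<gamma> using \<gamma> by (rule mm_plusD)
  have "integrable \<eta> (rn_density \<mu> E \<gamma>)"
    using nn_integral_rn_density[OF \<gamma>, of "\<lambda>_. 1"] \<gamma>.emeasure_finite[of "space \<gamma>"]
    by (intro integrableI_nonneg) (auto simp: rn_density_nonneg less_top[symmetric])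
  then show "integrable \<eta> (\<lambda>e. rn_density \<mu> E \<gamma> e * C)" by simp
  show "AE e in \<eta>. norm (rn_density \<mu> E \<gamma> e * h e) \<le> norm (rn_density \<mu> E \<gamma> e * C)"
    using bd by eventually_elim (auto simp: abs_mult intro!: mult_left_mono)
qed measurable

text \<open>The function \<open>g\<close> is controlled only on \<open>E\<close>, whereas an edge
  order lives on all unordered pairs; extension by 0 makes it a weight there.\<close>

lemma restricted_weight_measurable:
  assumes g: "g \<in> borel_measurable \<eta>"
  shows "(\<lambda>p. if Upair (fst p) (snd p) \<in> E then g (Upair (fst p) (snd p)) else 0 :: real) \<in> borel_measurable (borel \<Otimes>\<^sub>M borel)"
    (is "?w \<in> _")
proof (rule measurableI)
  fix B :: "real set" assume B: "B \<in> sets borel"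
  have "g -` B \<inter> E \<in> edge_sets E" using measurable_sets[OF g B] by simp
  then have [measurable]: "pairs_of (g -` B \<inter> E) \<in> sets (borel \<Otimes>\<^sub>M borel)" by (rule edge_setsD)
  have "?w -` B \<inter> space (borel \<Otimes>\<^sub>M borel) =
      pairs_of (g -` B \<inter> E) \<union> (if 0 \<in> B then space (borel \<Otimes>\<^sub>M borel) - pairs_of E else {})"
    by (auto simp: pairs_of_def space_pair_measure split: if_splits)
  also have "\<dots> \<in> sets (borel \<Otimes>\<^sub>M borel)" by simp
  finally show "?w -` B \<inter> space (borel \<Otimes>\<^sub>M borel) \<in> sets (borel \<Otimes>\<^sub>M borel)" .
qed simp

text \<open>The edge measure restricted to \<open>F\<close> attains on every set
  \<open>{g > t}\<close> with \<open>t \<ge> 0\<close> the largest value that \<open>mm_plus\<close>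
  allows, namely its rank, and the integral of the positive part of \<open>g\<close> is monotone in
  these values.\<close>

lemma optimal_edge_set:
  assumes g[measurable]: "g \<in> borel_measurable \<eta>"
  obtains F where "F \<in> edge_sets E" "\<And>e. e \<in> F \<Longrightarrow> 0 < g e" "density \<eta> (indicator F) \<in> mm_plus \<mu> E"
    "\<And>\<gamma>. \<gamma> \<in> mm_plus \<mu> E \<Longrightarrow> (\<integral>\<^sup>+ e. ennreal (g e) \<partial>\<gamma>) \<le> (\<integral>\<^sup>+ e. ennreal (g e) \<partial>density \<eta> (indicator F))"
proof -
  obtain above where o: "ordered_graphing \<mu> E above"
    and w: "\<And>e e'. above e e' \<Longrightarrow> (if e' \<in> E then g e' else 0) \<le> (if e \<in> E then g e else 0)"
    using ordered_graphing_by_weight[OF restricted_weight_measurable[OF g]] by metis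
  interpret ordered_graphing \<mu> E above by (rule o)
  define H where "H t = {e\<in>E. t < g e}" for t
  have H[measurable]: "H t \<in> edge_sets E" for t
    using measurable_sets[OF g, of "{t<..}"] by (simp add: H_def vimage_def Int_def conj_commute)
  have upH: "up_closed (H t)" for t
    using w unfolding up_closed_def upc_def H_def by (force split: if_splits)
  \<comment> \<open>Edges with \<open>g \<le> 0\<close> are dropped: they could not raise the
    integral of \<open>g\<close>, and they lie in no level set with
    \<open>t \<ge> 0\<close>.\<close>
  define F where "F = forest \<inter> H 0"
  have F: "F \<in> edge_sets E" unfolding F_def using forest_edge_sets H by blast
  define \<beta> where "\<beta> = density \<eta> (indicator F)"
  have \<beta>: "emeasure \<beta> A = emeasure \<eta> (F \<inter> A)" if "A \<in> edge_sets E" for A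
  proof -
    have FA: "F \<in> sets \<eta>" "A \<in> sets \<eta>" using F that by simp_all
    then have "emeasure \<beta> A = (\<integral>\<^sup>+ e. indicator (F \<inter> A) e \<partial>\<eta>)"
      unfolding \<beta>_def indicator_inter_arith by (intro emeasure_density borel_measurable_indicator)
    also have "\<dots> = emeasure \<eta> (F \<inter> A)" using FA by (intro nn_integral_indicator sets.Int)
    finally show ?thesis .
  qed
  have \<beta>_mm: "\<beta> \<in> mm_plus \<mu> E"
  proof -
    have "emeasure \<beta> A \<le> ennreal (rank \<mu> A)" if A: "A \<in> edge_sets E" for A
    proof -
      have FA: "F \<inter> A \<in> edge_sets E" using F A by blast
      have "emeasure \<beta> A \<le> ennreal (rank \<mu> (F \<inter> A))"
        unfolding \<beta>[OF A] by (rule forest_le_rank[OF upH H FA]) (auto simp: F_def)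
      also have "\<dots> \<le> ennreal (rank \<mu> A)" using FA A by (intro ennreal_leI rank_mono) auto
      finally show ?thesis .
    qed
    then show ?thesis by (simp add: mm_plus_def \<beta>_def)
  qed
  have "(\<integral>\<^sup>+ e. ennreal (g e) \<partial>\<gamma>) \<le> (\<integral>\<^sup>+ e. ennreal (g e) \<partial>\<beta>)" if \<gamma>: "\<gamma> \<in> mm_plus \<mu> E" for \<gamma>
  proof -
    interpret \<gamma>: finite_measure \<gamma> using \<gamma> by (rule mm_plusD)
    interpret \<beta>: finite_measure \<beta> using \<beta>_mm by (rule mm_plusD)
    have g_meas: "g \<in> borel_measurable \<gamma>" "g \<in> borel_measurable \<beta>"
      using g measurable_cong_sets[of \<gamma> \<eta> borel borel] mm_plusD(1)[OF \<gamma>]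
        measurable_cong_sets[of \<beta> \<eta> borel borel] mm_plusD(1)[OF \<beta>_mm] by auto
    have "(\<integral>\<^sup>+ e. ennreal (g e) \<partial>\<gamma>) = (\<integral>\<^sup>+ t\<in>{0..}. emeasure \<gamma> (H t) \<partial>lborel)"
      using \<gamma>.nn_integral_layer_cake[OF g_meas(1)] mm_plusD(2)[OF \<gamma>] by (simp add: H_def)
    also have "\<dots> \<le> (\<integral>\<^sup>+ t\<in>{0..}. emeasure \<beta> (H t) \<partial>lborel)"
    proof (rule nn_integral_mono)
      fix t :: real
      have "emeasure \<gamma> (H t) \<le> emeasure \<beta> (H t)" if "0 \<le> t"
      proof -
        have "F \<inter> H t = forest \<inter> H t" using that by (auto simp: F_def H_def)
        then have "emeasure \<beta> (H t) = ennreal (rank \<mu> (H t))"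
          using \<beta>[OF H] emeasure_forest_up_closed[OF upH H] by simp
        then show ?thesis using mm_plusD(5)[OF \<gamma> H] by simp
      qed
      then show "emeasure \<gamma> (H t) * indicator {0..} t \<le> emeasure \<beta> (H t) * indicator {0..} t"
        by (auto simp: indicator_def)
    qed
    also have "\<dots> = (\<integral>\<^sup>+ e. ennreal (g e) \<partial>\<beta>)"
      using \<beta>.nn_integral_layer_cake[OF g_meas(2)] mm_plusD(2)[OF \<beta>_mm] by (simp add: H_def)
    finally show ?thesis .
  qed
  moreover have "0 < g e" if "e \<in> F" for e using that by (simp add: F_def H_def)
  ultimately show ?thesis using F \<beta>_mm that[of F] unfolding \<beta>_def by metis
qed

end

theorem theorem4p4:
  fixes \<mu> :: "'a::polish_space measure" and E :: "'a uprod set"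
    and \<alpha> :: "'a uprod measure" and g :: "'a uprod \<Rightarrow> real"
  assumes "graphing \<mu> E"
    and "\<alpha> \<in> mm_plus \<mu> E"
    and "g \<in> borel_measurable (edge_measure \<mu> E)"
    and "\<exists>C. AE e in edge_measure \<mu> E. \<bar>g e\<bar> \<le> C"
    and "\<forall>\<beta> \<in> mm_plus \<mu> E.
           \<not> (AE e in edge_measure \<mu> E. rn_density \<mu> E \<beta> e = rn_density \<mu> E \<alpha> e) \<longrightarrow>
           (\<integral>e. rn_density \<mu> E \<alpha> e * g e \<partial>edge_measure \<mu> E)
             > (\<integral>e. rn_density \<mu> E \<beta> e * g e \<partial>edge_measure \<mu> E)"
  shows "AE e in edge_measure \<mu> E. rn_density \<mu> E \<alpha> e \<in> {0, 1}"
proof -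
  interpret graphing_space \<mu> E by unfold_locales (rule assms(1))
  note \<alpha> = assms(2) and g[measurable] = assms(3)
  obtain C where C: "AE e in \<eta>. \<bar>g e\<bar> \<le> C" using assms(4) by blast
  obtain F where F: "F \<in> edge_sets E" "\<And>e. e \<in> F \<Longrightarrow> 0 < g e" and mm: "density \<eta> (indicator F) \<in> mm_plus \<mu> E"
    and opt: "(\<integral>\<^sup>+ e. ennreal (g e) \<partial>\<alpha>) \<le> (\<integral>\<^sup>+ e. ennreal (g e) \<partial>density \<eta> (indicator F))"
    using optimal_edge_set[OF g] \<alpha> by metis
  define \<beta> where "\<beta> = density \<eta> (indicator F :: _ \<Rightarrow> ennreal)"
  define f where "f \<gamma> = rn_density \<mu> E \<gamma>" for \<gamma>
  have f\<beta>: "AE e in \<eta>. f \<beta> e = indicator F e"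
  proof -
    have "(indicator F :: _ \<Rightarrow> ennreal) \<in> borel_measurable \<eta>"
      by (rule borel_measurable_indicator) (simp add: F(1))
    from \<eta>.RN_deriv_unique[OF this refl] show ?thesis
      unfolding f_def rn_density_def \<beta>_def by eventually_elim (auto simp: indicator_def dest: sym)
  qed
  have bd: "AE e in \<eta>. \<bar>max 0 (g e)\<bar> \<le> C" using C by eventually_elim auto
  have gp[measurable]: "(\<lambda>e. max 0 (g e)) \<in> borel_measurable \<eta>" by measurable
  \<comment> \<open>\<open>ennreal (g e)\<close> is already the positive part, so this expresses the
    real integral by the quantity that \<open>F\<close> maximises.\<close>
  have pos_part: "(\<integral>e. f \<gamma> e * max 0 (g e) \<partial>\<eta>) = enn2real (\<integral>\<^sup>+ e. ennreal (g e) \<partial>\<gamma>)"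
    and fin: "(\<integral>\<^sup>+ e. ennreal (g e) \<partial>\<gamma>) < \<infinity>" if \<gamma>: "\<gamma> \<in> mm_plus \<mu> E" for \<gamma>
  proof -
    have "(\<integral>\<^sup>+ e. ennreal (f \<gamma> e * max 0 (g e)) \<partial>\<eta>) = (\<integral>\<^sup>+ e. ennreal (max 0 (g e)) \<partial>\<gamma>)"
      unfolding f_def by (rule nn_integral_rn_density[OF \<gamma> gp])
    also have "\<dots> = (\<integral>\<^sup>+ e. ennreal (g e) \<partial>\<gamma>)" by (simp add: ennreal_max_0)
    finally have *: "(\<integral>\<^sup>+ e. ennreal (f \<gamma> e * max 0 (g e)) \<partial>\<eta>) = (\<integral>\<^sup>+ e. ennreal (g e) \<partial>\<gamma>)" .
    have nn: "AE e in \<eta>. 0 \<le> f \<gamma> e * max 0 (g e)" by (simp add: f_def rn_density_nonneg)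
    have int: "integrable \<eta> (\<lambda>e. f \<gamma> e * max 0 (g e))"
      unfolding f_def by (rule integrable_rn_density_mult[OF \<gamma> gp bd])
    show "(\<integral>e. f \<gamma> e * max 0 (g e) \<partial>\<eta>) = enn2real (\<integral>\<^sup>+ e. ennreal (g e) \<partial>\<gamma>)"
      using integral_eq_nn_integral[OF borel_measurable_integrable[OF int] nn] * by simp
    show "(\<integral>\<^sup>+ e. ennreal (g e) \<partial>\<gamma>) < \<infinity>"
      using nn_integral_eq_integral[OF int nn] * by simp
  qed
  \<comment> \<open>Passing to the positive part can only increase the value for \<alpha>; for
    \<beta> nothing changes, since its density vanishes almost everywhere off \<open>F\<close> and
    \<open>g\<close> is positive on \<open>F\<close>.\<close>
  have "(\<integral>e. f \<alpha> e * g e \<partial>\<eta>) \<le> (\<integral>e. f \<alpha> e * max 0 (g e) \<partial>\<eta>)"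
    unfolding f_def
    by (intro integral_mono integrable_rn_density_mult[OF \<alpha> g C] integrable_rn_density_mult[OF \<alpha> gp bd]
        mult_left_mono rn_density_nonneg) simp
  also have "\<dots> \<le> (\<integral>e. f \<beta> e * max 0 (g e) \<partial>\<eta>)"
    unfolding pos_part[OF \<alpha>] \<beta>_def pos_part[OF mm] using opt fin[OF mm] by (intro enn2real_mono) auto
  also have "\<dots> = (\<integral>e. f \<beta> e * g e \<partial>\<eta>)"
  proof (rule integral_cong_AE)
    show "AE e in \<eta>. f \<beta> e * max 0 (g e) = f \<beta> e * g e"
      using f\<beta> by eventually_elim (auto simp: indicator_def dest: F(2))
  qed (auto simp: f_def)
  finally have "\<not> (\<integral>e. f \<alpha> e * g e \<partial>\<eta>) > (\<integral>e. f \<beta> e * g e \<partial>\<eta>)" by simp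
  then have "AE e in \<eta>. f \<beta> e = f \<alpha> e"
    using assms(5) mm unfolding f_def \<beta>_def by blast
  with f\<beta> show ?thesis
    unfolding f_def by eventually_elim (auto simp: indicator_def)
qed

end
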